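(* Let $L_{\mathrm{IRW},0}$ be the generator of the independent random walkers process with source of intensity $\lambda$ at the origin and $\mathcal{L}$ the generator of the associated deterministic system. For every local function $f:\mathbb{N}^V\to\mathbb{R}$ such that $\mathcal{G}f$ exists and depends smoothly on $z$, $$\mathcal{G}L_{\mathrm{IRW},0}f=\mathcal{L}\,\mathcal{G}f.$$ As a consequence, for any $\rho:V\to[0,\infty)$, if $\nu_\rho$ denotes the product of Poisson measures with parameter $\rho(x)$ at $x\in V$, and $\nu_\rho(t)$ the measure obtained at time $t$ when starting the Markov process with generator $L_{\mathrm{IRW},0}$ from initial distribution $\nu_\rho$, then $$\nu_\rho(t)=\nu_{\rho_t},\qquad \rho_t(x)=\mathbb{E}_x(\rho(X_t))+\lambda\int_0^t\mathbb{E}_x(\delta_{X_s,0})\,ds,$$ where $z_x(t)=\rho_t(x)$ is the solution (obtained by variation of constants) of $\frac{dz_x(t)}{dt}=\sum_{y\in V}p(x,y)(z_y(t)-z_x(t))+\lambda\delta_{x,0}$ with initial condition $z_x(0)=\rho(x)$. The density $\rho_t(x)$ diverges as $t\to\infty$ if and only if the random walk with generator $L_{\mathrm{RW}}$ is recurrent. If this random walk is transient, then starting from a homogeneous Poisson product measure with (constant) density $\rho$, $\nu_\rho(t)$ converges, as $t\to\infty$, to the Poisson product measure with density $$\rho_\infty(x)=\rho+\lambda\int_0^\infty\mathbb{E}_x(\delta_{X_s,0})\,ds,$$ which is a solution of the equation $L_{\mathrm{RW}}f(x)=-\lambda\delta_{x,0}$.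
   Context: $V$ is a countable set with a distinguished vertex $0\in V$ (the origin), $\lambda\ge0$, and $(p(x,y))_{x,y\in V}$ is an irreducible symmetric random walk transition probability on $V$: $p(x,y)=p(y,x)\ge0$, $\sum_yp(x,y)=1$, and for all $x,y$ there is $n$ with $p^{(n)}(x,y)>0$ where $p^{(n)}(x,y)=\sum_{z_1,\dots,z_{n-1}}p(x,z_1)\cdots p(z_{n-1},y)$. $X_t$ is the continuous-time random walk with generator $L_{\mathrm{RW}}f(x)=\sum_{y}p(x,y)(f(y)-f(x))$, $\mathbb{E}_x$ its expectation from $X_0=x$; $\delta_{\cdot,\cdot}$ is the Kronecker symbol. $e_x$ is the configuration with a single particle at $x$, and $\eta^{x,y}=\eta-e_x+e_y$ when $\eta_x\ge1$. The independent random walkers process with source of intensity $\lambda$ at $0$ is the process on $\mathbb{N}^V$ ($\mathbb{N}=\{0,1,2,\dots\}$) in which all particles perform independent random walks with generator $L_{\mathrm{RW}}$ and, independently, new particles are added at $0$ at rate $\lambda$. Its formal generator on local functions (depending on finitely many coordinates) is $$L_{\mathrm{IRW},0}f(\eta)=\sum_{\{x,y\}}p(x,y)\big(\eta_x(f(\eta^{x,y})-f(\eta))+\eta_y(f(\eta^{y,x})-f(\eta))\big)+\lambda(f(\eta+e_0)-f(\eta)),$$ the sum being over unordered pairs of distinct sites of $V$. For a local function $f$ depending on $\eta_i,i\in\Lambda$ ($\Lambda\subset V$ finite) and $z\in\mathbb{R}^V$, $$\mathcal{G}f(z)=\sum_{\eta_i\in\mathbb{N},\,i\in\Lambda}\ \prod_{i\in\Lambda}\frac{z_i^{\eta_i}}{\eta_i!}e^{-z_i}\,f(\eta_i,i\in\Lambda),$$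 where "exists" means absolute convergence of the series; $\mathcal{G}$ is applied to $L_{\mathrm{IRW},0}f$ term by term, each term of the sum being a local function. For local smooth $f$ on $\mathbb{R}^V$, with $\partial_x=\partial/\partial z_x$, $$\mathcal{L}f(z)=-\sum_{\{x,y\}}p(x,y)(z_x-z_y)(\partial_x-\partial_y)f(z)+\lambda\,\partial_0f(z),$$ the sum over unordered pairs; $\mathcal{L}$ is the generator of the deterministic system $\frac{dz_x(t)}{dt}=\sum_{y}p(x,y)(z_y(t)-z_x(t))+\lambda\delta_{x,0}$.
   Formalization: The equivalence "the density diverges iff the walk is recurrent" is proved for λ > 0 and bounded ρ (recurrence implies divergence for every ρ ≥ 0, λ > 0); it fails for λ = 0, ρ = 0, and for ρ(x) = |x|² on Z³. The differential equation is stated while ρ_t is finite. *)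

theory Defs
  imports "HOL-Probability.Probability"
begin

section \<open>The random walk\<close>

fun nstep :: "('v \<Rightarrow> 'v \<Rightarrow> real) \<Rightarrow> nat \<Rightarrow> 'v \<Rightarrow> 'v \<Rightarrow> real" where
  "nstep p 0 x y = of_bool (x = y)"
| "nstep p (Suc n) x y = (\<Sum>\<^sub>\<infinity>z. p x z * nstep p n z y)"

definition irreducible_symmetric_rw :: "('v \<Rightarrow> 'v \<Rightarrow> real) \<Rightarrow> bool" where
  "irreducible_symmetric_rw p \<longleftrightarrow>
     (\<forall>x y. 0 \<le> p x y) \<and> (\<forall>x y. p x y = p y x) \<and>
     (\<forall>x. (p x has_sum 1) UNIV) \<and>
     (\<forall>x y. \<exists>n\<ge>1. 0 < nstep p n x y)"

definition L_RW :: "('v \<Rightarrow> 'v \<Rightarrow> real) \<Rightarrow> ('v \<Rightarrow> real) \<Rightarrow> 'v \<Rightarrow> real" where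
  "L_RW p f x = (\<Sum>\<^sub>\<infinity>y. p x y * (f y - f x))"

text \<open>The walk with generator \<^const>\<open>L_RW\<close> waits independent exponential times of
  rate 1 and then jumps according to \<open>p\<close> (a ``jump'' from \<open>x\<close> to \<open>x\<close>, of probability \<open>p x x\<close>, has
  no effect).  The randomness of one walk is a pair \<open>(U, H)\<close>: all \<open>U n x\<close> are independent with law
  \<open>p x\<close>, so that iterating the random maps \<open>U n\<close> yields the Markov chain with transition
  matrix \<open>p\<close>, and \<open>H n\<close> are the holding times.\<close>

type_synonym 'v walk_data = "(nat \<Rightarrow> 'v \<Rightarrow> 'v) \<times> (nat \<Rightarrow> real)"

definition exp_clock :: "real measure" where
  "exp_clock = density lborel (exponential_density 1)"

definition walk_space :: "('v \<Rightarrow> 'v \<Rightarrow> real) \<Rightarrow> 'v walk_data measure" where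
  "walk_space p =
     (\<Pi>\<^sub>M n\<in>UNIV. \<Pi>\<^sub>M x\<in>UNIV. measure_pmf (embed_pmf (p x))) \<Otimes>\<^sub>M (\<Pi>\<^sub>M n\<in>UNIV. exp_clock)"

fun skeleton :: "'v \<Rightarrow> (nat \<Rightarrow> 'v \<Rightarrow> 'v) \<Rightarrow> nat \<Rightarrow> 'v" where
  "skeleton x U 0 = x"
| "skeleton x U (Suc n) = U n (skeleton x U n)"

text \<open>The set of jumps performed up to time \<open>t\<close> is almost surely finite.\<close>

definition walk :: "'v \<Rightarrow> 'v walk_data \<Rightarrow> real \<Rightarrow> 'v" where
  "walk x \<omega> t = skeleton x (fst \<omega>) (card {n. (\<Sum>k\<le>n. snd \<omega> k) \<le> t})"

definition rw_expect :: "('v \<Rightarrow> 'v \<Rightarrow> real) \<Rightarrow> 'v \<Rightarrow> real \<Rightarrow> ('v \<Rightarrow> ennreal) \<Rightarrow> ennreal" where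
  "rw_expect p x t g = (\<integral>\<^sup>+\<omega>. g (walk x \<omega> t) \<partial>walk_space p)"

definition rw_recurrent :: "('v \<Rightarrow> 'v \<Rightarrow> real) \<Rightarrow> bool" where
  "rw_recurrent p \<longleftrightarrow>
     (\<forall>x. AE \<omega> in walk_space p. \<not> bdd_above {t. 0 \<le> t \<and> walk x \<omega> t = x})"

abbreviation rw_transient :: "('v \<Rightarrow> 'v \<Rightarrow> real) \<Rightarrow> bool" where
  "rw_transient p \<equiv> \<not> rw_recurrent p"

section \<open>Generators\<close>

definition depends_on :: "'v set \<Rightarrow> (('v \<Rightarrow> 'a) \<Rightarrow> 'b) \<Rightarrow> bool" where
  "depends_on \<Lambda> f \<longleftrightarrow> (\<forall>\<eta> \<zeta>. (\<forall>x\<in>\<Lambda>. \<eta> x = \<zeta> x) \<longrightarrow> f \<eta> = f \<zeta>)"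

text \<open>Each unordered pair of distinct sites is listed exactly once, ordered by an injective
  enumeration of the sites; all summands below are symmetric in the two sites.\<close>

definition site_pairs :: "('v::countable \<times> 'v) set" where
  "site_pairs = {(x, y). to_nat x < to_nat y}"

text \<open>For \<open>\<eta> x = 0\<close> the value of \<open>hop x y \<eta>\<close> is irrelevant: it only occurs with the factor \<open>\<eta> x\<close>.\<close>

definition hop :: "'v \<Rightarrow> 'v \<Rightarrow> ('v \<Rightarrow> nat) \<Rightarrow> ('v \<Rightarrow> nat)" where
  "hop x y \<eta> = \<eta>(x := \<eta> x - 1, y := \<eta> y + 1)"

text \<open>The formal generator is the sum of \<open>irw_pair_term\<close> over \<^const>\<open>site_pairs\<close>
  plus \<open>irw_source_term\<close>.\<close>

definition irw_pair_term ::
    "('v \<Rightarrow> 'v \<Rightarrow> real) \<Rightarrow> (('v \<Rightarrow> nat) \<Rightarrow> real) \<Rightarrow> 'v \<Rightarrow> 'v \<Rightarrow> ('v \<Rightarrow> nat) \<Rightarrow> real" where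
  "irw_pair_term p f x y \<eta> =
     p x y * (real (\<eta> x) * (f (hop x y \<eta>) - f \<eta>) + real (\<eta> y) * (f (hop y x \<eta>) - f \<eta>))"

definition irw_source_term ::
    "'v \<Rightarrow> real \<Rightarrow> (('v \<Rightarrow> nat) \<Rightarrow> real) \<Rightarrow> ('v \<Rightarrow> nat) \<Rightarrow> real" where
  "irw_source_term orig lam f \<eta> = lam * (f (\<eta>(orig := \<eta> orig + 1)) - f \<eta>)"

text \<open>The transform of a function that depends on the coordinates in \<open>\<Lambda>\<close>: the multi-index
  \<open>(\<eta>\<^sub>i)\<close>, \<open>i \<in> \<Lambda>\<close>, is represented by its extension by 0.\<close>

definition G_summand :: "'v set \<Rightarrow> (('v \<Rightarrow> nat) \<Rightarrow> real) \<Rightarrow> ('v \<Rightarrow> real) \<Rightarrow> ('v \<Rightarrow> nat) \<Rightarrow> real" where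
  "G_summand \<Lambda> f z \<eta> = (\<Prod>i\<in>\<Lambda>. z i ^ \<eta> i / fact (\<eta> i) * exp (- z i)) * f \<eta>"

definition G_exists :: "'v set \<Rightarrow> (('v \<Rightarrow> nat) \<Rightarrow> real) \<Rightarrow> ('v \<Rightarrow> real) \<Rightarrow> bool" where
  "G_exists \<Lambda> f z \<longleftrightarrow> (\<lambda>\<eta>. \<bar>G_summand \<Lambda> f z \<eta>\<bar>) summable_on {\<eta>. \<forall>i. i \<notin> \<Lambda> \<longrightarrow> \<eta> i = 0}"

definition G_op :: "'v set \<Rightarrow> (('v \<Rightarrow> nat) \<Rightarrow> real) \<Rightarrow> ('v \<Rightarrow> real) \<Rightarrow> real" where
  "G_op \<Lambda> f z = (\<Sum>\<^sub>\<infinity>\<eta>\<in>{\<eta>. \<forall>i. i \<notin> \<Lambda> \<longrightarrow> \<eta> i = 0}. G_summand \<Lambda> f z \<eta>)"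

definition partial_deriv :: "'v \<Rightarrow> (('v \<Rightarrow> real) \<Rightarrow> real) \<Rightarrow> ('v \<Rightarrow> real) \<Rightarrow> real" where
  "partial_deriv x F z = deriv (\<lambda>s. F (z(x := s))) (z x)"

text \<open>Continuity below refers to the product topology on \<open>'v \<Rightarrow> real\<close>; for a local function this is
  continuity in the finitely many coordinates on which it depends.\<close>

definition smooth :: "(('v \<Rightarrow> real) \<Rightarrow> real) \<Rightarrow> bool" where
  "smooth F \<longleftrightarrow>
     (\<forall>xs. continuous_on UNIV (fold partial_deriv xs F) \<and>
        (\<forall>x z. (\<lambda>s. fold partial_deriv xs F (z(x := s))) differentiable (at (z x))))"

definition det_pair_term ::
    "('v \<Rightarrow> 'v \<Rightarrow> real) \<Rightarrow> (('v \<Rightarrow> real) \<Rightarrow> real) \<Rightarrow> ('v \<Rightarrow> real) \<Rightarrow> 'v \<Rightarrow> 'v \<Rightarrow> real" where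
  "det_pair_term p F z x y = p x y * (z x - z y) * (partial_deriv x F z - partial_deriv y F z)"

definition det_gen_converges ::
    "('v::countable \<Rightarrow> 'v \<Rightarrow> real) \<Rightarrow> (('v \<Rightarrow> real) \<Rightarrow> real) \<Rightarrow> ('v \<Rightarrow> real) \<Rightarrow> bool" where
  "det_gen_converges p F z \<longleftrightarrow> (\<lambda>(x, y). det_pair_term p F z x y) summable_on site_pairs"

definition det_gen ::
    "('v::countable \<Rightarrow> 'v \<Rightarrow> real) \<Rightarrow> 'v \<Rightarrow> real \<Rightarrow> (('v \<Rightarrow> real) \<Rightarrow> real) \<Rightarrow> ('v \<Rightarrow> real) \<Rightarrow> real" where
  "det_gen p orig lam F z =
     - (\<Sum>\<^sub>\<infinity>(x, y)\<in>site_pairs. det_pair_term p F z x y) + lam * partial_deriv orig F z"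

text \<open>The transform of the formal generator applied to \<open>f\<close>, term by term, for \<open>f\<close> depending
  on the coordinates in \<open>\<Lambda>\<close>.\<close>

definition G_irw_gen_converges ::
    "('v::countable \<Rightarrow> 'v \<Rightarrow> real) \<Rightarrow> 'v set \<Rightarrow> (('v \<Rightarrow> nat) \<Rightarrow> real) \<Rightarrow> ('v \<Rightarrow> real) \<Rightarrow> bool" where
  "G_irw_gen_converges p \<Lambda> f z \<longleftrightarrow>
     (\<lambda>(x, y). G_op (\<Lambda> \<union> {x, y}) (irw_pair_term p f x y) z) summable_on site_pairs"

definition G_irw_gen ::
    "('v::countable \<Rightarrow> 'v \<Rightarrow> real) \<Rightarrow> 'v \<Rightarrow> real \<Rightarrow> 'v set \<Rightarrow> (('v \<Rightarrow> nat) \<Rightarrow> real) \<Rightarrow> ('v \<Rightarrow> real) \<Rightarrow> real"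
  where
  "G_irw_gen p orig lam \<Lambda> f z =
     (\<Sum>\<^sub>\<infinity>(x, y)\<in>site_pairs. G_op (\<Lambda> \<union> {x, y}) (irw_pair_term p f x y) z)
     + G_op (\<Lambda> \<union> {orig}) (irw_source_term orig lam f) z"

section \<open>The process of independent walkers with source\<close>

text \<open>Configurations take values in \<^typ>\<open>enat\<close>, because for unbounded initial densities infinitely many
  particles may be at the same site at a positive time.  The Poisson law with parameter
  \<open>\<infinity>\<close> is the point mass at \<open>\<infinity>\<close>; the Poisson law with finite parameter lives on the finite numbers.\<close>

definition poisson_enat :: "ennreal \<Rightarrow> enat pmf" where
  "poisson_enat r =
     (if r = \<infinity> then return_pmf \<infinity>
      else if r = 0 then return_pmf 0
      else map_pmf enat (poisson_pmf (enn2real r)))"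

definition poisson_product :: "('v \<Rightarrow> ennreal) \<Rightarrow> ('v \<Rightarrow> enat) measure" where
  "poisson_product r = (\<Pi>\<^sub>M x\<in>UNIV. measure_pmf (poisson_enat (r x)))"

definition ecount :: "'a set \<Rightarrow> enat" where
  "ecount A = (if finite A then enat (card A) else \<infinity>)"

text \<open>Independent ingredients: the initial configuration \<open>\<eta>0\<close> with law \<open>\<mu>\<close>; the walk \<open>W (y, k)\<close> of the
  \<open>k\<close>-th particle initially at \<open>y\<close>; exponential times \<open>E\<close> that determine the arrivals at the
  source; the walk \<open>Y j\<close> of the \<open>j\<close>-th particle added at the source.\<close>

type_synonym 'v irw_data =
  "('v \<Rightarrow> enat) \<times> ('v \<times> nat \<Rightarrow> 'v walk_data) \<times> (nat \<Rightarrow> real) \<times> (nat \<Rightarrow> 'v walk_data)"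

definition irw_space :: "('v \<Rightarrow> 'v \<Rightarrow> real) \<Rightarrow> ('v \<Rightarrow> enat) measure \<Rightarrow> 'v irw_data measure" where
  "irw_space p \<mu> =
     \<mu> \<Otimes>\<^sub>M (\<Pi>\<^sub>M i\<in>UNIV. walk_space p) \<Otimes>\<^sub>M (\<Pi>\<^sub>M j\<in>UNIV. exp_clock) \<Otimes>\<^sub>M (\<Pi>\<^sub>M j\<in>UNIV. walk_space p)"

text \<open>For \<open>lam > 0\<close> the arrival times form a Poisson process of rate \<open>lam\<close>; for \<open>lam = 0\<close>
  nothing arrives.\<close>

definition arrival :: "real \<Rightarrow> (nat \<Rightarrow> real) \<Rightarrow> nat \<Rightarrow> real" where
  "arrival lam E j = (\<Sum>i\<le>j. E i) / lam"

fun irw_config :: "'v \<Rightarrow> real \<Rightarrow> 'v irw_data \<Rightarrow> real \<Rightarrow> 'v \<Rightarrow> enat" where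
  "irw_config orig lam (\<eta>0, W, E, Y) t x =
     ecount {(y, k). enat k < \<eta>0 y \<and> walk y (W (y, k)) t = x} +
     ecount {j. 0 < lam \<and> arrival lam E j \<le> t \<and> walk orig (Y j) (t - arrival lam E j) = x}"

definition irw_law ::
    "('v \<Rightarrow> 'v \<Rightarrow> real) \<Rightarrow> 'v \<Rightarrow> real \<Rightarrow> ('v \<Rightarrow> enat) measure \<Rightarrow> real \<Rightarrow> ('v \<Rightarrow> enat) measure" where
  "irw_law p orig lam \<mu> t =
     distr (irw_space p \<mu>) (\<Pi>\<^sub>M x\<in>UNIV. count_space UNIV) (\<lambda>\<omega>. irw_config orig lam \<omega> t)"

section \<open>Densities\<close>

definition rho_at ::
    "('v \<Rightarrow> 'v \<Rightarrow> real) \<Rightarrow> 'v \<Rightarrow> real \<Rightarrow> ('v \<Rightarrow> real) \<Rightarrow> real \<Rightarrow> 'v \<Rightarrow> ennreal" where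
  "rho_at p orig lam \<rho> t x =
     rw_expect p x t (\<lambda>y. ennreal (\<rho> y)) +
     ennreal lam * (\<integral>\<^sup>+s\<in>{0..t}. rw_expect p x s (\<lambda>y. of_bool (y = orig)) \<partial>lborel)"

definition rho_infinity :: "('v \<Rightarrow> 'v \<Rightarrow> real) \<Rightarrow> 'v \<Rightarrow> real \<Rightarrow> real \<Rightarrow> 'v \<Rightarrow> ennreal" where
  "rho_infinity p orig lam c x =
     ennreal c + ennreal lam * (\<integral>\<^sup>+s\<in>{0..}. rw_expect p x s (\<lambda>y. of_bool (y = orig)) \<partial>lborel)"

definition solves_det_system ::
    "('v \<Rightarrow> 'v \<Rightarrow> real) \<Rightarrow> 'v \<Rightarrow> real \<Rightarrow> real \<Rightarrow> (real \<Rightarrow> 'v \<Rightarrow> real) \<Rightarrow> bool" where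
  "solves_det_system p orig lam T z \<longleftrightarrow>
     (\<forall>x. \<forall>t\<in>{0..<T}.
        (\<lambda>y. p x y * (z t y - z t x)) summable_on UNIV \<and>
        ((\<lambda>s. z s x) has_real_derivative
           (\<Sum>\<^sub>\<infinity>y. p x y * (z t y - z t x)) + lam * of_bool (x = orig)) (at t within {0..<T}))"

text \<open>Weak convergence on the countable product of discrete spaces.  (The default topology of \<^typ>\<open>enat\<close>
  makes \<open>\<infinity>\<close> a limit of finite numbers; the discrete one admits more test functions
  and induces the usual topology on configurations of finite numbers.)\<close>

definition converges_weakly :: "(real \<Rightarrow> ('v \<Rightarrow> enat) measure) \<Rightarrow> ('v \<Rightarrow> enat) measure \<Rightarrow> bool" where
  "converges_weakly \<mu> \<nu> \<longleftrightarrow>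
     (\<forall>f :: ('v \<Rightarrow> enat) \<Rightarrow> real.
        continuous_map (product_topology (\<lambda>_. discrete_topology UNIV) UNIV) euclideanreal f \<and>
        bounded (range f) \<longrightarrow>
        ((\<lambda>t. \<integral>\<eta>. f \<eta> \<partial>\<mu> t) \<longlongrightarrow> (\<integral>\<eta>. f \<eta> \<partial>\<nu>)) at_top)"

end

theory Submission
  imports Defs
begin

text \<open>
  Independent particles preserve Poisson product laws: every particle is displaced independently of
  all others, so a Poisson number of particles per site is redistributed by independent thinning and
  superposition, and the occupation numbers stay independent Poisson variables. Their means are the
  initial density transported by the walk plus the mean number of particles that arrived at the
  source and sit at the given site. Everything else is an analysis of these means.

  \<^item> \<^emph>\<open>Generators.\<close> Under a Poisson law, adding a particle at \<open>x\<close> minus doing nothing turns into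
  \<open>\<partial>\<^sub>x\<close> (\<open>G_partial_deriv\<close>), and multiplication by the occupation number \<open>\<eta> x\<close> followed by removal of a
  particle turns into multiplication by \<open>z x\<close> (\<open>G_times_occupation\<close>). The identity of the generators
  therefore holds for each pair of sites separately (\<open>generator_duality\<close>).

  \<^item> \<^emph>\<open>Laws.\<close> The law of the occupation numbers is determined by its generating functions
  (\<open>config_measure_eqI\<close>), and these are products over the particles. An initial particle contributes the
  heat flow at its starting point, and averaging over Poisson numbers exponentiates; the arrivals at the
  source are handled by the renewal equation for the first arrival (locale \<open>thinning\<close>). Symmetry of
  \<open>p\<close> turns sums over starting points into expectations for the walk started at the observed site.
  The result is \<open>irw_law_poisson_product\<close>; it includes infinite densities, for which the
  generating function vanishes.

  \<^item> \<^emph>\<open>Deterministic system.\<close> Up to the factor \<open>exp (- t)\<close> the heat flow of a nonnegative function is a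
  power series in \<open>t\<close> with nonnegative coefficients, so finiteness up to time \<open>T\<close> already permits termwise
  differentiation (\<open>heat_flow\<close>). For uniqueness, two nonnegative solutions are compared with their sum:
  positivity forces the iterates \<open>P\<^sup>n\<close> of the sum to grow at most like \<open>n!\<close> times a geometric sequence, while
  the difference is an \<open>n\<close>-fold integral and gains a factor \<open>1 / n!\<close>
  (\<open>growth_bound\<close>, \<open>difference_bound\<close>).

  \<^item> \<^emph>\<open>Long times.\<close> The total time that the walk spends at a site has mean \<open>\<Sum>n. P\<^sup>n\<close>, the Green function.
  Decomposing according to the last visit shows that it is infinite exactly for recurrent walks
  (\<open>recurrent_iff_green_infinite\<close>). In the transient case the densities increase to a finite limit, and
  Poisson counts that are driven by common exponential clocks converge almost surely in every coordinate
  (\<open>poisson_product_converges_weakly\<close>).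
\<close>

section \<open>Duality of the generators\<close>

no_notation Infinite_Set_Sum.abs_summable_on (infix "abs'_summable'_on" 50)

abbreviation configs_on :: "'v set \<Rightarrow> ('v \<Rightarrow> nat) set" where
  "configs_on \<Lambda> \<equiv> {\<eta>. \<forall>i. i \<notin> \<Lambda> \<longrightarrow> \<eta> i = 0}"

abbreviation add_one :: "'v \<Rightarrow> (('v \<Rightarrow> nat) \<Rightarrow> real) \<Rightarrow> ('v \<Rightarrow> nat) \<Rightarrow> real" where
  "add_one x f \<equiv> \<lambda>\<eta>. f (\<eta>(x := \<eta> x + 1))"

lemma bij_configs_insert:
  assumes "x \<notin> \<Lambda>"
  shows "bij_betw (\<lambda>(n, \<zeta>). \<zeta>(x := n)) (UNIV \<times> configs_on \<Lambda>) (configs_on (insert x \<Lambda>))"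
  by (rule bij_betwI[where g = "\<lambda>\<eta>. (\<eta> x, \<eta>(x := 0))"])
     (use assms in \<open>auto simp: fun_eq_iff\<close>)

lemma G_summand_insert:
  assumes "finite \<Lambda>" "x \<notin> \<Lambda>"
  shows "G_summand (insert x \<Lambda>) f z (\<zeta>(x := n)) =
    z x ^ n / fact n * exp (- z x) * G_summand \<Lambda> (\<lambda>\<zeta>. f (\<zeta>(x := n))) z \<zeta>"
proof -
  have "(\<Prod>i\<in>\<Lambda>. z i ^ (\<zeta>(x := n)) i / fact ((\<zeta>(x := n)) i) * exp (- z i)) =
        (\<Prod>i\<in>\<Lambda>. z i ^ \<zeta> i / fact (\<zeta> i) * exp (- z i))"
    by (rule prod.cong) (use assms in auto)
  then show ?thesis using assms by (simp add: G_summand_def mult.assoc)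
qed

lemma G_exists_insert_iff:
  assumes "finite \<Lambda>" "x \<notin> \<Lambda>"
  shows "G_exists (insert x \<Lambda>) f z \<longleftrightarrow>
    (\<lambda>(n, \<zeta>). z x ^ n / fact n * exp (- z x) * G_summand \<Lambda> (\<lambda>\<zeta>. f (\<zeta>(x := n))) z \<zeta>)
      abs_summable_on UNIV \<times> configs_on \<Lambda>"
  unfolding G_exists_def
  by (subst summable_on_reindex_bij_betw[OF bij_configs_insert[OF assms(2)], symmetric])
     (simp add: case_prod_unfold G_summand_insert[OF assms])

lemma exp_has_sum: "((\<lambda>n. s ^ n / fact n * exp (- s)) has_sum (1::real)) UNIV"
proof (rule norm_summable_imp_has_sum)
  have "summable (\<lambda>n. \<bar>s\<bar> ^ n / fact n * exp (- s))"
    using summable_exp[of "\<bar>s\<bar>"] by (intro summable_mult2) (simp add: field_simps)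
  then show "summable (\<lambda>n. norm (s ^ n / fact n * exp (- s)))"
    by (simp add: abs_mult power_abs)
  have "(\<lambda>n. s ^ n /\<^sub>R fact n * exp (- s)) sums (exp s * exp (- s))"
    by (intro sums_mult2 exp_converges)
  then show "(\<lambda>n. s ^ n / fact n * exp (- s)) sums 1"
    by (simp add: exp_minus field_simps)
qed

text \<open>Summing over the coordinate \<open>x\<close> last exhibits the transform as a function of \<open>z x\<close> whose
  coefficients do not involve \<open>z x\<close>, which reduces derivatives to one-variable power series.\<close>

lemma G_insert_slices:
  assumes "finite \<Lambda>" "x \<notin> \<Lambda>" "G_exists (insert x \<Lambda>) f z"
  defines "c \<equiv> \<lambda>n. G_op \<Lambda> (\<lambda>\<zeta>. f (\<zeta>(x := n))) z"
  shows "G_op (insert x \<Lambda>) f z = (\<Sum>\<^sub>\<infinity>n. z x ^ n / fact n * exp (- z x) * c n)"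
    and "(\<lambda>n. z x ^ n / fact n * exp (- z x) * c n) abs_summable_on UNIV"
proof -
  let ?g = "\<lambda>n \<zeta>. z x ^ n / fact n * exp (- z x) * G_summand \<Lambda> (\<lambda>\<zeta>. f (\<zeta>(x := n))) z \<zeta>"
  have sm: "(\<lambda>(n, \<zeta>). ?g n \<zeta>) abs_summable_on UNIV \<times> configs_on \<Lambda>"
    using assms(3) G_exists_insert_iff[OF assms(1,2)] by blast
  have eq: "(\<Sum>\<^sub>\<infinity>\<zeta>\<in>configs_on \<Lambda>. ?g n \<zeta>) = z x ^ n / fact n * exp (- z x) * c n" for n
    unfolding c_def G_op_def by (rule infsum_cmult_right')
  have "G_op (insert x \<Lambda>) f z = (\<Sum>\<^sub>\<infinity>(n, \<zeta>)\<in>UNIV \<times> configs_on \<Lambda>. ?g n \<zeta>)"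
    unfolding G_op_def
    by (subst infsum_reindex_bij_betw[OF bij_configs_insert[OF assms(2)], symmetric])
       (simp add: case_prod_unfold G_summand_insert[OF assms(1,2)])
  also have "\<dots> = (\<Sum>\<^sub>\<infinity>n. \<Sum>\<^sub>\<infinity>\<zeta>\<in>configs_on \<Lambda>. ?g n \<zeta>)"
    using abs_summable_summable[OF sm] by (rule infsum_Sigma'_banach[symmetric])
  finally show "G_op (insert x \<Lambda>) f z = (\<Sum>\<^sub>\<infinity>n. z x ^ n / fact n * exp (- z x) * c n)"
    unfolding eq .
  have "(\<lambda>n. norm (\<Sum>\<^sub>\<infinity>\<zeta>\<in>configs_on \<Lambda>. ?g n \<zeta>)) summable_on UNIV"
  proof (rule summable_on_comparison_test)
    show "(\<lambda>n. \<Sum>\<^sub>\<infinity>\<zeta>\<in>configs_on \<Lambda>. norm (?g n \<zeta>)) summable_on UNIV"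
    proof -
      have "(\<lambda>n. norm (\<Sum>\<^sub>\<infinity>\<zeta>\<in>configs_on \<Lambda>. norm (?g n \<zeta>))) summable_on UNIV"
        using Infinite_Sum.abs_summable_on_Sigma_iff[THEN iffD1, OF sm] by simp
      moreover have "norm (\<Sum>\<^sub>\<infinity>\<zeta>\<in>configs_on \<Lambda>. norm (?g n \<zeta>)) = (\<Sum>\<^sub>\<infinity>\<zeta>\<in>configs_on \<Lambda>. norm (?g n \<zeta>))" for n
        unfolding real_norm_def[of "infsum _ _"] by (intro abs_of_nonneg infsum_nonneg) auto
      ultimately show ?thesis by simp
    qed
    show "norm (\<Sum>\<^sub>\<infinity>\<zeta>\<in>configs_on \<Lambda>. ?g n \<zeta>) \<le> (\<Sum>\<^sub>\<infinity>\<zeta>\<in>configs_on \<Lambda>. norm (?g n \<zeta>))" for n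
      using Infinite_Sum.abs_summable_on_Sigma_iff[THEN iffD1, OF sm] by (intro norm_infsum_bound) auto
  qed auto
  then show "(\<lambda>n. z x ^ n / fact n * exp (- z x) * c n) abs_summable_on UNIV"
    unfolding eq .
qed

lemma abs_summable_on_Times:
  fixes a :: "'a \<Rightarrow> real" and b :: "'b \<Rightarrow> real"
  assumes "a abs_summable_on A" "b abs_summable_on B"
  shows "(\<lambda>(x, y). a x * b y) abs_summable_on A \<times> B"
proof (subst Infinite_Sum.abs_summable_on_Sigma_iff, intro conjI ballI)
  fix x
  show "(\<lambda>y. case (x, y) of (x, y) \<Rightarrow> a x * b y) abs_summable_on B"
    using summable_on_cmult_right[OF assms(2), of "\<bar>a x\<bar>"] by (simp add: abs_mult)
next
  have norm_idem: "norm (norm r) = norm r" for r :: real by simp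
  have nn: "norm (\<Sum>\<^sub>\<infinity>y\<in>B. norm (b y)) = (\<Sum>\<^sub>\<infinity>y\<in>B. norm (b y))"
    unfolding real_norm_def[of "infsum _ _"] by (intro abs_of_nonneg infsum_nonneg) auto
  have eq: "(\<Sum>\<^sub>\<infinity>y\<in>B. norm (case (x, y) of (x, y) \<Rightarrow> a x * b y)) = norm (a x) * (\<Sum>\<^sub>\<infinity>y\<in>B. norm (b y))" for x
    by (simp add: abs_mult infsum_cmult_right')
  show "(\<lambda>x. \<Sum>\<^sub>\<infinity>y\<in>B. norm (case (x, y) of (x, y) \<Rightarrow> a x * b y)) abs_summable_on A"
    unfolding eq norm_mult norm_idem by (intro summable_on_cmult_left assms)
qed

text \<open>The Poisson weights of a coordinate on which \<open>f\<close> does not depend sum to 1.\<close>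

lemma G_insert_independent:
  assumes "finite \<Lambda>" "x \<notin> \<Lambda>" "depends_on \<Lambda> f" "G_exists \<Lambda> f z"
  shows "G_exists (insert x \<Lambda>) f z" and "G_op (insert x \<Lambda>) f z = G_op \<Lambda> f z"
proof -
  have f: "f (\<zeta>(x := n)) = f \<zeta>" for \<zeta> n
    using assms(2,3) by (auto simp: depends_on_def)
  have "(\<lambda>n. z x ^ n / fact n * exp (- z x)) abs_summable_on UNIV"
    by (subst summable_on_iff_abs_summable_on_real[symmetric])
       (rule has_sum_imp_summable[OF exp_has_sum])
  then show ex: "G_exists (insert x \<Lambda>) f z"
    using assms(4)[unfolded G_exists_def] unfolding G_exists_insert_iff[OF assms(1,2)] f
    by (intro abs_summable_on_Times) simp_all
  show "G_op (insert x \<Lambda>) f z = G_op \<Lambda> f z"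
    unfolding G_insert_slices(1)[OF assms(1,2) ex] f
    using infsumI[OF exp_has_sum[of "z x"]] by (subst infsum_cmult_left') simp
qed

lemma depends_on_mono: "depends_on \<Lambda> f \<Longrightarrow> \<Lambda> \<subseteq> \<Lambda>' \<Longrightarrow> depends_on \<Lambda>' f"
  unfolding depends_on_def by blast

lemma G_Un_independent:
  assumes "finite \<Lambda>" "depends_on \<Lambda> f" "G_exists \<Lambda> f z" "finite \<Delta>"
  shows "G_exists (\<Lambda> \<union> \<Delta>) f z \<and> G_op (\<Lambda> \<union> \<Delta>) f z = G_op \<Lambda> f z"
  using assms(4)
proof induction
  case (insert x \<Delta>)
  show ?case
  proof (cases "x \<in> \<Lambda>")
    case False
    then have "x \<notin> \<Lambda> \<union> \<Delta>" using insert by simp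
    then show ?thesis
      using G_insert_independent[of "\<Lambda> \<union> \<Delta>" x f z] insert assms
        depends_on_mono[OF assms(2), of "\<Lambda> \<union> \<Delta>"] by auto
  qed (use insert in \<open>simp add: insert_absorb\<close>)
qed (use assms in simp)

text \<open>As a function of \<open>s = z x\<close> the transform is \<open>exp (- s)\<close> times the exponential generating series of its
  slices, which converges for every \<open>s\<close> because the transform exists at every \<open>z\<close>. Differentiating the
  series shifts the slices by one, and differentiating \<open>exp (- s)\<close> contributes the term with the minus sign.\<close>

lemma G_add_one:
  assumes fin: "finite \<Lambda>" and x: "x \<notin> \<Lambda>" and ex: "\<And>z. G_exists (insert x \<Lambda>) f z"
  shows "G_exists (insert x \<Lambda>) (add_one x f) z"
    and "((\<lambda>s. G_op (insert x \<Lambda>) f (z(x := s))) has_real_derivative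
            G_op (insert x \<Lambda>) (add_one x f) z - G_op (insert x \<Lambda>) f z) (at (z x))"
proof -
  \<comment> \<open>The factor 2 absorbs the \<open>n + 1\<close> that the shift of the factorial costs.\<close>
  define R where "R = 2 * (\<bar>z x\<bar> + 1)"
  let ?h = "\<lambda>n \<zeta>. z x ^ n / fact n * exp (- z x) * G_summand \<Lambda> (\<lambda>\<zeta>. f (\<zeta>(x := n + 1))) z \<zeta>"
  let ?k = "\<lambda>n \<zeta>. R ^ n / fact n * exp (- R) * G_summand \<Lambda> (\<lambda>\<zeta>. f (\<zeta>(x := n))) z \<zeta>"
  have summand: "G_summand \<Lambda> g (z(x := s)) = G_summand \<Lambda> g z" for g s
  proof
    fix \<zeta>
    have "(\<Prod>i\<in>\<Lambda>. (z(x := s)) i ^ \<zeta> i / fact (\<zeta> i) * exp (- (z(x := s)) i)) =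
          (\<Prod>i\<in>\<Lambda>. z i ^ \<zeta> i / fact (\<zeta> i) * exp (- z i))"
      by (rule prod.cong) (use x in auto)
    then show "G_summand \<Lambda> g (z(x := s)) \<zeta> = G_summand \<Lambda> g z \<zeta>"
      by (simp add: G_summand_def)
  qed
  have "(\<lambda>(n, \<zeta>). ?k n \<zeta>) abs_summable_on UNIV \<times> configs_on \<Lambda>"
    using ex[of "z(x := R)"] unfolding G_exists_insert_iff[OF fin x] summand by simp
  then have "(\<lambda>(n, \<zeta>). ?k n \<zeta>) abs_summable_on (\<lambda>(n, \<zeta>). (Suc n, \<zeta>)) ` (UNIV \<times> configs_on \<Lambda>)"
    by (rule summable_on_subset_banach) auto
  then have k: "(\<lambda>(n, \<zeta>). ?k (Suc n) \<zeta>) abs_summable_on UNIV \<times> configs_on \<Lambda>"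
    by (subst (asm) summable_on_reindex) (auto simp: inj_on_def o_def case_prod_unfold)
  have pow: "\<bar>z x\<bar> ^ n / fact n \<le> R ^ Suc n / fact (Suc n)" for n
  proof -
    have "real (Suc n) \<le> 2 ^ Suc n" using of_nat_less_two_power[of "Suc n", where 'a=real] by linarith
    moreover have "\<bar>z x\<bar> ^ n \<le> (\<bar>z x\<bar> + 1) ^ Suc n"
      using mult_mono[of 1 "\<bar>z x\<bar> + 1" "\<bar>z x\<bar> ^ n" "(\<bar>z x\<bar> + 1) ^ n"]
        power_mono[of "\<bar>z x\<bar>" "\<bar>z x\<bar> + 1" n] by simp
    ultimately have "real (Suc n) * \<bar>z x\<bar> ^ n \<le> R ^ Suc n"
      unfolding R_def power_mult_distrib by (intro mult_mono) auto
    then have "real (Suc n) * \<bar>z x\<bar> ^ n / fact (Suc n) \<le> R ^ Suc n / fact (Suc n)"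
      by (intro divide_right_mono) auto
    moreover have "real (Suc n) * \<bar>z x\<bar> ^ n / fact (Suc n) = \<bar>z x\<bar> ^ n / fact n"
      unfolding fact_Suc of_nat_mult by (simp del: of_nat_Suc)
    ultimately show ?thesis by simp
  qed
  have "(\<lambda>(n, \<zeta>). ?h n \<zeta>) abs_summable_on UNIV \<times> configs_on \<Lambda>"
  proof (rule summable_on_comparison_test)
    show "(\<lambda>(n, \<zeta>). exp (- z x) * exp R * norm (?k (Suc n) \<zeta>)) summable_on UNIV \<times> configs_on \<Lambda>"
      using summable_on_cmult_right[OF k, of "exp (- z x) * exp R"] by (simp add: case_prod_unfold)
    fix q :: "nat \<times> ('a \<Rightarrow> nat)"
    obtain n \<zeta> where q: "q = (n, \<zeta>)" by (cases q)
    have R0: "R \<ge> 0" by (simp add: R_def)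
    have "norm (?h n \<zeta>) \<le> R ^ Suc n / fact (Suc n) * exp (- z x) *
        \<bar>G_summand \<Lambda> (\<lambda>\<zeta>. f (\<zeta>(x := n + 1))) z \<zeta>\<bar>"
    proof -
      have "norm (?h n \<zeta>) = \<bar>z x\<bar> ^ n / fact n * (exp (- z x) * \<bar>G_summand \<Lambda> (\<lambda>\<zeta>. f (\<zeta>(x := n + 1))) z \<zeta>\<bar>)"
        by (simp add: abs_mult power_abs)
      then show ?thesis using mult_right_mono[OF pow[of n]] by (simp add: mult.assoc del: power_Suc fact_Suc)
    qed
    also have "\<dots> = exp (- z x) * exp R * norm (?k (Suc n) \<zeta>)"
      using R0 by (simp add: abs_mult exp_minus field_simps del: power_Suc fact_Suc)
    finally show "norm (case q of (n, \<zeta>) \<Rightarrow> ?h n \<zeta>) \<le>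
        (case q of (n, \<zeta>) \<Rightarrow> exp (- z x) * exp R * norm (?k (Suc n) \<zeta>))"
      by (simp add: q)
  qed auto
  then show ex1: "G_exists (insert x \<Lambda>) (add_one x f) z"
    unfolding G_exists_insert_iff[OF fin x] by simp
  define c where "c n = G_op \<Lambda> (\<lambda>\<zeta>. f (\<zeta>(x := n))) z" for n
  have c: "G_op \<Lambda> (\<lambda>\<zeta>. f (\<zeta>(x := n))) (z(x := s)) = c n" for n s
    by (simp add: c_def G_op_def summand)
  have to_sums: "(\<Sum>\<^sub>\<infinity>n. g n) = suminf g \<and> summable g"
    if "g abs_summable_on UNIV" for g :: "nat \<Rightarrow> real"
  proof -
    have "(g has_sum infsum g UNIV) UNIV"
      using abs_summable_summable[OF that] by (rule has_sum_infsum)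
    then have "g sums infsum g UNIV" by (rule has_sum_imp_sums)
    then show ?thesis by (auto simp: sums_iff)
  qed
  have main: "G_op (insert x \<Lambda>) f (z(x := s)) = exp (- s) * (\<Sum>n. c n / fact n * s ^ n) \<and>
       summable (\<lambda>n. c n / fact n * s ^ n)" for s
  proof -
    have "(\<lambda>n. s ^ n / fact n * exp (- s) * c n) abs_summable_on UNIV"
      using G_insert_slices(2)[OF fin x ex[of "z(x := s)"]] by (simp add: c)
    note s = to_sums[OF this]
    have "summable (\<lambda>n. exp s * (s ^ n / fact n * exp (- s) * c n))"
      using s by (intro summable_mult) auto
    then have sm: "summable (\<lambda>n. c n / fact n * s ^ n)"
      by (simp add: exp_minus field_simps)
    have "G_op (insert x \<Lambda>) f (z(x := s)) = (\<Sum>n. s ^ n / fact n * exp (- s) * c n)"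
      using G_insert_slices(1)[OF fin x ex[of "z(x := s)"]] s by (simp add: c)
    also have "\<dots> = (\<Sum>n. exp (- s) * (c n / fact n * s ^ n))"
      by (simp add: mult_ac)
    also have "\<dots> = exp (- s) * (\<Sum>n. c n / fact n * s ^ n)"
      using sm by (rule suminf_mult)
    finally show ?thesis using sm by simp
  qed
  have d: "diffs (\<lambda>n. c n / fact n) n = c (n + 1) / fact n" for n
    unfolding diffs_def Suc_eq_plus1[symmetric] fact_Suc of_nat_mult by (simp del: of_nat_Suc)
  have sm1: "summable (\<lambda>n. c (n + 1) / fact n * s ^ n)" for s
    using termdiff_converges_all[of "\<lambda>n. c n / fact n" s] main unfolding d by blast
  have "G_op (insert x \<Lambda>) (add_one x f) z = (\<Sum>n. z x ^ n / fact n * exp (- z x) * c (n + 1))"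
    using G_insert_slices[OF fin x ex1] to_sums by (simp add: c_def)
  also have "\<dots> = (\<Sum>n. exp (- z x) * (c (n + 1) / fact n * z x ^ n))"
    by (simp add: mult_ac)
  also have "\<dots> = exp (- z x) * (\<Sum>n. c (n + 1) / fact n * z x ^ n)"
    using sm1 by (rule suminf_mult)
  finally have 1: "G_op (insert x \<Lambda>) (add_one x f) z = exp (- z x) * (\<Sum>n. c (n + 1) / fact n * z x ^ n)" .
  have "((\<lambda>s. \<Sum>n. c n / fact n * s ^ n) has_real_derivative (\<Sum>n. c (n + 1) / fact n * z x ^ n)) (at (z x))"
    using termdiffs_strong_converges_everywhere[of "\<lambda>n. c n / fact n" "z x"] main unfolding d by blast
  then have "((\<lambda>s. exp (- s) * (\<Sum>n. c n / fact n * s ^ n)) has_real_derivative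
      exp (- z x) * (\<Sum>n. c (n + 1) / fact n * z x ^ n) - exp (- z x) * (\<Sum>n. c n / fact n * z x ^ n)) (at (z x))"
    by (auto intro!: derivative_eq_intros)
  then show "((\<lambda>s. G_op (insert x \<Lambda>) f (z(x := s))) has_real_derivative
            G_op (insert x \<Lambda>) (add_one x f) z - G_op (insert x \<Lambda>) f z) (at (z x))"
    unfolding 1 using main[of "z x"] by (simp add: main)
qed

text \<open>The factor \<open>\<eta> x\<close> cancels against the factorial, which leaves a shift of the summation index.\<close>

lemma G_times_occupation:
  assumes fin: "finite \<Lambda>" and x: "x \<in> \<Lambda>" and ex: "G_exists \<Lambda> g z"
  shows "G_exists \<Lambda> (\<lambda>\<eta>. real (\<eta> x) * g (\<eta>(x := \<eta> x - 1))) z"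
    and "G_op \<Lambda> (\<lambda>\<eta>. real (\<eta> x) * g (\<eta>(x := \<eta> x - 1))) z = z x * G_op \<Lambda> g z"
proof -
  let ?f = "\<lambda>\<eta>. real (\<eta> x) * g (\<eta>(x := \<eta> x - 1))"
  let ?i = "\<lambda>\<eta>. \<eta>(x := \<eta> x + 1)"
  have inj: "inj_on ?i (configs_on \<Lambda>)"
  proof (rule inj_onI)
    fix \<eta> \<zeta> :: "'a \<Rightarrow> nat" assume eq: "?i \<eta> = ?i \<zeta>"
    show "\<eta> = \<zeta>"
    proof
      fix i show "\<eta> i = \<zeta> i" using fun_cong[OF eq, of i] by (cases "i = x") auto
    qed
  qed
  have trm: "G_summand \<Lambda> ?f z (?i \<eta>) = z x * G_summand \<Lambda> g z \<eta>" for \<eta>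
  proof -
    have "(\<Prod>i\<in>\<Lambda> - {x}. z i ^ (?i \<eta>) i / fact ((?i \<eta>) i) * exp (- z i)) =
          (\<Prod>i\<in>\<Lambda> - {x}. z i ^ \<eta> i / fact (\<eta> i) * exp (- z i))"
      by (rule prod.cong) auto
    then show ?thesis
      using fin x by (simp add: G_summand_def prod.remove field_simps del: of_nat_Suc)
  qed
  have sub: "?i ` configs_on \<Lambda> \<subseteq> configs_on \<Lambda>" using x by auto
  have zero: "G_summand \<Lambda> ?f z \<eta> = 0" if "\<eta> \<in> configs_on \<Lambda> - ?i ` configs_on \<Lambda>" for \<eta>
  proof -
    have "\<eta> x = 0"
    proof (rule ccontr)
      assume "\<eta> x \<noteq> 0"
      then have "\<eta> = ?i (\<eta>(x := \<eta> x - 1))" by auto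
      moreover have "\<eta>(x := \<eta> x - 1) \<in> configs_on \<Lambda>" using that by auto
      ultimately show False using that by blast
    qed
    then show ?thesis by (simp add: G_summand_def)
  qed
  have "(\<lambda>\<eta>. \<bar>z x\<bar> * \<bar>G_summand \<Lambda> g z \<eta>\<bar>) summable_on configs_on \<Lambda>"
    using ex unfolding G_exists_def by (rule summable_on_cmult_right)
  then have "(\<lambda>\<eta>. \<bar>G_summand \<Lambda> ?f z \<eta>\<bar>) summable_on ?i ` configs_on \<Lambda>"
    unfolding summable_on_reindex[OF inj] by (simp only: o_def trm abs_mult)
  then show "G_exists \<Lambda> ?f z"
    unfolding G_exists_def
  proof (rule summable_on_cong_neutral[THEN iffD1, rotated -1])
    show "\<bar>G_summand \<Lambda> ?f z \<eta>\<bar> = 0" if "\<eta> \<in> configs_on \<Lambda> - ?i ` configs_on \<Lambda>" for \<eta>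
      using zero[OF that] by (simp only: abs_zero)
    show "\<bar>G_summand \<Lambda> ?f z \<eta>\<bar> = 0" if "\<eta> \<in> ?i ` configs_on \<Lambda> - configs_on \<Lambda>" for \<eta>
      using sub that by blast
  qed (rule refl)
  have "G_op \<Lambda> ?f z = (\<Sum>\<^sub>\<infinity>\<eta>\<in>?i ` configs_on \<Lambda>. G_summand \<Lambda> ?f z \<eta>)"
    unfolding G_op_def
  proof (rule infsum_cong_neutral)
    show "G_summand \<Lambda> ?f z \<eta> = 0" if "\<eta> \<in> ?i ` configs_on \<Lambda> - configs_on \<Lambda>" for \<eta>
      using sub that by blast
  qed (rule zero refl; assumption)+
  also have "\<dots> = (\<Sum>\<^sub>\<infinity>\<eta>\<in>configs_on \<Lambda>. z x * G_summand \<Lambda> g z \<eta>)"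
    unfolding infsum_reindex[OF inj] by (simp only: o_def trm)
  also have "\<dots> = z x * G_op \<Lambda> g z"
    unfolding G_op_def by (rule infsum_cmult_right')
  finally show "G_op \<Lambda> ?f z = z x * G_op \<Lambda> g z" .
qed

lemma G_linear:
  assumes "G_exists \<Lambda> f z" "G_exists \<Lambda> g z"
  shows "G_exists \<Lambda> (\<lambda>\<eta>. f \<eta> + g \<eta>) z" "G_op \<Lambda> (\<lambda>\<eta>. f \<eta> + g \<eta>) z = G_op \<Lambda> f z + G_op \<Lambda> g z"
    "G_exists \<Lambda> (\<lambda>\<eta>. f \<eta> - g \<eta>) z" "G_op \<Lambda> (\<lambda>\<eta>. f \<eta> - g \<eta>) z = G_op \<Lambda> f z - G_op \<Lambda> g z"
    "G_exists \<Lambda> (\<lambda>\<eta>. c * f \<eta>) z" "G_op \<Lambda> (\<lambda>\<eta>. c * f \<eta>) z = c * G_op \<Lambda> f z"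
proof -
  let ?S = "configs_on \<Lambda>"
  have sf: "G_summand \<Lambda> f z summable_on ?S" and sg: "G_summand \<Lambda> g z summable_on ?S"
    using assms summable_on_iff_abs_summable_on_real[of "G_summand \<Lambda> f z" ?S]
      summable_on_iff_abs_summable_on_real[of "G_summand \<Lambda> g z" ?S] by (simp_all add: G_exists_def)
  have sm: "(\<lambda>\<eta>. - G_summand \<Lambda> g z \<eta>) summable_on ?S"
    using sg by (simp only: summable_on_uminus)
  have a: "G_summand \<Lambda> (\<lambda>\<eta>. f \<eta> + g \<eta>) z = (\<lambda>\<eta>. G_summand \<Lambda> f z \<eta> + G_summand \<Lambda> g z \<eta>)"
    and b: "G_summand \<Lambda> (\<lambda>\<eta>. f \<eta> - g \<eta>) z = (\<lambda>\<eta>. G_summand \<Lambda> f z \<eta> + - G_summand \<Lambda> g z \<eta>)"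
    and c: "G_summand \<Lambda> (\<lambda>\<eta>. c * f \<eta>) z = (\<lambda>\<eta>. c * G_summand \<Lambda> f z \<eta>)"
    by (auto simp: G_summand_def algebra_simps)
  have ex: "G_exists \<Lambda> h z" if "G_summand \<Lambda> h z summable_on ?S" for h
    using that summable_on_iff_abs_summable_on_real[of "G_summand \<Lambda> h z" ?S] by (simp add: G_exists_def)
  show "G_exists \<Lambda> (\<lambda>\<eta>. f \<eta> + g \<eta>) z"
    by (rule ex, unfold a, rule summable_on_add[OF sf sg])
  show "G_exists \<Lambda> (\<lambda>\<eta>. f \<eta> - g \<eta>) z"
    by (rule ex, unfold b, rule summable_on_add[OF sf sm])
  show "G_exists \<Lambda> (\<lambda>\<eta>. c * f \<eta>) z"
    by (rule ex, unfold c, rule summable_on_cmult_right[OF sf])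
  show "G_op \<Lambda> (\<lambda>\<eta>. f \<eta> + g \<eta>) z = G_op \<Lambda> f z + G_op \<Lambda> g z"
    unfolding G_op_def a by (rule infsum_add[OF sf sg])
  show "G_op \<Lambda> (\<lambda>\<eta>. f \<eta> - g \<eta>) z = G_op \<Lambda> f z - G_op \<Lambda> g z"
    unfolding G_op_def b infsum_add[OF sf sm] infsum_uminus by simp
  show "G_op \<Lambda> (\<lambda>\<eta>. c * f \<eta>) z = c * G_op \<Lambda> f z"
    unfolding G_op_def c by (rule infsum_cmult_right')
qed

lemma G_partial_deriv:
  assumes fin: "finite \<Lambda>" and ex: "\<And>z. G_exists \<Lambda> f z" and x: "x \<in> \<Lambda>"
  shows "G_exists \<Lambda> (add_one x f) z"
    and "partial_deriv x (G_op \<Lambda> f) z = G_op \<Lambda> (add_one x f) z - G_op \<Lambda> f z"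
proof -
  have L: "insert x (\<Lambda> - {x}) = \<Lambda>" using x by blast
  note G = G_add_one[of "\<Lambda> - {x}" x f z, unfolded L]
  show "G_exists \<Lambda> (add_one x f) z" using G(1) fin ex by simp
  show "partial_deriv x (G_op \<Lambda> f) z = G_op \<Lambda> (add_one x f) z - G_op \<Lambda> f z"
    unfolding partial_deriv_def using G(2) fin ex by (simp add: DERIV_imp_deriv)
qed

text \<open>Both \<open>f (hop x y \<eta>)\<close> and \<open>f \<eta>\<close> arise by first removing a particle at \<open>x\<close> and then adding one, at
  \<open>y\<close> or at \<open>x\<close>. In this form the pair term is a combination of functions \<open>\<eta> u * add_one v f\<close> evaluated
  after the removal at \<open>u\<close>, and the transforms of these are \<open>z u * (\<partial>\<^sub>v + 1) (G f)\<close>; the terms without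
  derivative cancel.\<close>

lemma generator_duality:
  fixes p :: "'v::countable \<Rightarrow> 'v \<Rightarrow> real" and lam :: real
  assumes fin: "finite \<Lambda>" and dep: "depends_on \<Lambda> f" and ex: "\<And>z. G_exists \<Lambda> f z"
  shows "x \<noteq> y \<Longrightarrow> G_exists (\<Lambda> \<union> {x, y}) (irw_pair_term p f x y) z"
    and "x \<noteq> y \<Longrightarrow> G_op (\<Lambda> \<union> {x, y}) (irw_pair_term p f x y) z = - det_pair_term p (G_op \<Lambda> f) z x y"
    and "G_exists (\<Lambda> \<union> {orig}) (irw_source_term orig lam f) z"
    and "G_op (\<Lambda> \<union> {orig}) (irw_source_term orig lam f) z = lam * partial_deriv orig (G_op \<Lambda> f) z"
proof -
  have ext: "G_exists (\<Lambda> \<union> \<Delta>) f z'" "G_op \<Lambda> f = G_op (\<Lambda> \<union> \<Delta>) f" if "finite \<Delta>" for \<Delta> z'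
    using G_Un_independent[OF fin dep ex that] by auto
  { assume ne: "x \<noteq> y"
    let ?L = "\<Lambda> \<union> {x, y}"
    let ?N = "\<lambda>x g \<eta>. real (\<eta> x) * g (\<eta>(x := \<eta> x - 1))"
    have fL: "finite ?L" and xy: "x \<in> ?L" "y \<in> ?L" using fin by auto
    have exL: "G_exists ?L f z'" for z' using ext(1)[of "{x, y}"] by simp
    note dx = G_partial_deriv[OF fL exL xy(1)] and dy = G_partial_deriv[OF fL exL xy(2)]
    have N: "G_exists ?L (?N u (add_one v f)) z'"
        "G_op ?L (?N u (add_one v f)) z' = z' u * G_op ?L (add_one v f) z'"
      if "u \<in> {x, y}" "v \<in> {x, y}" for u v z'
    proof -
      have "u \<in> ?L" "G_exists ?L (add_one v f) z'" using that dx(1) dy(1) by auto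
      from G_times_occupation[OF fL this] show "G_exists ?L (?N u (add_one v f)) z'"
        "G_op ?L (?N u (add_one v f)) z' = z' u * G_op ?L (add_one v f) z'" by auto
    qed
    have pair: "irw_pair_term p f x y = (\<lambda>\<eta>. p x y *
       ((?N x (add_one y f) \<eta> - ?N x (add_one x f) \<eta>) + (?N y (add_one x f) \<eta> - ?N y (add_one y f) \<eta>)))"
    proof
      fix \<eta> :: "'v \<Rightarrow> nat"
      have 1: "real (\<eta> u) * f (hop u v \<eta>) = ?N u (add_one v f) \<eta>" if "u \<noteq> v" for u v
        using that by (simp add: hop_def)
      have 2: "real (\<eta> u) * f \<eta> = ?N u (add_one u f) \<eta>" for u
        by (cases "\<eta> u = 0") simp_all
      show "irw_pair_term p f x y \<eta> = p x y *
       ((?N x (add_one y f) \<eta> - ?N x (add_one x f) \<eta>) + (?N y (add_one x f) \<eta> - ?N y (add_one y f) \<eta>))"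
        unfolding irw_pair_term_def right_diff_distrib[of "real _"] 1[OF ne] 1[OF ne[symmetric]] 2 ..
    qed
    have e1: "G_exists ?L (\<lambda>\<eta>. ?N x (add_one y f) \<eta> - ?N x (add_one x f) \<eta>) z"
      and e2: "G_exists ?L (\<lambda>\<eta>. ?N y (add_one x f) \<eta> - ?N y (add_one y f) \<eta>) z"
      by (intro G_linear(3) N; simp)+
    note e3 = G_linear(1)[OF e1 e2]
    show "G_exists ?L (irw_pair_term p f x y) z"
      unfolding pair by (rule G_linear(5)[OF e3 e3])
    have "G_op ?L (irw_pair_term p f x y) z = p x y *
       ((z x * G_op ?L (add_one y f) z - z x * G_op ?L (add_one x f) z) +
        (z y * G_op ?L (add_one x f) z - z y * G_op ?L (add_one y f) z))"
      unfolding pair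
      by (simp only: G_linear(6)[OF e3 e3] G_linear(2)[OF e1 e2] G_linear(4)[OF N(1) N(1)] N insert_iff simp_thms)
    also have "\<dots> = - det_pair_term p (G_op \<Lambda> f) z x y"
      unfolding det_pair_term_def ext(2)[of "{x, y}", OF finite.insertI[OF finite.insertI[OF finite.emptyI]]] dx(2) dy(2)
      by (simp only: algebra_simps)
    finally show "G_op ?L (irw_pair_term p f x y) z = - det_pair_term p (G_op \<Lambda> f) z x y" .
  }
  let ?L = "\<Lambda> \<union> {orig}"
  have exL: "G_exists ?L f z'" for z' using ext(1)[of "{orig}"] by simp
  have d: "G_exists ?L (add_one orig f) z"
      "partial_deriv orig (G_op ?L f) z = G_op ?L (add_one orig f) z - G_op ?L f z"
    using G_partial_deriv[of ?L f orig z] fin exL by auto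
  have s: "irw_source_term orig lam f = (\<lambda>\<eta>. lam * (add_one orig f \<eta> - f \<eta>))"
    by (auto simp: irw_source_term_def)
  note e4 = G_linear(3)[OF d(1) exL]
  show "G_exists ?L (irw_source_term orig lam f) z"
    unfolding s by (rule G_linear(5)[OF e4 e4])
  show "G_op ?L (irw_source_term orig lam f) z = lam * partial_deriv orig (G_op \<Lambda> f) z"
    unfolding s G_linear(6)[OF e4 e4] G_linear(4)[OF d(1) exL]
    using d(2) ext(2)[of "{orig}"] by simp
qed

lemma depends_on_irw_terms:
  assumes "depends_on \<Lambda> f"
  shows "depends_on (\<Lambda> \<union> {x, y}) (irw_pair_term p f x y)"
    and "depends_on (\<Lambda> \<union> {orig}) (irw_source_term orig lam f)"
proof -
  show "depends_on (\<Lambda> \<union> {x, y}) (irw_pair_term p f x y)"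
    unfolding depends_on_def
  proof safe
    fix \<eta> \<zeta> :: "'a \<Rightarrow> nat" assume *: "\<forall>i\<in>\<Lambda> \<union> {x, y}. \<eta> i = \<zeta> i"
    have "f (hop x y \<eta>) = f (hop x y \<zeta>)" "f (hop y x \<eta>) = f (hop y x \<zeta>)" "f \<eta> = f \<zeta>"
      using * assms by (auto simp: depends_on_def hop_def)
    then show "irw_pair_term p f x y \<eta> = irw_pair_term p f x y \<zeta>"
      using * by (simp add: irw_pair_term_def)
  qed
  show "depends_on (\<Lambda> \<union> {orig}) (irw_source_term orig lam f)"
    unfolding depends_on_def
  proof safe
    fix \<eta> \<zeta> :: "'a \<Rightarrow> nat" assume *: "\<forall>i\<in>\<Lambda> \<union> {orig}. \<eta> i = \<zeta> i"
    have "f (\<eta>(orig := \<eta> orig + 1)) = f (\<zeta>(orig := \<zeta> orig + 1))" "f \<eta> = f \<zeta>"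
      using * assms by (auto simp: depends_on_def)
    then show "irw_source_term orig lam f \<eta> = irw_source_term orig lam f \<zeta>"
      by (simp add: irw_source_term_def)
  qed
qed

text \<open>Only the pairs that meet the finite set \<open>\<Lambda>\<close> contribute, and the series over the pairs containing a
  fixed site is dominated by the assumed one.\<close>

lemma det_gen_converges_if_summable:
  fixes p :: "'v::countable \<Rightarrow> 'v \<Rightarrow> real"
  assumes p: "\<And>x y. 0 \<le> p x y" "\<And>x y. p x y = p y x" "\<And>x. p x summable_on UNIV"
    and fin: "finite \<Lambda>" and F: "\<And>x z. x \<notin> \<Lambda> \<Longrightarrow> partial_deriv x F z = 0"
    and z: "\<And>x. (\<lambda>y. p x y * \<bar>z y\<bar>) summable_on UNIV"
  shows "det_gen_converges p F z"
proof -
  define B where "B = (\<Sum>x\<in>\<Lambda>. \<bar>partial_deriv x F z\<bar>)"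
  have B: "\<bar>partial_deriv x F z\<bar> \<le> B" for x
    using member_le_sum[of x \<Lambda> "\<lambda>x. \<bar>partial_deriv x F z\<bar>"] fin F[of x z]
    by (cases "x \<in> \<Lambda>") (auto simp: B_def sum_nonneg)
  have t: "\<bar>det_pair_term p F z x y\<bar> \<le> (p x y * \<bar>z x\<bar> + p x y * \<bar>z y\<bar>) * (2 * B)" for x y
  proof -
    have "\<bar>det_pair_term p F z x y\<bar> = p x y * \<bar>z x - z y\<bar> * \<bar>partial_deriv x F z - partial_deriv y F z\<bar>"
      using p(1) by (simp add: det_pair_term_def abs_mult)
    also have "\<dots> \<le> p x y * (\<bar>z x\<bar> + \<bar>z y\<bar>) * (2 * B)"
      using B[of x] B[of y] p(1) by (intro mult_mono mult_left_mono) auto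
    finally show ?thesis by (simp add: algebra_simps)
  qed
  have row: "(\<lambda>y. det_pair_term p F z x y) abs_summable_on UNIV" for x
  proof (rule summable_on_comparison_test)
    show "(\<lambda>y. (p x y * \<bar>z x\<bar> + p x y * \<bar>z y\<bar>) * (2 * B)) summable_on UNIV"
      by (intro summable_on_cmult_left summable_on_add p z)
  qed (use t in auto)
  have sym: "det_pair_term p F z x y = det_pair_term p F z y x" for x y
    using p(2)[of x y] by (simp add: det_pair_term_def algebra_simps)
  have u1: "(\<lambda>(x, y). det_pair_term p F z x y) abs_summable_on (\<Lambda> \<times> UNIV)"
    by (subst Infinite_Sum.abs_summable_on_Sigma_iff) (use fin row in auto)
  have u2: "(\<lambda>(x, y). det_pair_term p F z x y) abs_summable_on (UNIV \<times> \<Lambda>)"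
  proof -
    have "(\<lambda>(y, x). det_pair_term p F z x y) abs_summable_on (\<Lambda> \<times> UNIV)"
      by (subst Infinite_Sum.abs_summable_on_Sigma_iff) (use fin row sym in auto)
    then have "((\<lambda>(x, y). norm (det_pair_term p F z x y)) \<circ> prod.swap) summable_on (\<Lambda> \<times> UNIV)"
      by (simp add: o_def case_prod_unfold)
    then have "(\<lambda>(x, y). norm (det_pair_term p F z x y)) summable_on prod.swap ` (\<Lambda> \<times> UNIV)"
      by (subst summable_on_reindex) auto
    then show ?thesis by (simp add: product_swap case_prod_unfold)
  qed
  have zero: "det_pair_term p F z x y = 0" if "x \<notin> \<Lambda>" "y \<notin> \<Lambda>" for x y
    using F[OF that(1)] F[OF that(2)] by (simp add: det_pair_term_def)
  from u1 u2 have "(\<lambda>(x, y). det_pair_term p F z x y) abs_summable_on (\<Lambda> \<times> UNIV \<union> UNIV \<times> \<Lambda>)"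
    by (rule summable_on_union)
  then have "(\<lambda>(x, y). det_pair_term p F z x y) summable_on (\<Lambda> \<times> UNIV \<union> UNIV \<times> \<Lambda>)"
    by (rule abs_summable_summable)
  then have "(\<lambda>(x, y). det_pair_term p F z x y) summable_on (\<Lambda> \<times> UNIV \<union> UNIV \<times> \<Lambda>) \<inter> site_pairs"
    by (rule summable_on_subset_banach) auto
  then show ?thesis
    unfolding det_gen_converges_def
    by (subst summable_on_cong_neutral[where T = "(\<Lambda> \<times> UNIV \<union> UNIV \<times> \<Lambda>) \<inter> site_pairs"])
       (use zero in auto)
qed

text \<open>The two series over pairs of sites agree term by term up to the sign, so they converge together and
  have opposite sums without any exchange of limits.\<close>

lemma G_irw_gen_eq_det_gen:
  fixes p :: "'v::countable \<Rightarrow> 'v \<Rightarrow> real"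
  assumes rw: "irreducible_symmetric_rw p"
    and fin: "finite \<Lambda>" and dep: "depends_on \<Lambda> f" and ex: "\<And>z. G_exists \<Lambda> f z"
  shows "(\<forall>(x, y)\<in>site_pairs.
             depends_on (\<Lambda> \<union> {x, y}) (irw_pair_term p f x y) \<and>
             G_exists (\<Lambda> \<union> {x, y}) (irw_pair_term p f x y) z) \<and>
          depends_on (\<Lambda> \<union> {orig}) (irw_source_term orig lam f) \<and>
          G_exists (\<Lambda> \<union> {orig}) (irw_source_term orig lam f) z \<and>
          (G_irw_gen_converges p \<Lambda> f z \<longleftrightarrow> det_gen_converges p (G_op \<Lambda> f) z) \<and>
          ((\<forall>x. (\<lambda>y. p x y * \<bar>z y\<bar>) summable_on UNIV) \<longrightarrow> G_irw_gen_converges p \<Lambda> f z) \<and>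
          G_irw_gen p orig lam \<Lambda> f z = det_gen p orig lam (G_op \<Lambda> f) z"
proof -
  note dual = generator_duality[OF fin dep ex]
  have ne: "x \<noteq> y" if "(x, y) \<in> site_pairs" for x y :: 'v
    using that by (auto simp: site_pairs_def)
  have iff: "G_irw_gen_converges p \<Lambda> f z \<longleftrightarrow> det_gen_converges p (G_op \<Lambda> f) z"
  proof -
    have "G_irw_gen_converges p \<Lambda> f z \<longleftrightarrow> (\<lambda>(x, y). - det_pair_term p (G_op \<Lambda> f) z x y) summable_on site_pairs"
      unfolding G_irw_gen_converges_def
      by (rule summable_on_cong) (use ne dual(2) in auto)
    also have "\<dots> \<longleftrightarrow> det_gen_converges p (G_op \<Lambda> f) z"
      unfolding det_gen_converges_def by (simp add: case_prod_unfold summable_on_uminus)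
    finally show ?thesis .
  qed
  have "G_irw_gen p orig lam \<Lambda> f z = det_gen p orig lam (G_op \<Lambda> f) z"
  proof -
    have "(\<Sum>\<^sub>\<infinity>(x, y)\<in>site_pairs. G_op (\<Lambda> \<union> {x, y}) (irw_pair_term p f x y) z) =
       (\<Sum>\<^sub>\<infinity>(x, y)\<in>site_pairs. - det_pair_term p (G_op \<Lambda> f) z x y)"
      by (rule infsum_cong) (use ne dual(2) in auto)
    also have "\<dots> = - (\<Sum>\<^sub>\<infinity>(x, y)\<in>site_pairs. det_pair_term p (G_op \<Lambda> f) z x y)"
      by (simp add: case_prod_unfold infsum_uminus)
    finally show ?thesis unfolding G_irw_gen_def det_gen_def dual(4) by simp
  qed
  moreover have "det_gen_converges p (G_op \<Lambda> f) z" if "\<forall>x. (\<lambda>y. p x y * \<bar>z y\<bar>) summable_on UNIV"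
  proof (rule det_gen_converges_if_summable[where \<Lambda> = \<Lambda>])
    show "partial_deriv x (G_op \<Lambda> f) z' = 0" if "x \<notin> \<Lambda>" for x z'
    proof -
      have eq: "G_op \<Lambda> f = G_op (insert x \<Lambda>) f"
        using G_Un_independent[OF fin dep ex, of "{x}"] by auto
      have ex': "G_exists (insert x \<Lambda>) f z'" for z'
        using G_Un_independent[OF fin dep ex, of "{x}"] by auto
      have "add_one x f = f"
      proof
        fix \<eta> show "add_one x f \<eta> = f \<eta>"
          by (rule dep[unfolded depends_on_def, rule_format]) (use that in auto)
      qed
      then show ?thesis
        unfolding eq using G_partial_deriv(2)[of "insert x \<Lambda>" f x z'] fin ex' by simp
    qed
  qed (use rw that fin in \<open>auto simp: irreducible_symmetric_rw_def summable_on_def\<close>)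
  ultimately show ?thesis
    using dual(1,3) ne iff depends_on_irw_terms[OF dep] by auto
qed

section \<open>Transition operator and heat semigroup\<close>

lemma nn_integral_count_space_eq_infsum:
  fixes f :: "'a \<Rightarrow> real"
  assumes "f summable_on UNIV" "\<And>x. 0 \<le> f x"
  shows "(\<integral>\<^sup>+x. ennreal (f x) \<partial>count_space UNIV) = ennreal (\<Sum>\<^sub>\<infinity>x. f x)"
proof -
  have "Infinite_Set_Sum.abs_summable_on f UNIV"
    unfolding abs_summable_equivalent[symmetric] using assms by simp
  then show ?thesis
    using assms(2) by (subst nn_integral_conv_infsetsum) (simp_all add: infsetsum_infsum)
qed

lemma summable_on_iff_nn_integral_finite:
  fixes f :: "'a \<Rightarrow> real"
  assumes nn: "\<And>x. 0 \<le> f x"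
  shows "f summable_on UNIV \<longleftrightarrow> (\<integral>\<^sup>+x. ennreal (f x) \<partial>count_space UNIV) < \<infinity>"
proof
  assume "(\<integral>\<^sup>+x. ennreal (f x) \<partial>count_space UNIV) < \<infinity>"
  then have "integrable (count_space UNIV) f"
    using nn by (intro integrableI_bounded) auto
  then have "Infinite_Set_Sum.abs_summable_on f UNIV"
    by (simp add: Infinite_Set_Sum.abs_summable_on_def)
  then show "f summable_on UNIV"
    unfolding abs_summable_equivalent[symmetric] by (rule abs_summable_summable)
qed (simp add: nn_integral_count_space_eq_infsum nn)

text \<open>The operator acts on functions with values in \<open>[0, \<infinity>]\<close>, where all sums exist and commute; this is
  essential for unbounded initial densities.\<close>

definition trans_op :: "('v \<Rightarrow> 'v \<Rightarrow> real) \<Rightarrow> ('v \<Rightarrow> ennreal) \<Rightarrow> 'v \<Rightarrow> ennreal" where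
  "trans_op p g x = (\<integral>\<^sup>+y. ennreal (p x y) * g y \<partial>count_space UNIV)"

text \<open>The semigroup of the continuous-time walk: the number of jumps up to time \<open>t\<close> is Poisson with
  mean \<open>t\<close>.\<close>

definition heat :: "('v \<Rightarrow> 'v \<Rightarrow> real) \<Rightarrow> real \<Rightarrow> ('v \<Rightarrow> ennreal) \<Rightarrow> 'v \<Rightarrow> ennreal" where
  "heat p t g x = (\<Sum>n. ennreal (exp (- t) * t ^ n / fact n) * (trans_op p ^^ n) g x)"

abbreviation point :: "'v \<Rightarrow> 'v \<Rightarrow> ennreal" where
  "point y \<equiv> \<lambda>x. of_bool (x = y)"

lemma trans_op_mono: "(\<And>x. g x \<le> h x) \<Longrightarrow> trans_op p g x \<le> trans_op p h x"
  unfolding trans_op_def by (intro nn_integral_mono mult_left_mono) auto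

lemma trans_op_iter_mono: "(\<And>x. g x \<le> h x) \<Longrightarrow> (trans_op p ^^ n) g x \<le> (trans_op p ^^ n) h x"
  by (induction n arbitrary: x) (auto intro!: trans_op_mono)

lemma trans_op_cmult: "trans_op p (\<lambda>x. c * g x) = (\<lambda>x. c * trans_op p g x)"
  by (auto simp: trans_op_def nn_integral_cmult[symmetric] mult.left_commute)

lemma trans_op_iter_cmult: "(trans_op p ^^ n) (\<lambda>x. c * g x) = (\<lambda>x. c * (trans_op p ^^ n) g x)"
  by (induction n) (simp_all add: trans_op_cmult)

lemma trans_op_suminf: "trans_op p (\<lambda>x. \<Sum>i. g i x) = (\<lambda>x. \<Sum>i. trans_op p (g i) x)"
proof
  fix x
  have "trans_op p (\<lambda>x. \<Sum>i. g i x) x = (\<integral>\<^sup>+y. (\<Sum>i. ennreal (p x y) * g i y) \<partial>count_space UNIV)"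
    unfolding trans_op_def by (subst ennreal_suminf_cmult) (rule refl)
  also have "\<dots> = (\<Sum>i. trans_op p (g i) x)"
    unfolding trans_op_def by (rule nn_integral_suminf) simp
  finally show "trans_op p (\<lambda>x. \<Sum>i. g i x) x = (\<Sum>i. trans_op p (g i) x)" .
qed

lemma trans_op_nn_integral:
  fixes g :: "'i::countable \<Rightarrow> 'v::countable \<Rightarrow> ennreal"
  shows "trans_op p (\<lambda>x. \<integral>\<^sup>+i. g i x \<partial>count_space UNIV) = (\<lambda>x. \<integral>\<^sup>+i. trans_op p (g i) x \<partial>count_space UNIV)"
proof
  fix x
  show "trans_op p (\<lambda>x. \<integral>\<^sup>+i. g i x \<partial>count_space UNIV) x = (\<integral>\<^sup>+i. trans_op p (g i) x \<partial>count_space UNIV)"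
    unfolding trans_op_def
    by (subst nn_integral_count_space_nn_integral[symmetric]) (auto simp: nn_integral_cmult)
qed

lemma trans_op_iter_nn_integral:
  fixes g :: "'i::countable \<Rightarrow> 'v::countable \<Rightarrow> ennreal"
  shows "(trans_op p ^^ n) (\<lambda>x. \<integral>\<^sup>+i. g i x \<partial>count_space UNIV) =
    (\<lambda>x. \<integral>\<^sup>+i. (trans_op p ^^ n) (g i) x \<partial>count_space UNIV)"
  by (induction n) (simp_all add: trans_op_nn_integral)

lemma funpow_Suc_apply': "(f ^^ Suc n) x = (f ^^ n) (f x)"
  by (induction n) simp_all

lemma nn_integral_point_mult:
  "(\<integral>\<^sup>+y. g y * point x y \<partial>count_space UNIV) = g x"
proof -
  have "(\<integral>\<^sup>+y. g y * point x y \<partial>count_space UNIV) = (\<integral>\<^sup>+y. g x * indicator {x} y \<partial>count_space UNIV)"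
    by (intro nn_integral_cong) (auto simp: indicator_def)
  then show ?thesis by (simp add: nn_integral_cmult_indicator)
qed

lemma decompose_points: "g x = (\<integral>\<^sup>+y. g y * point y x \<partial>count_space UNIV)"
proof -
  have "point y x = point x y" for y :: 'a by auto
  then show ?thesis using nn_integral_point_mult[of g x] by simp
qed

lemma heat_cmult: "heat p t (\<lambda>x. c * g x) x = c * heat p t g x"
proof -
  have "heat p t (\<lambda>x. c * g x) x =
      (\<Sum>n. c * (ennreal (exp (- t) * t ^ n / fact n) * (trans_op p ^^ n) g x))"
    unfolding heat_def trans_op_iter_cmult by (subst mult.left_commute) (rule refl)
  then show ?thesis unfolding heat_def by (simp only: ennreal_suminf_cmult)
qed

lemma heat_mono: "(\<And>x. g x \<le> h x) \<Longrightarrow> heat p t g x \<le> heat p t h x"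
  unfolding heat_def by (intro suminf_le mult_left_mono trans_op_iter_mono) auto

lemma heat_nn_integral:
  fixes g :: "'i::countable \<Rightarrow> 'v::countable \<Rightarrow> ennreal"
  shows "heat p t (\<lambda>x. \<integral>\<^sup>+i. g i x \<partial>count_space UNIV) x = (\<integral>\<^sup>+i. heat p t (g i) x \<partial>count_space UNIV)"
proof -
  let ?w = "\<lambda>n. ennreal (exp (- t) * t ^ n / fact n)"
  have "heat p t (\<lambda>x. \<integral>\<^sup>+i. g i x \<partial>count_space UNIV) x =
      (\<Sum>n. \<integral>\<^sup>+i. ?w n * (trans_op p ^^ n) (g i) x \<partial>count_space UNIV)"
    unfolding heat_def trans_op_iter_nn_integral by (subst nn_integral_cmult) auto
  also have "\<dots> = (\<integral>\<^sup>+i. heat p t (g i) x \<partial>count_space UNIV)"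
    unfolding heat_def by (rule nn_integral_suminf[symmetric]) simp
  finally show ?thesis .
qed

lemma heat_kernel:
  fixes g :: "'v::countable \<Rightarrow> ennreal"
  shows "heat p t g x = (\<integral>\<^sup>+y. g y * heat p t (point y) x \<partial>count_space UNIV)"
proof -
  have "heat p t g x = heat p t (\<lambda>x. \<integral>\<^sup>+y. g y * point y x \<partial>count_space UNIV) x"
    by (subst decompose_points[of g, symmetric]) simp
  then show ?thesis by (simp add: heat_nn_integral heat_cmult)
qed

lemma heat_0: "heat p 0 g x = g x"
proof -
  have "heat p 0 g x = (\<Sum>n\<in>{0}. ennreal (exp (- 0) * 0 ^ n / fact n) * (trans_op p ^^ n) g x)"
    unfolding heat_def by (rule suminf_finite) auto
  then show ?thesis by simp
qed

lemma poisson_weights_sum: "0 \<le> t \<Longrightarrow> (\<Sum>n. ennreal (exp (- t) * t ^ n / fact n)) = 1"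
proof -
  assume "0 \<le> t"
  have "(\<lambda>n. exp (- t) * (t ^ n /\<^sub>R fact n)) sums (exp (- t) * exp t)"
    by (intro sums_mult exp_converges)
  then have "(\<lambda>n. exp (- t) * t ^ n / fact n) sums 1"
    by (simp add: exp_minus field_simps)
  then have "(\<Sum>n. ennreal (exp (- t) * t ^ n / fact n)) = ennreal 1"
    by (rule suminf_ennreal_eq[rotated]) (use \<open>0 \<le> t\<close> in simp)
  then show ?thesis by (simp only: ennreal_1)
qed

lemma heat_add: "heat p t (\<lambda>x. g x + h x) x = heat p t g x + heat p t h x"
proof -
  have 1: "trans_op p (\<lambda>x. g x + h x) = (\<lambda>x. trans_op p g x + trans_op p h x)" for g h
  proof
    fix x
    show "trans_op p (\<lambda>x. g x + h x) x = trans_op p g x + trans_op p h x"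
      unfolding trans_op_def by (simp only: distrib_left, rule nn_integral_add) simp_all
  qed
  have "(trans_op p ^^ n) (\<lambda>x. g x + h x) = (\<lambda>x. (trans_op p ^^ n) g x + (trans_op p ^^ n) h x)" for n
  proof (induction n)
    case (Suc n)
    show ?case unfolding funpow.simps o_def Suc by (rule 1)
  qed simp
  then have "heat p t (\<lambda>x. g x + h x) x = (\<Sum>n. ennreal (exp (- t) * t ^ n / fact n) * (trans_op p ^^ n) g x +
      ennreal (exp (- t) * t ^ n / fact n) * (trans_op p ^^ n) h x)"
    unfolding heat_def by (simp only: distrib_left)
  also have "\<dots> = heat p t g x + heat p t h x"
    unfolding heat_def by (rule suminf_add[symmetric]) (rule summableI)+
  finally show ?thesis .
qed

locale symmetric_walk =
  fixes p :: "'v::countable \<Rightarrow> 'v \<Rightarrow> real"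
  assumes rw: "irreducible_symmetric_rw p"
begin

abbreviation P :: "('v \<Rightarrow> ennreal) \<Rightarrow> 'v \<Rightarrow> ennreal" where
  "P \<equiv> trans_op p"

lemma p_nonneg: "0 \<le> p x y" and p_sym: "p x y = p y x" and p_has_sum: "(p x has_sum 1) UNIV"
  using rw unfolding irreducible_symmetric_rw_def by blast+

lemma p_total: "(\<integral>\<^sup>+y. ennreal (p x y) \<partial>count_space UNIV) = 1"
  using p_has_sum[of x] by (subst nn_integral_count_space_eq_infsum)
    (auto simp: p_nonneg infsumI has_sum_imp_summable)

lemma pmf_kernel: "pmf (embed_pmf (p x)) y = p x y"
  by (rule pmf_embed_pmf) (simp_all add: p_nonneg p_total)

lemma nn_integral_kernel: "(\<integral>\<^sup>+y. g y \<partial>measure_pmf (embed_pmf (p x))) = P g x"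
  by (simp add: nn_integral_measure_pmf pmf_kernel trans_op_def)

lemma trans_op_const: "P (\<lambda>_. c) = (\<lambda>_. c)"
proof
  fix x
  show "P (\<lambda>_. c) x = c"
    unfolding trans_op_def by (subst nn_integral_multc) (simp_all add: p_total)
qed

lemma trans_op_iter_const: "(P ^^ n) (\<lambda>_. c) = (\<lambda>_. c)"
  by (induction n) (simp_all add: trans_op_const)

lemma heat_const: "0 \<le> t \<Longrightarrow> heat p t (\<lambda>_. c) x = c"
  unfolding heat_def trans_op_iter_const ennreal_suminf_multc poisson_weights_sum by simp

lemma trans_op_symmetric:
  "(\<integral>\<^sup>+x. a x * P b x \<partial>count_space UNIV) = (\<integral>\<^sup>+x. P a x * b x \<partial>count_space UNIV)"
proof -
  have "(\<integral>\<^sup>+x. a x * P b x \<partial>count_space UNIV) =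
      (\<integral>\<^sup>+x. \<integral>\<^sup>+y. a x * (ennreal (p x y) * b y) \<partial>count_space UNIV \<partial>count_space UNIV)"
    unfolding trans_op_def by (simp add: nn_integral_cmult)
  also have "\<dots> = (\<integral>\<^sup>+y. \<integral>\<^sup>+x. a x * (ennreal (p x y) * b y) \<partial>count_space UNIV \<partial>count_space UNIV)"
    by (rule nn_integral_count_space_nn_integral) auto
  also have "\<dots> = (\<integral>\<^sup>+y. \<integral>\<^sup>+x. (ennreal (p y x) * a x) * b y \<partial>count_space UNIV \<partial>count_space UNIV)"
    by (subst p_sym) (simp add: mult_ac)
  also have "\<dots> = (\<integral>\<^sup>+x. P a x * b x \<partial>count_space UNIV)"
    unfolding trans_op_def by (simp add: nn_integral_multc)
  finally show ?thesis .
qed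

lemma trans_op_iter_symmetric:
  "(\<integral>\<^sup>+x. a x * (P ^^ n) b x \<partial>count_space UNIV) = (\<integral>\<^sup>+x. (P ^^ n) a x * b x \<partial>count_space UNIV)"
proof (induction n arbitrary: b)
  case (Suc n)
  have "(\<integral>\<^sup>+x. a x * (P ^^ Suc n) b x \<partial>count_space UNIV) = (\<integral>\<^sup>+x. (P ^^ n) a x * P b x \<partial>count_space UNIV)"
    unfolding funpow_Suc_apply' by (rule Suc)
  then show ?case by (simp add: trans_op_symmetric)
qed simp

lemma trans_op_iter_point_sym: "(P ^^ n) (point y) x = (P ^^ n) (point x) y"
proof -
  have "(P ^^ n) (point y) x = (\<integral>\<^sup>+z. (P ^^ n) (point y) z * point x z \<partial>count_space UNIV)"
    by (simp add: nn_integral_point_mult)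
  also have "\<dots> = (\<integral>\<^sup>+z. (P ^^ n) (point x) z * point y z \<partial>count_space UNIV)"
    by (subst trans_op_iter_symmetric[symmetric]) (simp add: mult.commute)
  finally show ?thesis by (simp add: nn_integral_point_mult)
qed

lemma heat_point_sym: "heat p t (point y) x = heat p t (point x) y"
  by (simp add: heat_def trans_op_iter_point_sym[of _ y x])

lemma trans_op_iter_le_const: "(\<And>x. g x \<le> c) \<Longrightarrow> (P ^^ n) g x \<le> c"
  using trans_op_iter_mono[of g "\<lambda>_. c" n p x] by (simp add: trans_op_iter_const)

lemma heat_le_const: "(\<And>x. g x \<le> c) \<Longrightarrow> 0 \<le> t \<Longrightarrow> heat p t g x \<le> c"
  using heat_mono[of g "\<lambda>_. c" p t x] by (simp add: heat_const)

text \<open>Irreducibility is expressed by real-valued \<open>n\<close>-step probabilities; this identifies them with iterates of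
  the transition operator.\<close>

lemma ennreal_nstep: "ennreal (nstep p n x y) = (P ^^ n) (point y) x" "0 \<le> nstep p n x y"
proof (induction n arbitrary: x)
  case 0
  { case 1 show ?case by auto }
  { case 2 show ?case by simp }
next
  case (Suc n)
  have le: "nstep p n z y \<le> 1" for z
  proof -
    have "ennreal (nstep p n z y) \<le> 1"
      unfolding Suc.IH(1) by (rule trans_op_iter_le_const) auto
    then show ?thesis by simp
  qed
  have sm: "(\<lambda>z. p x z * nstep p n z y) summable_on UNIV" for x
  proof (rule summable_on_comparison_test)
    show "p x summable_on UNIV" using p_has_sum has_sum_imp_summable by blast
    show "p x z * nstep p n z y \<le> p x z" for z
      using p_nonneg[of x z] Suc.IH(2)[of z] le[of z] by (simp add: mult_left_le)
    show "0 \<le> p x z * nstep p n z y" for z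
      using p_nonneg[of x z] Suc.IH(2)[of z] by simp
  qed
  { case 1
    have "ennreal (nstep p (Suc n) x y) = (\<integral>\<^sup>+z. ennreal (p x z * nstep p n z y) \<partial>count_space UNIV)"
      unfolding nstep.simps
      by (rule nn_integral_count_space_eq_infsum[OF sm, symmetric]) (simp add: p_nonneg Suc)
    also have "\<dots> = P ((P ^^ n) (point y)) x"
      unfolding trans_op_def[of p _ x] by (simp only: ennreal_mult p_nonneg Suc)
    finally show ?case by simp }
  { case 2 show ?case by (auto intro!: infsum_nonneg simp: p_nonneg Suc) }
qed

lemma irreducible: "\<exists>n\<ge>1. (P ^^ n) (point y) x > 0"
proof -
  obtain n where "n \<ge> 1" "0 < nstep p n x y"
    using rw unfolding irreducible_symmetric_rw_def by blast
  then show ?thesis using ennreal_nstep(1)[of n x y] by (auto simp: ennreal_less_zero_iff intro!: exI[of _ n] simp flip: ennreal_nstep)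
qed

end

section \<open>The law of the random walk\<close>

context symmetric_walk begin

abbreviation U_row :: "('v \<Rightarrow> 'v) measure" where
  "U_row \<equiv> \<Pi>\<^sub>M x\<in>UNIV. measure_pmf (embed_pmf (p x))"

abbreviation U_space :: "(nat \<Rightarrow> 'v \<Rightarrow> 'v) measure" where
  "U_space \<equiv> \<Pi>\<^sub>M n\<in>UNIV. U_row"

lemma prob_space_U_row: "prob_space U_row"
  by (intro prob_space_PiM measure_pmf.prob_space_axioms)

lemma measurable_U_row: "(\<lambda>u. u x) \<in> U_row \<rightarrow>\<^sub>M count_space UNIV"
  using measurable_component_singleton[of x UNIV "\<lambda>x. measure_pmf (embed_pmf (p x))"]
  by (simp cong: measurable_cong_sets)

lemma measurable_U_space: "(\<lambda>U. U n x) \<in> U_space \<rightarrow>\<^sub>M count_space UNIV"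
  by (rule measurable_compose[of "\<lambda>U. U n", OF measurable_component_singleton measurable_U_row]) simp

lemma nn_integral_U_row: "(\<integral>\<^sup>+u. g (u x) \<partial>U_row) = P g x"
proof -
  have "P g x = (\<integral>\<^sup>+y. g y \<partial>distr U_row (measure_pmf (embed_pmf (p x))) (\<lambda>u. u x))"
    by (subst distr_PiM_component) (auto simp: nn_integral_kernel measure_pmf.prob_space_axioms)
  also have "\<dots> = (\<integral>\<^sup>+u. g (u x) \<partial>U_row)"
    by (rule nn_integral_distr) auto
  finally show ?thesis by simp
qed

sublocale U: sequence_space U_row
  unfolding sequence_space_def by (rule product_prob_spaceI) (rule prob_space_U_row)

lemma measurable_skeleton [measurable]: "(\<lambda>U. skeleton x U n) \<in> U_space \<rightarrow>\<^sub>M count_space UNIV"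
proof (induction n)
  case (Suc n)
  have "(\<lambda>U. U n (skeleton x U n)) \<in> U_space \<rightarrow>\<^sub>M count_space UNIV"
    by (rule measurable_compose_countable[where f = "\<lambda>y U. U n y", OF measurable_U_space Suc])
  then show ?case by simp
qed simp

lemma skeleton_case_nat: "skeleton x (case_nat u U) (Suc n) = skeleton (u x) U n"
  by (induction n) auto

text \<open>An i.i.d. sequence of random maps with one more independent map put in front has the same law, so the
  first step can be split off.\<close>

lemma nn_integral_skeleton: "(\<integral>\<^sup>+U. g (skeleton x U n) \<partial>U_space) = (P ^^ n) g x"
proof (induction n arbitrary: x)
  case 0
  show ?case by (simp add: U.P.emeasure_space_1)
next
  case (Suc n)
  have "(\<integral>\<^sup>+U. g (skeleton x U (Suc n)) \<partial>U_space) =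
     (\<integral>\<^sup>+U. g (skeleton x U (Suc n)) \<partial>distr (U_row \<Otimes>\<^sub>M U_space) U_space (\<lambda>(s, \<omega>). case_nat s \<omega>))"
    by (subst U.PiM_iter) simp
  also have "\<dots> = (\<integral>\<^sup>+z. g (skeleton (fst z x) (snd z) n) \<partial>(U_row \<Otimes>\<^sub>M U_space))"
    by (subst nn_integral_distr) (simp_all add: case_prod_unfold skeleton_case_nat del: skeleton.simps)
  also have "\<dots> = (\<integral>\<^sup>+u. \<integral>\<^sup>+U. g (skeleton (u x) U n) \<partial>U_space \<partial>U_row)"
  proof (subst U.P.nn_integral_fst[symmetric])
    have "(\<lambda>z. skeleton (fst z x) (snd z) n) \<in> U_row \<Otimes>\<^sub>M U_space \<rightarrow>\<^sub>M count_space UNIV"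
      by (rule measurable_compose_countable[where f = "\<lambda>y z. skeleton y (snd z) n" and g = "\<lambda>z. fst z x"]) measurable
    then show "(\<lambda>z. g (skeleton (fst z x) (snd z) n)) \<in> borel_measurable (U_row \<Otimes>\<^sub>M U_space)"
      by (rule measurable_compose) simp
  qed simp
  also have "\<dots> = P ((P ^^ n) g) x"
    by (simp add: Suc nn_integral_U_row)
  finally show ?case by simp
qed

end

lemma exp_clock_sets [measurable_cong, simp]: "sets exp_clock = sets borel"
  by (simp add: exp_clock_def)

lemma exp_clock_space [simp]: "space exp_clock = UNIV"
  by (simp add: exp_clock_def)

lemma prob_space_exp_clock: "prob_space exp_clock"
  unfolding exp_clock_def by (rule prob_space_exponential_density) simp

abbreviation clocks :: "(nat \<Rightarrow> real) measure" where
  "clocks \<equiv> \<Pi>\<^sub>M n\<in>UNIV. exp_clock"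

interpretation clocks: sequence_space exp_clock
  unfolding sequence_space_def by (rule product_prob_spaceI) (rule prob_space_exp_clock)

lemma measurable_clock: "(\<lambda>E. E n) \<in> borel_measurable clocks"
  using measurable_component_singleton[of n UNIV "\<lambda>_. exp_clock"] by (simp cong: measurable_cong_sets)

text \<open>Mind the index: \<open>ring_time E 0\<close> is the first ring.\<close>

abbreviation ring_time :: "(nat \<Rightarrow> real) \<Rightarrow> nat \<Rightarrow> real" where
  "ring_time E n \<equiv> \<Sum>k\<le>n. E k"

abbreviation rings :: "(nat \<Rightarrow> real) \<Rightarrow> real \<Rightarrow> nat" where
  "rings E t \<equiv> card {n. ring_time E n \<le> t}"

lemma indep_clocks: "clocks.P.indep_vars (\<lambda>_. borel) (\<lambda>n E. E n) I"
proof (cases "I = {}")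
  case False
  have d: "distr clocks borel (\<lambda>E. E n) = exp_clock" for n
    using distr_PiM_component[of UNIV "\<lambda>_. exp_clock" n] prob_space_exp_clock
    by (simp cong: distr_cong)
  have "distr clocks (\<Pi>\<^sub>M i\<in>I. borel) (\<lambda>E. \<lambda>i\<in>I. E i) = distr clocks (\<Pi>\<^sub>M i\<in>I. exp_clock) (\<lambda>E. \<lambda>i\<in>I. E i)"
    by (intro distr_cong sets_PiM_cong) auto
  also have "\<dots> = (\<Pi>\<^sub>M i\<in>I. exp_clock)"
    using distr_PiM_reindex[of UNIV "\<lambda>_. exp_clock" "\<lambda>x. x" I] prob_space_exp_clock by simp
  finally show ?thesis
    by (subst clocks.P.indep_vars_iff_distr_eq_PiM[OF False]) (simp_all add: d)
qed (simp add: clocks.P.indep_vars_def clocks.P.indep_sets_def)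

lemma clock_distributed: "distributed clocks lborel (\<lambda>E. E n) (exponential_density 1)"
  unfolding distributed_def
proof (intro conjI)
  have "distr clocks lborel (\<lambda>E. E n) = exp_clock"
    using distr_PiM_component[of UNIV "\<lambda>_. exp_clock" n] prob_space_exp_clock
    by (simp add: exp_clock_def cong: distr_cong)
  then show "distr clocks lborel (\<lambda>E. E n) = density lborel (exponential_density 1)"
    by (simp add: exp_clock_def)
qed auto

lemma ring_time_distributed: "distributed clocks lborel (\<lambda>E. ring_time E n) (erlang_density n 1)"
  using clocks.P.exponential_distributed_sum[of "{..n}" 1 "\<lambda>n E. E n"] indep_clocks clock_distributed
  by simp

lemma prob_ring_time_le:
  assumes "0 \<le> t"
  shows "clocks.P.prob {E\<in>space clocks. ring_time E n \<le> t} = erlang_CDF n 1 t"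
proof -
  from clocks.P.erlang_distributed_le[OF ring_time_distributed] assms show ?thesis
    by (simp add: clocks.P.emeasure_eq_measure)
qed

lemma erlang_CDF_tendsto_0: "0 \<le> t \<Longrightarrow> (\<lambda>n. erlang_CDF n 1 t) \<longlonglongrightarrow> 0"
proof -
  assume t: "0 \<le> t"
  have "(\<lambda>n. exp (- t) * (t ^ n /\<^sub>R fact n)) sums (exp (- t) * exp t)"
    by (intro sums_mult exp_converges)
  then have "(\<lambda>n. t ^ n * exp (- t) / fact n) sums 1"
    by (simp add: exp_minus field_simps)
  then have "(\<lambda>n. \<Sum>k\<le>n. t ^ k * exp (- t) / fact k) \<longlonglongrightarrow> 1"
    by (simp add: sums_def_le)
  then have "(\<lambda>n. 1 - (\<Sum>k\<le>n. t ^ k * exp (- t) / fact k)) \<longlonglongrightarrow> 1 - 1"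
    by (intro tendsto_diff tendsto_const)
  then show ?thesis using t by (simp add: erlang_CDF_def)
qed

lemma AE_exp_clock_pos: "AE e in exp_clock. 0 < e"
proof -
  have "AE x in lborel. x \<noteq> (0::real)" by (rule AE_lborel_singleton)
  then show ?thesis unfolding exp_clock_def
    by (subst AE_density) (auto simp: exponential_density_def elim!: eventually_mono)
qed

text \<open>Regularity makes the set of rings up to a given time finite. This matters because \<open>rings\<close> is a
  cardinality, which would be 0 for an infinite set.\<close>

definition regular_clock :: "(nat \<Rightarrow> real) \<Rightarrow> bool" where
  "regular_clock E \<longleftrightarrow> (\<forall>n. 0 < E n) \<and> (\<forall>m::nat. \<exists>n. real m < ring_time E n)"

lemma AE_regular_clock: "AE E in clocks. regular_clock E"
proof -
  have "AE E in clocks. 0 < E n" for n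
    using prob_space_exp_clock AE_exp_clock_pos by (intro AE_PiM_component) auto
  moreover have "AE E in clocks. \<exists>n. real m < ring_time E n" for m
  proof -
    let ?B = "{E\<in>space clocks. \<forall>n. ring_time E n \<le> real m}"
    have [measurable]: "?B \<in> sets clocks" by measurable
    have "clocks.P.prob ?B \<le> erlang_CDF n 1 (real m)" for n
      unfolding prob_ring_time_le[of "real m" n, symmetric, OF of_nat_0_le_iff]
      by (intro clocks.P.finite_measure_mono) auto
    then have "clocks.P.prob ?B \<le> 0"
      by (intro LIMSEQ_le_const[OF erlang_CDF_tendsto_0[of "real m"]]) auto
    then have "emeasure clocks ?B = 0"
      by (simp add: clocks.P.emeasure_eq_measure measure_le_0_iff)
    then show ?thesis by (intro AE_I[where N = ?B]) (auto simp: not_less)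
  qed
  ultimately show ?thesis
    unfolding regular_clock_def by (simp add: AE_all_countable AE_conj_iff)
qed

lemma ring_time_strict_mono:
  assumes "regular_clock E" "m < n" shows "ring_time E m < ring_time E n"
proof -
  have "strict_mono (ring_time E)"
    using assms(1) by (subst strict_mono_Suc_iff) (simp add: regular_clock_def)
  then show ?thesis using assms(2) by (simp add: strict_mono_def)
qed

text \<open>The number of rings is the inverse of the sequence of ring times.\<close>

lemma ring_time_le_iff:
  assumes E: "regular_clock E"
  shows "ring_time E n \<le> t \<longleftrightarrow> n < rings E t"
proof -
  obtain N where N: "t < ring_time E N"
    using E reals_Archimedean2[of t] unfolding regular_clock_def by (meson less_trans)
  define L where "L = (LEAST n. t < ring_time E n)"
  have L: "t < ring_time E L" "\<And>n. n < L \<Longrightarrow> ring_time E n \<le> t"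
    using LeastI[of "\<lambda>n. t < ring_time E n", OF N] not_less_Least[of _ "\<lambda>n. t < ring_time E n"]
    by (auto simp: L_def not_less)
  have "ring_time E n \<le> t \<longleftrightarrow> n < L" for n
    using L ring_time_strict_mono[OF E, of L n] by (cases n L rule: linorder_cases) auto
  then have "{n. ring_time E n \<le> t} = {..<L}" by auto
  with \<open>\<And>n. ring_time E n \<le> t \<longleftrightarrow> n < L\<close> show ?thesis by simp
qed

lemma measurable_rings [measurable]: "(\<lambda>E. rings E t) \<in> clocks \<rightarrow>\<^sub>M count_space UNIV"
  by measurable

lemma prob_rings_greater:
  assumes t: "0 \<le> t"
  shows "clocks.P.prob {E\<in>space clocks. n < rings E t} = erlang_CDF n 1 t"
proof -
  have "clocks.P.prob {E\<in>space clocks. n < rings E t} = clocks.P.prob {E\<in>space clocks. ring_time E n \<le> t}"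
  proof (rule clocks.P.prob_eq_AE)
    show "AE E in clocks. (n < rings E t) = (ring_time E n \<le> t)"
      using AE_regular_clock by eventually_elim (rule ring_time_le_iff[symmetric])
  qed measurable
  also have "\<dots> = erlang_CDF n 1 t"
    by (rule prob_ring_time_le[OF t])
  finally show ?thesis .
qed

text \<open>The Poisson weight is the difference of two consecutive Erlang distribution functions.\<close>

lemma emeasure_rings:
  assumes t: "0 \<le> t"
  shows "emeasure clocks {E\<in>space clocks. rings E t = n} = ennreal (exp (- t) * t ^ n / fact n)"
proof -
  have gt [measurable]: "{E\<in>space clocks. n < rings E t} \<in> sets clocks" for n
    by measurable
  have "clocks.P.prob {E\<in>space clocks. rings E t = n} = exp (- t) * t ^ n / fact n"
  proof (cases n)
    case 0
    have "{E\<in>space clocks. rings E t = n} = space clocks - {E\<in>space clocks. 0 < rings E t}"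
      unfolding 0 by fastforce
    then have "clocks.P.prob {E\<in>space clocks. rings E t = n} = 1 - erlang_CDF 0 1 t"
      by (simp only: clocks.P.prob_compl[OF gt] prob_rings_greater[OF t])
    then show ?thesis using t 0 by (simp add: erlang_CDF_def)
  next
    case (Suc m)
    have "{E\<in>space clocks. rings E t = n} = {E\<in>space clocks. m < rings E t} - {E\<in>space clocks. n < rings E t}"
      unfolding Suc by (auto simp only: mem_Collect_eq Diff_iff less_Suc_eq_le Suc_le_eq[symmetric] le_antisym)
    moreover have "{E\<in>space clocks. n < rings E t} \<subseteq> {E\<in>space clocks. m < rings E t}"
      unfolding Suc using Suc_lessD by blast
    ultimately have "clocks.P.prob {E\<in>space clocks. rings E t = n} = erlang_CDF m 1 t - erlang_CDF n 1 t"
      by (simp only: clocks.P.finite_measure_Diff[OF gt gt] prob_rings_greater[OF t])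
    then show ?thesis using t Suc by (simp add: erlang_CDF_def)
  qed
  then show ?thesis by (simp only: clocks.P.emeasure_eq_measure)
qed

lemma nn_integral_rings:
  assumes t: "0 \<le> t"
  shows "(\<integral>\<^sup>+E. h (rings E t) \<partial>clocks) = (\<Sum>n. ennreal (exp (- t) * t ^ n / fact n) * h n)"
proof -
  have "(\<integral>\<^sup>+E. h (rings E t) \<partial>clocks) = (\<integral>\<^sup>+E. (\<Sum>n. h n * indicator {E\<in>space clocks. rings E t = n} E) \<partial>clocks)"
  proof (rule nn_integral_cong)
    fix E assume E: "E \<in> space clocks"
    have "(\<Sum>n. h n * indicator {E\<in>space clocks. rings E t = n} E) =
          (\<Sum>n\<in>{rings E t}. h n * indicator {E\<in>space clocks. rings E t = n} E)"
      by (rule suminf_finite) (auto simp: indicator_def)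
    then show "h (rings E t) = (\<Sum>n. h n * indicator {E\<in>space clocks. rings E t = n} E)"
      using E by simp
  qed
  also have "\<dots> = (\<Sum>n. \<integral>\<^sup>+E. h n * indicator {E\<in>space clocks. rings E t = n} E \<partial>clocks)"
    by (rule nn_integral_suminf) measurable
  also have "\<dots> = (\<Sum>n. ennreal (exp (- t) * t ^ n / fact n) * h n)"
    using emeasure_rings[OF t] by (subst nn_integral_cmult_indicator) (auto simp: mult.commute)
  finally show ?thesis .
qed

context symmetric_walk begin

lemma walk_space_eq: "walk_space p = U_space \<Otimes>\<^sub>M clocks"
  by (simp add: walk_space_def)

lemma prob_space_walk_space: "prob_space (walk_space p)"
proof -
  interpret pair_prob_space U_space clocks ..
  show ?thesis unfolding walk_space_eq by unfold_locales
qed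

text \<open>Joint measurability in path and time is needed because the particles that enter at the source are
  observed at random ages.\<close>

lemma measurable_walk_joint:
  "(\<lambda>(\<omega>, s). walk x \<omega> s) \<in> walk_space p \<Otimes>\<^sub>M borel \<rightarrow>\<^sub>M count_space UNIV"
proof -
  have r: "(\<lambda>z. rings (snd (fst z)) (snd z)) \<in> walk_space p \<Otimes>\<^sub>M borel \<rightarrow>\<^sub>M count_space UNIV"
  proof (rule measurable_card)
    fix n
    have 1: "(\<lambda>z. snd (fst z) k) \<in> borel_measurable (walk_space p \<Otimes>\<^sub>M borel)" for k
      unfolding walk_space_eq
      by (rule measurable_compose[OF measurable_compose[OF measurable_fst measurable_snd] measurable_clock])
    have "(\<lambda>z. ring_time (snd (fst z)) n) \<in> borel_measurable (walk_space p \<Otimes>\<^sub>M borel)"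
      by (rule borel_measurable_sum) (rule 1)
    then show "{z \<in> space (walk_space p \<Otimes>\<^sub>M borel). n \<in> {n. ring_time (snd (fst z)) n \<le> snd z}} \<in> sets (walk_space p \<Otimes>\<^sub>M borel)"
      by (simp only: mem_Collect_eq) (rule borel_measurable_le, simp_all)
  qed
  have f: "(\<lambda>z. skeleton x (fst (fst z)) n) \<in> walk_space p \<Otimes>\<^sub>M borel \<rightarrow>\<^sub>M count_space UNIV" for n
    unfolding walk_space_eq
    by (rule measurable_compose[OF measurable_compose[OF measurable_fst measurable_fst] measurable_skeleton])
  show ?thesis
    unfolding walk_def case_prod_unfold
    by (rule measurable_compose_countable[where f = "\<lambda>n z. skeleton x (fst (fst z)) n", OF f r])
qed

lemma measurable_walk [measurable]: "(\<lambda>\<omega>. walk x \<omega> t) \<in> walk_space p \<rightarrow>\<^sub>M count_space UNIV"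
  using measurable_compose[OF _ measurable_walk_joint, of "\<lambda>\<omega>. (\<omega>, t)" "walk_space p" x] by simp

lemma rw_expect_eq_heat:
  assumes t: "0 \<le> t"
  shows "rw_expect p x t g = heat p t g x"
proof -
  interpret pair_prob_space U_space clocks ..
  have "(\<lambda>\<omega>. g (walk x \<omega> t)) \<in> borel_measurable (U_space \<Otimes>\<^sub>M clocks)"
    using measurable_compose[OF measurable_walk, of g borel x t] by (simp add: walk_space_eq)
  then have "rw_expect p x t g = (\<integral>\<^sup>+E. \<integral>\<^sup>+U. g (walk x (U, E) t) \<partial>U_space \<partial>clocks)"
    unfolding rw_expect_def walk_space_eq by (subst nn_integral_snd[symmetric]) simp_all
  also have "\<dots> = (\<integral>\<^sup>+E. (P ^^ rings E t) g x \<partial>clocks)"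
    by (simp add: walk_def nn_integral_skeleton)
  also have "\<dots> = heat p t g x"
    unfolding heat_def by (rule nn_integral_rings[OF t])
  finally show ?thesis .
qed

end

section \<open>Generating functions of Poisson configurations\<close>

text \<open>The function \<open>r \<mapsto> exp (- r)\<close>, continued by its limit at infinity.\<close>

definition nexp :: "ennreal \<Rightarrow> real" where
  "nexp r = (if r = \<infinity> then 0 else exp (- enn2real r))"

lemma nexp_bounds: "0 \<le> nexp r" "nexp r \<le> 1"
  by (simp_all add: nexp_def)

lemma nexp_0 [simp]: "nexp 0 = 1"
  by (simp add: nexp_def)

lemma nexp_top [simp]: "nexp \<top> = 0"
  by (simp add: nexp_def)

lemma nexp_ennreal: "0 \<le> r \<Longrightarrow> nexp (ennreal r) = exp (- r)"
  by (simp add: nexp_def)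

lemma nexp_add: "nexp (a + b) = nexp a * nexp b"
proof (cases "a = \<infinity> \<or> b = \<infinity>")
  case False
  then have "enn2real (a + b) = enn2real a + enn2real b"
    by (intro enn2real_plus) (auto simp: less_top)
  then show ?thesis using False by (simp add: nexp_def exp_add[symmetric])
qed (auto simp: nexp_def)

lemma nexp_sum: "finite I \<Longrightarrow> nexp (\<Sum>i\<in>I. a i) = (\<Prod>i\<in>I. nexp (a i))"
  by (induction I rule: finite_induct) (simp_all add: nexp_add)

lemma tendsto_nexp:
  assumes "(a \<longlongrightarrow> b) F"
  shows "((\<lambda>i. nexp (a i)) \<longlongrightarrow> nexp b) F"
proof (cases "b = \<infinity>")
  case False
  then have "((\<lambda>i. exp (- enn2real (a i))) \<longlongrightarrow> exp (- enn2real b)) F"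
    using assms by (intro tendsto_intros tendsto_enn2real) (auto simp: less_top)
  moreover have "eventually (\<lambda>i. exp (- enn2real (a i)) = nexp (a i)) F"
  proof -
    have "eventually (\<lambda>i. a i < \<infinity>) F"
      using order_tendstoD(2)[OF assms, of \<infinity>] False by (simp add: less_top)
    then show ?thesis by eventually_elim (auto simp: nexp_def)
  qed
  ultimately show ?thesis
    using False by (simp add: nexp_def[of b] Lim_transform_eventually)
next
  case True
  have "eventually (\<lambda>i. nexp (a i) < e) F" if "0 < e" for e
  proof -
    have "eventually (\<lambda>i. ennreal (max 0 (- ln (e / 2))) < a i) F"
      using order_tendstoD(1)[OF assms, of "ennreal (max 0 (- ln (e / 2)))"] True by simp
    then show ?thesis
    proof eventually_elim
      case (elim i)
      show "nexp (a i) < e"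
      proof (cases "a i = \<infinity>")
        case False
        then obtain r where r: "a i = ennreal r" "0 \<le> r" by (cases "a i") auto
        then have "max 0 (- ln (e / 2)) < r"
          using elim by (metis ennreal_leI not_le)
        then have "- r < ln (e / 2)" by simp
        then have "exp (- r) < e / 2"
          using that by (subst exp_ln[symmetric]) (auto simp del: exp_ln)
        then show ?thesis using r that by (simp add: nexp_ennreal)
      qed (simp add: nexp_def that)
    qed
  qed
  then show ?thesis
    using True nexp_bounds(1) by (intro order_tendstoI) (auto intro!: always_eventually intro: less_le_trans)
qed

text \<open>The value at \<open>\<infinity>\<close> is the limit of the powers for \<open>0 \<le> s < 1\<close>.\<close>

definition epow :: "real \<Rightarrow> enat \<Rightarrow> real" where
  "epow s n = (case n of enat k \<Rightarrow> s ^ k | \<infinity> \<Rightarrow> 0)"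

lemma epow_simps [simp]: "epow s (enat k) = s ^ k" "epow s \<infinity> = 0"
  by (simp_all add: epow_def)

lemma epow_bounds: "0 \<le> s \<Longrightarrow> 0 \<le> epow s n" "0 \<le> s \<Longrightarrow> s \<le> 1 \<Longrightarrow> epow s n \<le> 1"
  by (cases n; simp add: power_le_one)+

lemma epow_add: "epow s (m + n) = epow s m * epow s n"
  by (cases m; cases n) (simp_all add: power_add)

lemma finite_subset_incseq:
  assumes "finite A" "incseq F" "A \<subseteq> (\<Union>m. F m)"
  shows "\<exists>N::nat. A \<subseteq> F N"
  using assms(1,3)
proof (induction A rule: finite_induct)
  case (insert a A)
  then obtain N k where "A \<subseteq> F N" "a \<in> F k" by blast
  then have "insert a A \<subseteq> F (max N k)"
    using monoD[OF assms(2), of N "max N k"] monoD[OF assms(2), of k "max N k"] by auto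
  then show ?case by blast
qed simp

text \<open>The counts along an increasing sequence of finite sets either stabilize or tend to infinity; since
  \<open>s < 1\<close>, the powers converge in both cases.\<close>

lemma tendsto_epow_ecount:
  assumes s: "0 \<le> s" "s < 1" and F: "incseq F" "\<And>m. finite (F m)"
  shows "(\<lambda>m. s ^ card (F m)) \<longlonglongrightarrow> epow s (ecount (\<Union>m. F m))"
proof (cases "finite (\<Union>m. F m)")
  case True
  then have "\<exists>N. (\<Union>m. F m) \<subseteq> F N"
    using F(1) by (rule finite_subset_incseq) simp
  then obtain N where N: "(\<Union>m. F m) \<subseteq> F N" by blast
  have "eventually (\<lambda>m. s ^ card (F m) = epow s (ecount (\<Union>m. F m))) sequentially"
    using eventually_ge_at_top[of N]
  proof eventually_elim
    case (elim m)
    then have "F m = (\<Union>m. F m)" using N monoD[OF F(1) elim] by blast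
    then show ?case using True by (simp add: ecount_def)
  qed
  then show ?thesis by (rule tendsto_eventually)
next
  case False
  have "filterlim (\<lambda>m. card (F m)) at_top sequentially"
    unfolding filterlim_at_top
  proof
    fix K :: nat
    obtain A where A: "A \<subseteq> (\<Union>m. F m)" "finite A" "card A = K"
      using infinite_arbitrarily_large[OF False] by blast
    have "\<exists>N. A \<subseteq> F N" by (rule finite_subset_incseq[OF A(2) F(1) A(1)])
    then obtain N where N: "A \<subseteq> F N" by blast
    show "eventually (\<lambda>m. K \<le> card (F m)) sequentially"
      using eventually_ge_at_top[of N]
    proof eventually_elim
      case (elim m)
      then have "A \<subseteq> F m" using N monoD[OF F(1) elim] by blast
      then show ?case using A(3) card_mono[OF F(2)] by blast
    qed
  qed
  moreover have "(\<lambda>n. s ^ n) \<longlonglongrightarrow> 0"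
    using s by (intro LIMSEQ_realpow_zero)
  ultimately have "(\<lambda>m. s ^ card (F m)) \<longlonglongrightarrow> 0"
    by (rule filterlim_compose[rotated])
  then show ?thesis using False by (simp add: ecount_def)
qed

abbreviation config_space :: "('v \<Rightarrow> enat) measure" where
  "config_space \<equiv> \<Pi>\<^sub>M x\<in>UNIV. count_space UNIV"

lemma measurable_prod_epow:
  "(\<lambda>\<eta>. ennreal (\<Prod>x\<in>J. epow (s x) (\<eta> x))) \<in> borel_measurable config_space"
proof -
  have "(\<lambda>\<eta>. epow (s x) (\<eta> x)) \<in> borel_measurable config_space" for x
    by (rule measurable_compose[OF measurable_component_singleton[of x UNIV "\<lambda>_. count_space UNIV", OF UNIV_I]]) simp
  then show ?thesis
    by (intro measurable_compose[OF borel_measurable_prod measurable_ennreal]) auto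
qed

text \<open>If the two sequences agree below \<open>n\<close>, the remaining terms show that the difference of the \<open>n\<close>-th
  coefficients is at most \<open>4 * s\<close> for all small \<open>s > 0\<close>.\<close>

lemma power_series_coefficients_unique:
  fixes a b :: "nat \<Rightarrow> real"
  assumes bd: "\<And>n. \<bar>a n\<bar> \<le> 1" "\<And>n. \<bar>b n\<bar> \<le> 1"
    and eq: "\<And>s. 0 \<le> s \<Longrightarrow> s < 1 \<Longrightarrow> (\<Sum>n. s ^ n * a n) = (\<Sum>n. s ^ n * b n)"
  shows "a n = b n"
proof (induction n rule: less_induct)
  case (less n)
  have sm: "summable (\<lambda>k. s ^ k * c k)" if "\<And>n. \<bar>c n\<bar> \<le> 1" "0 \<le> s" "s < 1" for s :: real and c :: "nat \<Rightarrow> real"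
  proof (rule summable_comparison_test')
    show "summable (\<lambda>k. s ^ k)" using that by (intro summable_geometric) simp
    show "norm (s ^ k * c k) \<le> s ^ k" for k
      using that by (simp add: abs_mult mult_left_le)
  qed
  define d where "d k = a k - b k" for k
  have d2: "\<bar>d k\<bar> \<le> 2" for k using bd(1)[of k] bd(2)[of k] by (simp add: d_def)
  have d0: "d k = 0" if "k < n" for k using less[OF that] by (simp add: d_def)
  have bound: "\<bar>d n\<bar> \<le> 4 * s" if s: "0 < s" "s < 1/2" for s :: real
  proof -
    have sma: "summable (\<lambda>k. s ^ k * a k)" and smb: "summable (\<lambda>k. s ^ k * b k)"
      using s by (auto intro!: sm bd)
    have smd: "summable (\<lambda>k. s ^ k * d k)"
      using summable_diff[OF sma smb] by (simp add: d_def algebra_simps)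
    have "(\<Sum>k. s ^ k * d k) = 0"
      using suminf_diff[OF sma smb] s eq[of s] by (simp add: d_def algebra_simps)
    then have "(\<Sum>k. s ^ (k + Suc n) * d (k + Suc n)) + (\<Sum>k<Suc n. s ^ k * d k) = 0"
      using suminf_split_initial_segment[OF smd, of "Suc n"] by simp
    then have e: "s ^ n * d n = - (\<Sum>k. s ^ (k + Suc n) * d (k + Suc n))"
      using d0 by simp
    have g: "summable (\<lambda>k. s ^ Suc n * 2 * s ^ k)"
      using s by (intro summable_mult summable_geometric) simp
    have nb: "norm (s ^ (k + Suc n) * d (k + Suc n)) \<le> s ^ Suc n * 2 * s ^ k" for k
      using d2[of "k + Suc n"] s by (simp add: abs_mult power_add mult_left_mono)
    have "\<bar>s ^ n * d n\<bar> \<le> (\<Sum>k. s ^ Suc n * 2 * s ^ k)"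
      unfolding e real_norm_def[symmetric] norm_minus_cancel by (rule norm_suminf_le[OF nb g])
    also have "\<dots> = s ^ Suc n * 2 * (1 / (1 - s))"
      using s by (subst suminf_mult) (auto intro: summable_geometric simp: suminf_geometric)
    also have "\<dots> \<le> s ^ Suc n * 2 * 2"
      using s by (intro mult_left_mono) (auto simp: field_simps)
    finally have "s ^ n * \<bar>d n\<bar> \<le> s ^ n * (4 * s)"
      using s by (simp add: abs_mult mult_ac)
    then show ?thesis using s by simp
  qed
  have "\<bar>d n\<bar> \<le> 0"
  proof (rule field_le_epsilon)
    fix e :: real assume "0 < e"
    then have "\<bar>d n\<bar> \<le> 4 * min (1/4) (e / 4)"
      by (intro bound) (auto simp: min_less_iff_disj)
    also have "\<dots> \<le> 0 + e" by simp
    finally show "\<bar>d n\<bar> \<le> 0 + e" .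
  qed
  then show ?case by (simp add: d_def)
qed

lemma nn_integral_enat:
  assumes [measurable]: "X \<in> M \<rightarrow>\<^sub>M count_space UNIV" "R \<in> borel_measurable M"
  shows "(\<integral>\<^sup>+\<omega>. f (X \<omega>) * R \<omega> \<partial>M) =
    (\<integral>\<^sup>+n. f n * (\<integral>\<^sup>+\<omega>. indicator (X -` {n} \<inter> space M) \<omega> * R \<omega> \<partial>M) \<partial>count_space (UNIV :: enat set))"
proof -
  have [measurable]: "X -` {n} \<inter> space M \<in> sets M" for n
    by (rule measurable_sets[OF assms(1)]) simp
  have "(\<integral>\<^sup>+\<omega>. f (X \<omega>) * R \<omega> \<partial>M) =
     (\<integral>\<^sup>+\<omega>. \<integral>\<^sup>+n. f n * (indicator (X -` {n} \<inter> space M) \<omega> * R \<omega>) \<partial>count_space UNIV \<partial>M)"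
  proof (rule nn_integral_cong)
    fix \<omega> assume "\<omega> \<in> space M"
    then have "(\<integral>\<^sup>+n. f n * (indicator (X -` {n} \<inter> space M) \<omega> * R \<omega>) \<partial>count_space UNIV) =
       (\<integral>\<^sup>+n. (f (X \<omega>) * R \<omega>) * indicator {X \<omega>} n \<partial>count_space UNIV)"
      by (intro nn_integral_cong) (auto simp: indicator_def)
    then show "f (X \<omega>) * R \<omega> = (\<integral>\<^sup>+n. f n * (indicator (X -` {n} \<inter> space M) \<omega> * R \<omega>) \<partial>count_space UNIV)"
      by (simp add: nn_integral_cmult_indicator)
  qed
  also have "\<dots> = (\<integral>\<^sup>+n. \<integral>\<^sup>+\<omega>. f n * (indicator (X -` {n} \<inter> space M) \<omega> * R \<omega>) \<partial>M \<partial>count_space UNIV)"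
    by (rule nn_integral_count_space_nn_integral) auto
  also have "\<dots> = (\<integral>\<^sup>+n. f n * (\<integral>\<^sup>+\<omega>. indicator (X -` {n} \<inter> space M) \<omega> * R \<omega> \<partial>M) \<partial>count_space UNIV)"
    by (intro nn_integral_cong nn_integral_cmult) measurable
  finally show ?thesis .
qed

lemma nn_integral_count_space_enat:
  "(\<integral>\<^sup>+n. f n \<partial>count_space (UNIV :: enat set)) = (\<Sum>n. f (enat n)) + f \<infinity>"
proof -
  have U: "(UNIV :: enat set) = range enat \<union> {\<infinity>}"
    using enat.exhaust by auto
  have "(\<integral>\<^sup>+n. f n \<partial>count_space (UNIV :: enat set)) =
     (\<integral>\<^sup>+n. f n * indicator (range enat) n + f n * indicator {\<infinity>} n \<partial>count_space UNIV)"
    by (intro nn_integral_cong) (auto simp: indicator_def not_infinity_eq)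
  also have "\<dots> = (\<integral>\<^sup>+n. f n * indicator (range enat) n \<partial>count_space UNIV) + (\<integral>\<^sup>+n. f n * indicator {\<infinity>} n \<partial>count_space UNIV)"
    by (rule nn_integral_add) auto
  also have "(\<integral>\<^sup>+n. f n * indicator {\<infinity>} n \<partial>count_space UNIV) = f \<infinity>"
    by (subst nn_integral_count_space'[where A = "{\<infinity>}"]) auto
  also have "(\<integral>\<^sup>+n. f n * indicator (range enat) n \<partial>count_space UNIV) = (\<integral>\<^sup>+n. f n \<partial>count_space (range enat))"
    by (rule nn_integral_count_space_indicator[symmetric]) simp
  also have "\<dots> = (\<integral>\<^sup>+n. f (enat n) \<partial>count_space UNIV)"
    by (rule nn_integral_bij_count_space[symmetric]) (auto simp: bij_betw_def inj_on_def)
  finally show ?thesis by (simp add: nn_integral_count_space_nat)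
qed

text \<open>The masses of the finite values are the coefficients of a power series. The mass of \<open>\<infinity>\<close> is
  invisible for \<open>s < 1\<close> and is recovered from the total mass, which is finite.\<close>

lemma nn_integral_enat_determined:
  fixes M N :: "('v \<Rightarrow> enat) measure"
  assumes "prob_space M" "prob_space N"
    and [measurable]: "(\<lambda>\<eta>. \<eta> x) \<in> M \<rightarrow>\<^sub>M count_space UNIV" "(\<lambda>\<eta>. \<eta> x) \<in> N \<rightarrow>\<^sub>M count_space UNIV"
      "R \<in> borel_measurable M" "R \<in> borel_measurable N"
    and R: "\<And>\<eta>. R \<eta> \<le> 1"
    and eq: "\<And>s. 0 \<le> s \<Longrightarrow> s < 1 \<Longrightarrow>
       (\<integral>\<^sup>+\<eta>. ennreal (epow s (\<eta> x)) * R \<eta> \<partial>M) = (\<integral>\<^sup>+\<eta>. ennreal (epow s (\<eta> x)) * R \<eta> \<partial>N)"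
    and total: "(\<integral>\<^sup>+\<eta>. R \<eta> \<partial>M) = (\<integral>\<^sup>+\<eta>. R \<eta> \<partial>N)"
  shows "(\<integral>\<^sup>+\<eta>. f (\<eta> x) * R \<eta> \<partial>M) = (\<integral>\<^sup>+\<eta>. f (\<eta> x) * R \<eta> \<partial>N)"
proof -
  define a where "a M n = (\<integral>\<^sup>+\<eta>. indicator ((\<lambda>\<eta>. \<eta> x) -` {n} \<inter> space M) \<eta> * R \<eta> \<partial>M)" for M n
  have le1: "a M' n \<le> 1" if "prob_space M'" for M' n
  proof -
    have "a M' n \<le> (\<integral>\<^sup>+\<eta>. 1 \<partial>M')"
      unfolding a_def using R by (intro nn_integral_mono) (auto simp: indicator_def)
    then show ?thesis using prob_space.emeasure_space_1[OF that] by simp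
  qed
  have expand: "(\<integral>\<^sup>+\<eta>. g (\<eta> x) * R \<eta> \<partial>M) = (\<integral>\<^sup>+n. g n * a M n \<partial>count_space UNIV)"
    "(\<integral>\<^sup>+\<eta>. g (\<eta> x) * R \<eta> \<partial>N) = (\<integral>\<^sup>+n. g n * a N n \<partial>count_space UNIV)" for g
    unfolding a_def by (rule nn_integral_enat; measurable)+
  have aM: "a M n = ennreal (enn2real (a M n))" "enn2real (a M n) \<le> 1"
    and aN: "a N n = ennreal (enn2real (a N n))" "enn2real (a N n) \<le> 1" for n
    using le1[OF assms(1), of n] le1[OF assms(2), of n] enn2real_mono[of "a M n" 1] enn2real_mono[of "a N n" 1]
    by (auto simp: ennreal_enn2real_if top_unique)
  have ps: "(\<Sum>n. ennreal (s ^ n) * ennreal (c n)) = ennreal (\<Sum>n. s ^ n * c n)"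
    if "0 \<le> s" "s < 1" "\<And>n. 0 \<le> c n" "\<And>n. c n \<le> 1" for s :: real and c :: "nat \<Rightarrow> real"
  proof -
    have "summable (\<lambda>n. s ^ n * c n)"
    proof (rule summable_comparison_test')
      show "summable (\<lambda>k. s ^ k)" using that by (intro summable_geometric) simp
      show "norm (s ^ k * c k) \<le> s ^ k" for k
        using that by (simp add: abs_mult mult_left_le)
    qed
    then have "(\<Sum>n. ennreal (s ^ n * c n)) = ennreal (\<Sum>n. s ^ n * c n)"
      using that by (intro suminf_ennreal2) auto
    then show ?thesis using that by (simp add: ennreal_mult)
  qed
  have "enn2real (a M (enat n)) = enn2real (a N (enat n))" for n
  proof (rule power_series_coefficients_unique[where a = "\<lambda>n. enn2real (a M (enat n))" and b = "\<lambda>n. enn2real (a N (enat n))"])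
    fix s :: real assume s: "0 \<le> s" "s < 1"
    have "(\<Sum>n. ennreal (s ^ n) * a M (enat n)) = (\<Sum>n. ennreal (s ^ n) * a N (enat n))"
      using eq[OF s] unfolding expand[of "\<lambda>n. ennreal (epow s n)"] nn_integral_count_space_enat by simp
    then have "ennreal (\<Sum>n. s ^ n * enn2real (a M (enat n))) = ennreal (\<Sum>n. s ^ n * enn2real (a N (enat n)))"
      using aM(2) aN(2) s by (subst (asm) aM(1), subst (asm) aN(1)) (simp add: ps)
    moreover have "0 \<le> (\<Sum>n. s ^ n * c n)" if "\<And>n. 0 \<le> c n" "\<And>n. c n \<le> 1" for c :: "nat \<Rightarrow> real"
    proof (rule suminf_nonneg)
      show "summable (\<lambda>n. s ^ n * c n)"
      proof (rule summable_comparison_test')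
        show "summable (\<lambda>k. s ^ k)" using s by (intro summable_geometric) simp
        show "norm (s ^ k * c k) \<le> s ^ k" for k
          using that s by (simp add: abs_mult mult_left_le)
      qed
    qed (use that s in auto)
    ultimately show "(\<Sum>n. s ^ n * enn2real (a M (enat n))) = (\<Sum>n. s ^ n * enn2real (a N (enat n)))"
      using aM(2) aN(2) by (subst (asm) ennreal_inj) auto
  qed (use aM(2) aN(2) in auto)
  then have fin: "a M (enat n) = a N (enat n)" for n
    by (subst aM(1), subst aN(1)) simp
  have "(\<Sum>n. a M (enat n)) + a M \<infinity> = (\<Sum>n. a M (enat n)) + a N \<infinity>"
    using total expand[of "\<lambda>_. 1"] by (simp add: nn_integral_count_space_enat fin)
  moreover have "(\<Sum>n. a M (enat n)) \<noteq> \<infinity>"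
  proof -
    have "(\<integral>\<^sup>+\<eta>. R \<eta> \<partial>M) \<le> (\<integral>\<^sup>+\<eta>. 1 \<partial>M)" by (intro nn_integral_mono R)
    also have "\<dots> = 1" using prob_space.emeasure_space_1[OF assms(1)] by simp
    finally have "(\<Sum>n. a M (enat n)) + a M \<infinity> \<le> 1"
      using expand[of "\<lambda>_. 1"] by (simp add: nn_integral_count_space_enat)
    then show ?thesis by (auto simp: top_unique)
  qed
  ultimately have "a M \<infinity> = a N \<infinity>"
    by (simp add: ennreal_add_left_cancel)
  with fin have "a M n = a N n" for n by (cases n) auto
  then show ?thesis unfolding expand by simp
qed

text \<open>Cylinder probabilities are obtained from generating functions by replacing the power by an indicator in one
  coordinate after the other.\<close>

lemma config_measure_eqI:
  fixes M N :: "('v \<Rightarrow> enat) measure"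
  assumes M: "prob_space M" and N: "prob_space N"
    and sets: "sets M = sets config_space" "sets N = sets config_space"
    and eq: "\<And>J s. finite J \<Longrightarrow> (\<And>x. 0 \<le> s x \<and> s x < 1) \<Longrightarrow>
       (\<integral>\<^sup>+\<eta>. ennreal (\<Prod>x\<in>J. epow (s x) (\<eta> x)) \<partial>M) = (\<integral>\<^sup>+\<eta>. ennreal (\<Prod>x\<in>J. epow (s x) (\<eta> x)) \<partial>N)"
  shows "M = N"
proof -
  have comp [measurable]: "(\<lambda>\<eta>. \<eta> x) \<in> M \<rightarrow>\<^sub>M count_space UNIV" "(\<lambda>\<eta>. \<eta> x) \<in> N \<rightarrow>\<^sub>M count_space UNIV" for x
    unfolding measurable_cong_sets[OF sets(1) refl] measurable_cong_sets[OF sets(2) refl]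
    by (rule measurable_component_singleton; simp)+
  have main: "(\<integral>\<^sup>+\<eta>. ennreal (\<Prod>x\<in>J. epow (s x) (\<eta> x)) * (\<Prod>x\<in>K. indicator (A x) (\<eta> x)) \<partial>M) =
      (\<integral>\<^sup>+\<eta>. ennreal (\<Prod>x\<in>J. epow (s x) (\<eta> x)) * (\<Prod>x\<in>K. indicator (A x) (\<eta> x)) \<partial>N)"
    if "finite K" "finite J" "J \<inter> K = {}" "\<And>x. 0 \<le> s x \<and> s x < 1" for K J s and A :: "'v \<Rightarrow> enat set"
    using that
  proof (induction K arbitrary: J s rule: finite_induct)
    case empty
    then show ?case using eq[OF empty(1,3)] by simp
  next
    case (insert y K)
    let ?R = "\<lambda>\<eta>. ennreal (\<Prod>x\<in>J. epow (s x) (\<eta> x)) * (\<Prod>x\<in>K. indicator (A x) (\<eta> x))"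
    have "?R \<in> borel_measurable L" if c: "\<And>x. (\<lambda>\<eta>. \<eta> x) \<in> L \<rightarrow>\<^sub>M count_space UNIV" for L
      by (intro borel_measurable_times_ennreal measurable_compose[OF _ measurable_ennreal]
          borel_measurable_prod borel_measurable_prod_ennreal measurable_compose[OF c]) auto
    then have Rm: "?R \<in> borel_measurable M" "?R \<in> borel_measurable N"
      using comp by blast+
    have "(\<integral>\<^sup>+\<eta>. indicator (A y) (\<eta> y) * ?R \<eta> \<partial>M) = (\<integral>\<^sup>+\<eta>. indicator (A y) (\<eta> y) * ?R \<eta> \<partial>N)"
    proof (rule nn_integral_enat_determined[OF M N])
      show "?R \<eta> \<le> 1" for \<eta>
      proof -
        have "(\<Prod>x\<in>J. epow (s x) (\<eta> x)) \<le> 1"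
          using insert.prems(3) by (intro prod_le_1) (auto simp: epow_bounds less_imp_le)
        moreover have "(\<Prod>x\<in>K. indicator (A x) (\<eta> x) :: ennreal) \<le> 1"
          by (intro prod_le_1) (auto simp: indicator_def)
        ultimately show ?thesis by (intro mult_le_one) (auto simp: ennreal_le_1)
      qed
      fix t :: real assume t: "0 \<le> t" "t < 1"
      have y: "y \<notin> J" using insert by auto
      have "ennreal (epow t (\<eta> y)) * ?R \<eta> =
        ennreal (\<Prod>x\<in>insert y J. epow ((s(y := t)) x) (\<eta> x)) * (\<Prod>x\<in>K. indicator (A x) (\<eta> x))" for \<eta>
      proof -
        have "(\<Prod>x\<in>J. epow ((s(y := t)) x) (\<eta> x)) = (\<Prod>x\<in>J. epow (s x) (\<eta> x))"
          using y by (intro prod.cong) auto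
        then show ?thesis
          using y insert.prems(1) t by (simp add: ennreal_mult epow_bounds insert.prems prod_nonneg mult.assoc)
      qed
      then show "(\<integral>\<^sup>+\<eta>. ennreal (epow t (\<eta> y)) * ?R \<eta> \<partial>M) = (\<integral>\<^sup>+\<eta>. ennreal (epow t (\<eta> y)) * ?R \<eta> \<partial>N)"
        using insert.IH[of "insert y J" "s(y := t)"] insert.prems insert.hyps t by simp
    next
      show "(\<integral>\<^sup>+\<eta>. ?R \<eta> \<partial>M) = (\<integral>\<^sup>+\<eta>. ?R \<eta> \<partial>N)"
        using insert by auto
    qed (rule comp Rm)+
    then show ?case using insert.hyps by (simp add: mult_ac)
  qed
  show ?thesis
  proof (rule measure_eqI_PiM_infinite[of _ UNIV "\<lambda>_. count_space UNIV"])
    show "finite_measure M" using M by (simp add: prob_space_def)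
    fix A :: "'v \<Rightarrow> enat set" and J :: "'v set" assume J: "finite J"
    let ?X = "prod_emb UNIV (\<lambda>_. count_space UNIV) J (Pi\<^sub>E J A)"
    have X: "?X \<in> sets config_space"
      using J by (intro sets_PiM_I) auto
    have i: "indicator ?X \<eta> = (\<Prod>x\<in>J. indicator (A x) (\<eta> x) :: ennreal)" for \<eta>
    proof (cases "\<eta> \<in> ?X")
      case True
      then have "(\<Prod>x\<in>J. indicator (A x) (\<eta> x) :: ennreal) = 1"
        by (intro prod.neutral) (auto simp: prod_emb_def PiE_iff indicator_def)
      then show ?thesis using True by simp
    next
      case False
      then obtain x where "x \<in> J" "\<eta> x \<notin> A x" by (auto simp: prod_emb_def PiE_iff space_PiM)
      then have "(\<Prod>x\<in>J. indicator (A x) (\<eta> x) :: ennreal) = 0"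
        using J by (intro prod_zero bexI[of _ x]) auto
      then show ?thesis using False by simp
    qed
    have "emeasure M ?X = (\<integral>\<^sup>+\<eta>. (\<Prod>x\<in>J. indicator (A x) (\<eta> x)) \<partial>M)"
      using X sets by (simp add: i[symmetric])
    also have "\<dots> = (\<integral>\<^sup>+\<eta>. (\<Prod>x\<in>J. indicator (A x) (\<eta> x)) \<partial>N)"
      using main[OF J, of "{}" "\<lambda>_. 0"] by simp
    also have "\<dots> = emeasure N ?X"
      using X sets by (simp add: i[symmetric])
    finally show "emeasure M ?X = emeasure N ?X" .
  qed (use sets in auto)
qed

lemma poisson_pgf_sums: "(\<lambda>n. exp (- q) * q ^ n / fact n * s ^ n) sums exp (- (1 - s) * (q::real))"
proof -
  have "(\<lambda>n. exp (- q) * ((s * q) ^ n /\<^sub>R fact n)) sums (exp (- q) * exp (s * q))"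
    by (intro sums_mult exp_converges)
  also have "exp (- q) * exp (s * q) = exp (- (1 - s) * q)"
    by (simp add: exp_add[symmetric] algebra_simps)
  finally show ?thesis
    by (simp add: power_mult_distrib field_simps)
qed

text \<open>The value \<open>s = 1\<close> is admitted for finite \<open>r\<close>, since a particle may avoid the observed sites with
  probability 1, for instance at time 0.\<close>

lemma poisson_enat_pgf:
  assumes s: "0 \<le> s" "s \<le> 1" and finite_or_less: "r < \<infinity> \<or> s < 1"
  shows "(\<integral>\<^sup>+n. ennreal (epow s n) \<partial>measure_pmf (poisson_enat r)) = ennreal (nexp (ennreal (1 - s) * r))"
proof -
  consider "r = \<infinity>" | "r = 0" | q where "r = ennreal q" "0 < q"
    by (cases r) (auto simp: less_le)
  then show ?thesis
  proof cases
    case 1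
    then show ?thesis using finite_or_less by (simp add: poisson_enat_def nexp_def ennreal_mult_top)
  next
    case 2
    then show ?thesis by (simp add: poisson_enat_def zero_enat_def)
  next
    case 3
    have "(\<integral>\<^sup>+n. ennreal (epow s n) \<partial>measure_pmf (poisson_enat r)) = (\<integral>\<^sup>+n. ennreal (s ^ n) \<partial>measure_pmf (poisson_pmf q))"
      using 3 by (simp add: poisson_enat_def)
    also have "\<dots> = (\<Sum>n. ennreal (q ^ n / fact n * exp (- q) * s ^ n))"
      using 3 s by (simp add: nn_integral_measure_pmf nn_integral_count_space_nat ennreal_mult[symmetric])
    also have "\<dots> = ennreal (exp (- (1 - s) * q))"
    proof (rule suminf_ennreal_eq)
      show "(\<lambda>n. q ^ n / fact n * exp (- q) * s ^ n) sums exp (- (1 - s) * q)"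
        using poisson_pgf_sums[of q s] by (simp add: mult_ac)
    qed (use 3 s in auto)
    also have "exp (- (1 - s) * q) = nexp (ennreal (1 - s) * r)"
      using 3 s by (simp add: ennreal_mult[symmetric] nexp_ennreal algebra_simps)
    finally show ?thesis .
  qed
qed

lemma sets_poisson_product: "sets (poisson_product r) = sets config_space"
  unfolding poisson_product_def by (intro sets_PiM_cong) auto

lemma prob_space_poisson_product: "prob_space (poisson_product r)"
  unfolding poisson_product_def by (intro prob_space_PiM measure_pmf.prob_space_axioms)

lemma nn_integral_PiM_prod:
  fixes M :: "'i \<Rightarrow> 'b measure"
  assumes M: "\<And>i. prob_space (M i)" and J: "finite J"
    and f: "\<And>i. i \<in> J \<Longrightarrow> f i \<in> borel_measurable (M i)"
  shows "(\<integral>\<^sup>+\<omega>. (\<Prod>i\<in>J. f i (\<omega> i)) \<partial>PiM UNIV M) = (\<Prod>i\<in>J. \<integral>\<^sup>+n. f i n \<partial>M i)"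
proof -
  interpret product_prob_space M UNIV
    by (rule product_prob_spaceI) (rule M)
  have m1: "(\<lambda>\<omega>. \<Prod>i\<in>J. f i (\<omega> i)) \<in> borel_measurable (PiM J M)"
  proof (rule borel_measurable_prod_ennreal)
    show "(\<lambda>\<omega>. f i (\<omega> i)) \<in> borel_measurable (PiM J M)" if "i \<in> J" for i
      by (rule measurable_compose[OF measurable_component_singleton[OF that, of M] f[OF that]])
  qed
  have m2: "(\<lambda>\<omega>. restrict \<omega> J) \<in> PiM UNIV M \<rightarrow>\<^sub>M PiM J M"
    by (rule measurable_restrict_subset) simp
  have "(\<integral>\<^sup>+\<omega>. (\<Prod>i\<in>J. f i (\<omega> i)) \<partial>PiM UNIV M) = (\<integral>\<^sup>+\<omega>. (\<Prod>i\<in>J. f i (restrict \<omega> J i)) \<partial>PiM UNIV M)"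
    by (intro nn_integral_cong prod.cong) auto
  also have "\<dots> = (\<integral>\<^sup>+\<omega>. (\<Prod>i\<in>J. f i (\<omega> i)) \<partial>distr (PiM UNIV M) (PiM J M) (\<lambda>\<omega>. restrict \<omega> J))"
    by (subst nn_integral_distr[OF m2]) (use m1 in simp_all)
  also have "\<dots> = (\<Prod>i\<in>J. \<integral>\<^sup>+n. f i n \<partial>M i)"
    by (subst distr_PiM_restrict_finite[OF J]) (auto intro!: product_nn_integral_prod J f)
  finally show ?thesis .
qed

lemma poisson_product_pgf:
  assumes J: "finite J" and s: "\<And>x. 0 \<le> s x \<and> s x \<le> 1 \<and> (r x < \<infinity> \<or> s x < 1)"
  shows "(\<integral>\<^sup>+\<eta>. ennreal (\<Prod>x\<in>J. epow (s x) (\<eta> x)) \<partial>poisson_product r) =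
     ennreal (nexp (\<Sum>x\<in>J. ennreal (1 - s x) * r x))"
proof -
  have "(\<integral>\<^sup>+\<eta>. ennreal (\<Prod>x\<in>J. epow (s x) (\<eta> x)) \<partial>poisson_product r) =
     (\<integral>\<^sup>+\<eta>. (\<Prod>x\<in>J. ennreal (epow (s x) (\<eta> x))) \<partial>poisson_product r)"
    using s by (subst prod_ennreal) (auto simp: epow_bounds)
  also have "\<dots> = (\<Prod>x\<in>J. ennreal (nexp (ennreal (1 - s x) * r x)))"
  proof -
    have "(\<integral>\<^sup>+n. ennreal (epow (s x) n) \<partial>measure_pmf (poisson_enat (r x))) = ennreal (nexp (ennreal (1 - s x) * r x))" for x
      using s[of x] by (intro poisson_enat_pgf) auto
    then show ?thesis
      unfolding poisson_product_def
      by (subst nn_integral_PiM_prod[OF measure_pmf.prob_space_axioms J]) simp_all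
  qed
  also have "\<dots> = ennreal (nexp (\<Sum>x\<in>J. ennreal (1 - s x) * r x))"
    by (simp add: nexp_sum[OF J] prod_ennreal nexp_bounds)
  finally show ?thesis .
qed

lemma AE_poisson_product_finite:
  fixes \<rho> :: "'v::countable \<Rightarrow> real"
  shows "AE \<eta> in poisson_product (\<lambda>x. ennreal (\<rho> x)). \<forall>x. \<eta> x \<noteq> \<infinity>"
proof -
  have "AE \<eta> in poisson_product (\<lambda>x. ennreal (\<rho> x)). \<eta> x \<noteq> \<infinity>" for x
  proof -
    have "AE n in measure_pmf (poisson_enat (ennreal (\<rho> x))). n \<noteq> \<infinity>"
      by (auto simp: poisson_enat_def AE_measure_pmf_iff zero_enat_def)
    then show ?thesis unfolding poisson_product_def
      by (intro AE_PiM_component measure_pmf.prob_space_axioms) auto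
  qed
  then show ?thesis by (simp add: AE_all_countable)
qed

section \<open>Weighted Poisson arrivals\<close>

lemma nn_integral_exp_clock:
  assumes [measurable]: "f \<in> borel_measurable borel"
  shows "(\<integral>\<^sup>+e. f e \<partial>exp_clock) = (\<integral>\<^sup>+e. ennreal (exp (- e)) * f e * indicator {0..} e \<partial>lborel)"
  unfolding exp_clock_def
  by (subst nn_integral_density) (auto intro!: nn_integral_cong simp: exponential_density_def indicator_def)

text \<open>The arrivals of a rate-one Poisson process on \<open>[0, t]\<close> are weighted by \<open>h\<close> at their ages
  \<open>t - ring_time E j\<close>. The mean of the product of the weights will turn out to be \<open>exp (- H t)\<close>.\<close>

locale thinning =
  fixes h H :: "real \<Rightarrow> real"
  assumes h_measurable [measurable]: "h \<in> borel_measurable borel"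
    and h_bounds: "\<And>u. 0 \<le> u \<Longrightarrow> 0 \<le> h u" "\<And>u. 0 \<le> u \<Longrightarrow> h u \<le> 1"
    and H_deriv: "\<And>u. (H has_real_derivative (1 - h u)) (at u)"
    and H_0: "H 0 = 0"
begin

lemma H_measurable [measurable]: "H \<in> borel_measurable borel"
proof -
  have "continuous_on UNIV H"
    using H_deriv by (meson DERIV_isCont continuous_at_imp_continuous_on)
  then show ?thesis by (rule borel_measurable_continuous_onI)
qed

lemma H_nonneg: "0 \<le> t \<Longrightarrow> 0 \<le> H t"
  using DERIV_nonneg_imp_nondecreasing[of 0 t H] H_deriv h_bounds(2) H_0 by (metis diff_ge_0_iff_ge)

lemma H_integral: "0 \<le> t \<Longrightarrow> (\<integral>\<^sup>+u. ennreal (1 - h u) * indicator {0..t} u \<partial>lborel) = ennreal (H t)"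
  by (subst nn_integral_FTC_Icc[where F = H]) (auto simp: H_0 intro!: H_deriv simp: h_bounds)

text \<open>Conditioning on the first arrival \<open>e\<close> leads to this equation for \<open>exp (- H)\<close>. Its integrand on
  \<open>[0, t]\<close> is the derivative of \<open>- exp (- e) * exp (- H (t - e))\<close>.\<close>

lemma renewal_identity:
  assumes t: "0 \<le> t"
  shows "(\<integral>\<^sup>+e. (if e \<le> t then ennreal (h (t - e) * exp (- H (t - e))) else 1) \<partial>exp_clock) = ennreal (exp (- H t))"
proof -
  have [measurable]: "(\<lambda>e. h (t - e)) \<in> borel_measurable borel" "(\<lambda>e. H (t - e)) \<in> borel_measurable borel"
    by (rule measurable_compose[OF _ h_measurable] measurable_compose[OF _ H_measurable]; simp)+
  let ?f1 = "\<lambda>e. exp (- e) * (h (t - e) * exp (- H (t - e)))" and ?f2 = "\<lambda>e::real. exp (- e)"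
  have "(\<integral>\<^sup>+e. (if e \<le> t then ennreal (h (t - e) * exp (- H (t - e))) else 1) \<partial>exp_clock) =
     (\<integral>\<^sup>+e. ennreal (exp (- e)) * (if e \<le> t then ennreal (h (t - e) * exp (- H (t - e))) else 1) * indicator {0..} e \<partial>lborel)"
    by (rule nn_integral_exp_clock) measurable
  also have "\<dots> = (\<integral>\<^sup>+e. ennreal (?f1 e) * indicator {0..t} e + ennreal (?f2 e) * indicator {t..} e \<partial>lborel)"
  proof (rule nn_integral_cong_AE)
    have "AE x in lborel. x \<noteq> t" by (rule AE_lborel_singleton)
    then show "AE e in lborel. ennreal (exp (- e)) * (if e \<le> t then ennreal (h (t - e) * exp (- H (t - e))) else 1) * indicator {0..} e
       = ennreal (?f1 e) * indicator {0..t} e + ennreal (?f2 e) * indicator {t..} e"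
      by eventually_elim (use t in \<open>auto simp: indicator_def ennreal_mult' h_bounds\<close>)
  qed
  also have "\<dots> = (\<integral>\<^sup>+e. ennreal (?f1 e) * indicator {0..t} e \<partial>lborel) + (\<integral>\<^sup>+e. ennreal (?f2 e) * indicator {t..} e \<partial>lborel)"
    by (rule nn_integral_add; measurable)
  also have "(\<integral>\<^sup>+e. ennreal (?f2 e) * indicator {t..} e \<partial>lborel) = ennreal (0 - (- exp (- t)))"
  proof (rule nn_integral_FTC_atLeast)
    show "((\<lambda>e. - exp (- e)) has_real_derivative exp (- e)) (at e)" for e :: real
      by (auto intro!: derivative_eq_intros)
    show "((\<lambda>e::real. - exp (- e)) \<longlongrightarrow> 0) at_top"
      using tendsto_minus[OF filterlim_compose[OF exp_at_bot filterlim_uminus_at_bot_at_top]] by simp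
  qed auto
  also have "(\<integral>\<^sup>+e. ennreal (?f1 e) * indicator {0..t} e \<partial>lborel) =
     ennreal ((- exp (- t) * exp (- H (t - t))) - (- exp (- 0) * exp (- H (t - 0))))"
  proof (rule nn_integral_FTC_Icc)
    fix e assume "e \<in> {0..t}"
    have "((\<lambda>e. - exp (- e) * exp (- H (t - e))) has_real_derivative
        exp (- e) * exp (- H (t - e)) + - exp (- e) * (exp (- H (t - e)) * - ((1 - h (t - e)) * - 1))) (at e)"
      by (rule derivative_eq_intros DERIV_chain2[OF H_deriv] refl | simp)+
    also have "exp (- e) * exp (- H (t - e)) + - exp (- e) * (exp (- H (t - e)) * - ((1 - h (t - e)) * - 1)) = ?f1 e"
      by (simp add: algebra_simps)
    finally show "((\<lambda>e. - exp (- e) * exp (- H (t - e))) has_real_derivative ?f1 e) (at e)" .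
  qed (use t h_bounds in auto)
  also have "\<dots> + ennreal (0 - (- exp (- t))) = ennreal (exp (- H t))"
  proof -
    have "exp (- t) \<le> exp (- H t)"
    proof -
      have "H t \<le> t"
      proof -
        have "t - H t \<ge> 0 - H 0"
        proof (rule DERIV_nonneg_imp_nondecreasing[OF t])
          fix x assume "0 \<le> x" "x \<le> t"
          then show "\<exists>y. ((\<lambda>t. t - H t) has_real_derivative y) (at x) \<and> 0 \<le> y"
            by (intro exI[of _ "h x"]) (auto intro!: derivative_eq_intros H_deriv simp: h_bounds)
        qed
        then show ?thesis by (simp add: H_0)
      qed
      then show ?thesis by simp
    qed
    then show ?thesis by (simp add: H_0 flip: ennreal_plus)
  qed
  finally show ?thesis .
qed

text \<open>One renewal step integrates an error bound once more, which produces the terms of the exponential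
  series.\<close>

lemma renewal_error:
  assumes t: "0 \<le> t"
  shows "(\<integral>\<^sup>+e. (if e \<le> t then ennreal ((t - e) ^ m / fact m) else 0) \<partial>exp_clock) \<le> ennreal (t ^ Suc m / fact (Suc m))"
proof -
  have "(\<integral>\<^sup>+e. (if e \<le> t then ennreal ((t - e) ^ m / fact m) else 0) \<partial>exp_clock) =
     (\<integral>\<^sup>+e. ennreal (exp (- e)) * (if e \<le> t then ennreal ((t - e) ^ m / fact m) else 0) * indicator {0..} e \<partial>lborel)"
    by (rule nn_integral_exp_clock) measurable
  also have "\<dots> \<le> (\<integral>\<^sup>+e. ennreal ((t - e) ^ m / fact m) * indicator {0..t} e \<partial>lborel)"
  proof (rule nn_integral_mono)
    fix e :: real
    have "ennreal (exp (- e)) * c \<le> c" if "0 \<le> e" for c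
      using mult_right_mono[of "ennreal (exp (- e))" 1 c] that by (simp add: ennreal_le_1)
    then show "ennreal (exp (- e)) * (if e \<le> t then ennreal ((t - e) ^ m / fact m) else 0) * indicator {0..} e
       \<le> ennreal ((t - e) ^ m / fact m) * indicator {0..t} e"
      by (auto simp: indicator_def)
  qed
  also have "\<dots> = ennreal (- ((t - t) ^ Suc m / fact (Suc m)) - (- ((t - 0) ^ Suc m / fact (Suc m))))"
  proof (rule nn_integral_FTC_Icc)
    fix e assume "e \<in> {0..t}"
    have "((\<lambda>e. - ((t - e) ^ Suc m / fact (Suc m))) has_real_derivative
        - (real (Suc m) * (t - e) ^ m * - 1 / fact (Suc m))) (at e)"
      by (rule derivative_eq_intros refl | simp)+
    also have "- (real (Suc m) * (t - e) ^ m * - 1 / fact (Suc m)) = (t - e) ^ m / fact m"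
      unfolding fact_Suc of_nat_mult by (simp del: of_nat_Suc)
    finally show "((\<lambda>e. - ((t - e) ^ Suc m / fact (Suc m))) has_real_derivative (t - e) ^ m / fact m) (at e)" .
  qed (use t in auto)
  finally show ?thesis by simp
qed

definition thinned :: "nat \<Rightarrow> real \<Rightarrow> ennreal" where
  "thinned m t = (\<integral>\<^sup>+E. (\<Prod>j<m. ennreal (if ring_time E j \<le> t then h (t - ring_time E j) else 1)) \<partial>clocks)"

lemma ring_time_case_nat: "ring_time (case_nat e E) 0 = e" "ring_time (case_nat e E) (Suc j) = e + ring_time E j"
  by (simp, subst sum.atMost_Suc_shift, simp)

text \<open>After the first arrival at time \<open>e\<close>, the remaining arrivals form the same process with horizon
  \<open>t - e\<close>.\<close>

lemma thinned_Suc: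
  "thinned (Suc m) t = (\<integral>\<^sup>+e. (if e \<le> t then ennreal (h (t - e)) * thinned m (t - e) else 1) \<partial>exp_clock)"
proof -
  let ?r = "\<lambda>t E j. ennreal (if ring_time E j \<le> t then h (t - ring_time E j) else 1)"
  have r [measurable]: "(\<lambda>E. ?r t E j) \<in> borel_measurable clocks" for j t
    by measurable
  have "thinned (Suc m) t = (\<integral>\<^sup>+E. (\<Prod>j<Suc m. ?r t E j) \<partial>distr (exp_clock \<Otimes>\<^sub>M clocks) clocks (\<lambda>(s, \<omega>). case_nat s \<omega>))"
    unfolding thinned_def by (subst clocks.PiM_iter) simp
  also have "\<dots> = (\<integral>\<^sup>+z. (\<Prod>j<Suc m. ?r t (case_nat (fst z) (snd z)) j) \<partial>(exp_clock \<Otimes>\<^sub>M clocks))"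
    unfolding case_prod_unfold by (rule nn_integral_distr) measurable
  also have "\<dots> = (\<integral>\<^sup>+e. \<integral>\<^sup>+E. (\<Prod>j<Suc m. ?r t (case_nat e E) j) \<partial>clocks \<partial>exp_clock)"
  proof -
    have "(\<lambda>z. \<Prod>j<Suc m. ?r t (case_nat (fst z) (snd z)) j) \<in> borel_measurable (exp_clock \<Otimes>\<^sub>M clocks)"
      by measurable
    from clocks.P.nn_integral_fst[OF this] show ?thesis by (simp only: fst_conv snd_conv)
  qed
  also have "\<dots> = (\<integral>\<^sup>+e. (if e \<le> t then ennreal (h (t - e)) * thinned m (t - e) else 1) \<partial>exp_clock)"
  proof (rule nn_integral_cong)
    fix e :: real
    show "(\<integral>\<^sup>+E. (\<Prod>j<Suc m. ?r t (case_nat e E) j) \<partial>clocks) = (if e \<le> t then ennreal (h (t - e)) * thinned m (t - e) else 1)"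
    proof (cases "e \<le> t")
      case True
      have "(\<Prod>j<Suc m. ?r t (case_nat e E) j) = ennreal (h (t - e)) * (\<Prod>j<m. ?r (t - e) E j)" for E
      proof -
        have "?r t (case_nat e E) (Suc j) = ?r (t - e) E j" for j
          unfolding ring_time_case_nat by (simp add: algebra_simps)
        then show ?thesis unfolding prod.lessThan_Suc_shift using True by (simp add: ring_time_case_nat(1))
      qed
      then show ?thesis using True by (simp add: thinned_def nn_integral_cmult)
    next
      case False
      have "(\<integral>\<^sup>+E. (\<Prod>j<Suc m. ?r t (case_nat e E) j) \<partial>clocks) = (\<integral>\<^sup>+E. 1 \<partial>clocks)"
      proof (rule nn_integral_cong_AE)
        show "AE E in clocks. (\<Prod>j<Suc m. ?r t (case_nat e E) j) = 1"
          using AE_regular_clock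
        proof eventually_elim
          case (elim E)
          have "0 < ring_time E j" for j
            using elim by (intro sum_pos) (auto simp: regular_clock_def)
          then have "\<not> ring_time (case_nat e E) j \<le> t" for j
            using False by (cases j) (auto simp only: ring_time_case_nat not_le intro: less_add_same_cancel1[THEN iffD2] less_trans)
          then show ?case by simp
        qed
      qed
      then show ?thesis using False by (simp add: clocks.P.emeasure_space_1)
    qed
  qed
  finally show ?thesis .
qed

lemma thinned_measurable [measurable]: "thinned m \<in> borel_measurable borel"
proof -
  have "(\<lambda>t. \<integral>\<^sup>+E. (\<Prod>j<m. ennreal (if ring_time E j \<le> t then h (t - ring_time E j) else 1)) \<partial>clocks) \<in> borel_measurable borel"
    by (rule clocks.P.borel_measurable_nn_integral) measurable
  then show ?thesis unfolding thinned_def[abs_def] .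
qed

text \<open>Starting from the constant 1, the renewal equation is iterated towards its solution.\<close>

lemma thinned_bounds:
  assumes "0 \<le> t"
  shows "ennreal (exp (- H t)) \<le> thinned m t" "thinned m t \<le> ennreal (exp (- H t) + t ^ m / fact m)"
  using assms
proof (induction m arbitrary: t)
  case 0
  { case 1 then show ?case using H_nonneg by (simp add: thinned_def clocks.P.emeasure_space_1) }
  { case 2
    have "ennreal 1 \<le> ennreal (exp (- H t) + t ^ 0 / fact 0)" by (rule ennreal_leI) simp
    then show ?case by (simp add: thinned_def clocks.P.emeasure_space_1 del: ennreal_plus) }
next
  case (Suc m)
  { case 1
    have "ennreal (exp (- H t)) \<le> thinned (Suc m) t"
      unfolding renewal_identity[OF 1, symmetric] thinned_Suc
    proof (rule nn_integral_mono_AE)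
      show "AE e in exp_clock. (if e \<le> t then ennreal (h (t - e) * exp (- H (t - e))) else 1)
          \<le> (if e \<le> t then ennreal (h (t - e)) * thinned m (t - e) else 1)"
        using AE_exp_clock_pos
        by eventually_elim (auto simp: ennreal_mult h_bounds intro!: mult_left_mono Suc)
    qed
    then show ?case . }
  { case 2
    have "thinned (Suc m) t \<le> (\<integral>\<^sup>+e. (if e \<le> t then ennreal (h (t - e) * exp (- H (t - e))) else 1) +
         (if e \<le> t then ennreal ((t - e) ^ m / fact m) else 0) \<partial>exp_clock)"
      unfolding thinned_Suc
    proof (rule nn_integral_mono_AE)
      show "AE e in exp_clock. (if e \<le> t then ennreal (h (t - e)) * thinned m (t - e) else 1)
        \<le> (if e \<le> t then ennreal (h (t - e) * exp (- H (t - e))) else 1) + (if e \<le> t then ennreal ((t - e) ^ m / fact m) else 0)"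
        using AE_exp_clock_pos
      proof eventually_elim
        case (elim e)
        show ?case
        proof (cases "e \<le> t")
          case True
          then have u: "0 \<le> t - e" by simp
          have "ennreal (h (t - e)) * thinned m (t - e) \<le> ennreal (h (t - e)) * ennreal (exp (- H (t - e)) + (t - e) ^ m / fact m)"
            by (intro mult_left_mono Suc.IH(2) u) simp
          also have "\<dots> = ennreal (h (t - e) * (exp (- H (t - e)) + (t - e) ^ m / fact m))"
            using h_bounds(1)[OF u] by (simp add: ennreal_mult')
          also have "\<dots> \<le> ennreal (h (t - e) * exp (- H (t - e)) + (t - e) ^ m / fact m)"
            using h_bounds[OF u] u by (intro ennreal_leI) (use mult_right_mono[of "h (t - e)" 1 "(t - e) ^ m / fact m"] in \<open>auto simp: distrib_left\<close>)
          finally show ?thesis using True u h_bounds(1)[OF u] by simp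
        qed simp
      qed
    qed
    also have "\<dots> = (\<integral>\<^sup>+e. (if e \<le> t then ennreal (h (t - e) * exp (- H (t - e))) else 1) \<partial>exp_clock) +
         (\<integral>\<^sup>+e. (if e \<le> t then ennreal ((t - e) ^ m / fact m) else 0) \<partial>exp_clock)"
      by (rule nn_integral_add; measurable)
    also have "\<dots> \<le> ennreal (exp (- H t)) + ennreal (t ^ Suc m / fact (Suc m))"
      unfolding renewal_identity[OF 2] by (intro add_left_mono renewal_error 2)
    finally show ?case using 2 by (simp del: power_Suc fact_Suc) }
qed

lemma thinned_tendsto: "0 \<le> t \<Longrightarrow> (\<lambda>m. thinned m t) \<longlonglongrightarrow> ennreal (exp (- H t))"
proof (rule tendsto_sandwich)
  assume t: "0 \<le> t"
  show "eventually (\<lambda>m. ennreal (exp (- H t)) \<le> thinned m t) sequentially"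
    "eventually (\<lambda>m. thinned m t \<le> ennreal (exp (- H t) + t ^ m / fact m)) sequentially"
    using thinned_bounds[OF t] by simp_all
  have "(\<lambda>m. t ^ m /\<^sub>R fact m) \<longlonglongrightarrow> 0"
    by (rule summable_LIMSEQ_zero[OF summable_exp_generic])
  then have "(\<lambda>m. exp (- H t) + t ^ m / fact m) \<longlonglongrightarrow> exp (- H t) + 0"
    by (intro tendsto_intros) (simp add: field_simps)
  then show "(\<lambda>m. ennreal (exp (- H t) + t ^ m / fact m)) \<longlonglongrightarrow> ennreal (exp (- H t))"
    by (intro tendsto_ennrealI) simp
qed simp

end

text \<open>Speeding up time by the factor \<open>lam\<close> reduces arrivals at rate \<open>lam\<close> to arrivals at rate one.\<close>

lemma arrivals_thinned_tendsto:
  assumes h: "thinning h H" and lam: "0 \<le> lam" and t: "0 \<le> t"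
  shows "(\<lambda>m. \<integral>\<^sup>+E. (\<Prod>j<m. ennreal (if 0 < lam \<and> arrival lam E j \<le> t then h (t - arrival lam E j) else 1)) \<partial>clocks)
     \<longlonglongrightarrow> ennreal (exp (- lam * H t))"
proof (cases "lam = 0")
  case True
  then show ?thesis by (simp add: clocks.P.emeasure_space_1)
next
  case False
  then have pos: "0 < lam" using lam by simp
  interpret thinning h H by (rule h)
  interpret scaled: thinning "\<lambda>u. h (u / lam)" "\<lambda>u. lam * H (u / lam)"
  proof
    show "((\<lambda>u. lam * H (u / lam)) has_real_derivative 1 - h (u / lam)) (at u)" for u
      using pos by (auto intro!: derivative_eq_intros DERIV_chain2[OF H_deriv])
  qed (use pos in \<open>auto simp: h_bounds H_0\<close>)
  have "(if 0 < lam \<and> arrival lam E j \<le> t then h (t - arrival lam E j) else 1) =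
      (if ring_time E j \<le> lam * t then h ((lam * t - ring_time E j) / lam) else 1)" for E j
    using pos by (simp add: arrival_def field_simps)
  then show ?thesis
    using scaled.thinned_tendsto[of "lam * t"] pos t unfolding scaled.thinned_def by simp
qed

section \<open>Particle counts as infinite products\<close>

lemma measurable_ecount:
  fixes Q :: "'i::countable \<Rightarrow> 'a \<Rightarrow> bool"
  assumes Q: "\<And>i. Measurable.pred M (Q i)"
  shows "(\<lambda>\<omega>. ecount {i. Q i \<omega>}) \<in> M \<rightarrow>\<^sub>M count_space UNIV"
proof -
  note Q [measurable]
  have fin: "finite {i. Q i \<omega>} \<longleftrightarrow> (\<exists>m::nat. \<forall>i. Q i \<omega> \<longrightarrow> to_nat i < m)" for \<omega>
  proof
    assume "finite {i. Q i \<omega>}"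
    then have "finite (to_nat ` {i. Q i \<omega>})" by simp
    then show "\<exists>m::nat. \<forall>i. Q i \<omega> \<longrightarrow> to_nat i < m"
      unfolding finite_nat_iff_bounded by auto
  next
    assume "\<exists>m::nat. \<forall>i. Q i \<omega> \<longrightarrow> to_nat i < m"
    then have "finite (to_nat ` {i. Q i \<omega>})"
      unfolding finite_nat_iff_bounded by auto
    then show "finite {i. Q i \<omega>}" by (rule finite_imageD) simp
  qed
  have card: "card {i. Q i \<omega>} = card {n. \<exists>i. to_nat i = n \<and> Q i \<omega>}" for \<omega>
  proof -
    have "{n. \<exists>i. to_nat i = n \<and> Q i \<omega>} = to_nat ` {i. Q i \<omega>}" by auto
    then show ?thesis by (simp add: card_image)
  qed
  have p: "Measurable.pred M (\<lambda>\<omega>. finite {i. Q i \<omega>})"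
    unfolding fin by measurable
  have c: "(\<lambda>\<omega>. card {i. Q i \<omega>}) \<in> M \<rightarrow>\<^sub>M count_space UNIV"
    unfolding card by (rule measurable_card) measurable
  have c': "(\<lambda>\<omega>. enat (card {i. Q i \<omega>})) \<in> M \<rightarrow>\<^sub>M count_space UNIV"
    by (rule measurable_compose[OF c]) simp
  show ?thesis
    unfolding ecount_def by (rule measurable_If[OF c' _ p[unfolded pred_def]]) simp
qed

text \<open>Both sides are the product over all pairs of a particle and a site at which it sits.\<close>

lemma prod_power_card:
  fixes s :: "'v \<Rightarrow> real"
  assumes "finite I" "finite J"
  shows "(\<Prod>x\<in>J. s x ^ card {i\<in>I. act i \<and> pos i = x}) =
     (\<Prod>i\<in>I. if act i then (if pos i \<in> J then s (pos i) else 1) else 1)"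
proof -
  have "(\<Prod>x\<in>J. s x ^ card {i\<in>I. act i \<and> pos i = x}) = (\<Prod>x\<in>J. \<Prod>i\<in>I. if act i \<and> pos i = x then s x else 1)"
  proof (rule prod.cong)
    fix x
    have "(\<Prod>i\<in>I. if act i \<and> pos i = x then s x else 1) = (\<Prod>i\<in>{i\<in>I. act i \<and> pos i = x}. s x)"
      using assms(1) by (subst prod.inter_filter) auto
    then show "s x ^ card {i\<in>I. act i \<and> pos i = x} = (\<Prod>i\<in>I. if act i \<and> pos i = x then s x else 1)"
      by simp
  qed simp
  also have "\<dots> = (\<Prod>i\<in>I. \<Prod>x\<in>J. if act i \<and> pos i = x then s x else 1)"
    by (rule prod.swap)
  also have "\<dots> = (\<Prod>i\<in>I. if act i then (if pos i \<in> J then s (pos i) else 1) else 1)"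
  proof (rule prod.cong)
    fix i
    show "(\<Prod>x\<in>J. if act i \<and> pos i = x then s x else 1) = (if act i then (if pos i \<in> J then s (pos i) else 1) else 1)"
    proof (cases "act i")
      case True
      then show ?thesis using prod.delta'[OF assms(2), of "pos i" s] by simp
    qed simp
  qed simp
  finally show ?thesis .
qed

text \<open>This writes the generating function of the counts as an infinite product over particles, to which
  independence applies.\<close>

lemma tendsto_prod_epow_ecount:
  fixes s :: "'v \<Rightarrow> real"
  assumes J: "finite J" and s: "\<And>x. 0 \<le> s x \<and> s x < 1"
    and F: "incseq F" "\<And>m. finite (F m)" "\<And>i. act i \<Longrightarrow> \<exists>m. i \<in> F m"
  shows "(\<lambda>m. \<Prod>i\<in>F m. if act i then (if pos i \<in> J then s (pos i) else 1) else 1)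
      \<longlonglongrightarrow> (\<Prod>x\<in>J. epow (s x) (ecount {i. act i \<and> pos i = x}))"
proof -
  have "(\<lambda>m. \<Prod>x\<in>J. s x ^ card {i\<in>F m. act i \<and> pos i = x})
      \<longlonglongrightarrow> (\<Prod>x\<in>J. epow (s x) (ecount {i. act i \<and> pos i = x}))"
  proof (rule tendsto_prod)
    fix x
    have "(\<lambda>m. s x ^ card {i\<in>F m. act i \<and> pos i = x}) \<longlonglongrightarrow> epow (s x) (ecount (\<Union>m. {i\<in>F m. act i \<and> pos i = x}))"
      using s F by (intro tendsto_epow_ecount) (auto simp: incseq_def)
    moreover have "(\<Union>m. {i\<in>F m. act i \<and> pos i = x}) = {i. act i \<and> pos i = x}"
      using F(3) by auto
    ultimately show "(\<lambda>m. s x ^ card {i\<in>F m. act i \<and> pos i = x}) \<longlonglongrightarrow> epow (s x) (ecount {i. act i \<and> pos i = x})"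
      by simp
  qed
  then show ?thesis using prod_power_card[OF F(2) J, where s = s and act = act and pos = pos] by simp
qed

lemma initial_segments:
  fixes f :: "'i::countable \<Rightarrow> ennreal"
  shows "incseq (\<lambda>m. {i::'i. to_nat i < m})" "finite {i::'i. to_nat i < m}"
    and "(\<lambda>m. \<Sum>i\<in>{i. to_nat i < m}. f i) \<longlonglongrightarrow> (\<integral>\<^sup>+i. f i \<partial>count_space UNIV)"
proof -
  show inc: "incseq (\<lambda>m. {i::'i. to_nat i < m})" by (auto simp: incseq_def)
  show fin: "finite {i::'i. to_nat i < m}" for m
    using finite_imageD[of to_nat "{i::'i. to_nat i < m}"] finite_subset[of "to_nat ` {i::'i. to_nat i < m}" "{..<m}"] by auto
  let ?g = "\<lambda>m i. f i * indicator {i. to_nat i < m} i"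
  have g: "(\<Sum>i\<in>{i. to_nat i < m}. f i) = (\<integral>\<^sup>+i. ?g m i \<partial>count_space UNIV)" for m
  proof -
    have "(\<integral>\<^sup>+i. ?g m i \<partial>count_space UNIV) = (\<Sum>i\<in>{i. to_nat i < m}. ?g m i)"
      by (rule nn_integral_count_space'[OF fin]) auto
    then show ?thesis by simp
  qed
  have incg: "incseq ?g"
    by (auto simp: incseq_def le_fun_def indicator_def)
  have sup: "(SUP m. ?g m i) = f i" for i
  proof (rule antisym)
    show "(SUP m. ?g m i) \<le> f i" by (rule SUP_least) (auto simp: indicator_def)
    show "f i \<le> (SUP m. ?g m i)" by (rule SUP_upper2[of "Suc (to_nat i)"]) auto
  qed
  have "(\<integral>\<^sup>+i. f i \<partial>count_space UNIV) = (SUP m. \<integral>\<^sup>+i. ?g m i \<partial>count_space UNIV)"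
    using nn_integral_monotone_convergence_SUP[OF incg, of "count_space UNIV"] by (simp add: sup)
  moreover have "incseq (\<lambda>m. \<integral>\<^sup>+i. ?g m i \<partial>count_space UNIV)"
    using incg by (auto simp: incseq_def le_fun_def intro!: nn_integral_mono)
  ultimately show "(\<lambda>m. \<Sum>i\<in>{i. to_nat i < m}. f i) \<longlonglongrightarrow> (\<integral>\<^sup>+i. f i \<partial>count_space UNIV)"
    unfolding g using LIMSEQ_SUP by metis
qed

lemma heat_measurable [measurable]: "(\<lambda>t. heat p t g x) \<in> borel_measurable borel"
  unfolding heat_def by measurable

lemma heat_sum: "finite J \<Longrightarrow> heat p t (\<lambda>z. \<Sum>x\<in>J. c x * g x z) y = (\<Sum>x\<in>J. c x * heat p t (g x) y)"
proof (induction J rule: finite_induct)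
  case empty
  have "(trans_op p ^^ n) (\<lambda>z. 0) = (\<lambda>z. 0)" for n
    by (induction n) (simp_all add: trans_op_def)
  then show ?case by (simp add: heat_def)
next
  case (insert x J)
  then show ?case by (simp add: heat_add heat_cmult)
qed

lemma heat_eq_power_series:
  assumes a: "\<And>n. (trans_op p ^^ n) g x = ennreal (a n)" "\<And>n. 0 \<le> a n"
    and sm: "summable (\<lambda>n. a n / fact n * t ^ n)" and t: "0 \<le> t"
  shows "heat p t g x = ennreal (exp (- t) * (\<Sum>n. a n / fact n * t ^ n))"
proof -
  have "heat p t g x = (\<Sum>n. ennreal (exp (- t) * t ^ n / fact n * a n))"
    unfolding heat_def a(1) using a(2) t by (simp add: ennreal_mult[symmetric])
  also have "\<dots> = (\<Sum>n. ennreal (exp (- t) * (a n / fact n * t ^ n)))"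
    by (simp add: field_simps)
  also have "\<dots> = ennreal (\<Sum>n. exp (- t) * (a n / fact n * t ^ n))"
    using a(2) t sm by (intro suminf_ennreal2 summable_mult) auto
  also have "\<dots> = ennreal (exp (- t) * (\<Sum>n. a n / fact n * t ^ n))"
    by (subst suminf_mult[OF sm]) simp
  finally show ?thesis .
qed

lemma bounded_power_series:
  fixes a :: "nat \<Rightarrow> real"
  assumes "\<And>n. \<bar>a n\<bar> \<le> 1"
  shows "summable (\<lambda>n. a n / fact n * t ^ n)"
proof (rule summable_comparison_test')
  show "summable (\<lambda>n. \<bar>t\<bar> ^ n /\<^sub>R fact n)" by (rule summable_exp_generic)
  show "norm (a n / fact n * t ^ n) \<le> \<bar>t\<bar> ^ n /\<^sub>R fact n" for n
    using mult_right_mono[OF assms[of n], of "\<bar>t\<bar> ^ n / fact n"] by (simp add: abs_mult power_abs field_simps)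
qed

context symmetric_walk begin

text \<open>In time, the heat flow of a function with values in \<open>[0, 1]\<close> is \<open>exp (- u)\<close> times an everywhere
  convergent power series. It is therefore continuous and has a primitive on the whole line.\<close>

lemma thinning_heat:
  assumes g: "\<And>x. 0 \<le> g x" "\<And>x. g x \<le> 1"
  obtains h H where "thinning h H" "\<And>u. 0 \<le> u \<Longrightarrow> heat p u (\<lambda>x. ennreal (g x)) y = ennreal (h u)"
proof -
  define a where "a n = enn2real ((P ^^ n) (\<lambda>x. ennreal (g x)) y)" for n
  have le: "(P ^^ n) (\<lambda>x. ennreal (g x)) y \<le> 1" for n
    by (rule trans_op_iter_le_const) (simp add: g)
  have a: "(P ^^ n) (\<lambda>x. ennreal (g x)) y = ennreal (a n)" "0 \<le> a n" "a n \<le> 1" for n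
    using le[of n] enn2real_mono[OF le[of n]] by (auto simp: a_def ennreal_enn2real_if top_unique)
  have sm: "summable (\<lambda>n. a n / fact n * t ^ n)" for t
    using a by (intro bounded_power_series) auto
  define h where "h u = exp (- u) * (\<Sum>n. a n / fact n * u ^ n)" for u
  have heat: "heat p u (\<lambda>x. ennreal (g x)) y = ennreal (h u)" if "0 \<le> u" for u
    unfolding h_def by (rule heat_eq_power_series[OF a(1,2) sm that])
  have cont: "continuous_on UNIV h"
    unfolding h_def
  proof (intro continuous_intros)
    have "isCont (\<lambda>u. \<Sum>n. a n / fact n * u ^ n) u" for u
      by (rule isCont_powser_converges_everywhere) (rule sm)
    then show "continuous_on UNIV (\<lambda>u. \<Sum>n. a n / fact n * u ^ n)"
      by (simp add: continuous_at_imp_continuous_on)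
  qed
  define H where "H u = (LBINT v=0..u. 1 - h v)" for u :: real
  have "(H has_real_derivative (1 - h u)) (at u)" for u
  proof -
    let ?b = "\<bar>u\<bar> + 1"
    have "((\<lambda>u. LBINT v=ereal 0..ereal u. 1 - h v) has_vector_derivative (1 - h u)) (at u within {-?b..?b})"
      by (rule interval_integral_FTC2) (auto intro!: continuous_intros continuous_on_subset[OF cont])
    then have "(H has_vector_derivative (1 - h u)) (at u within {-?b..?b})"
      unfolding H_def[abs_def] zero_ereal_def .
    moreover have "at u within {-?b..?b} = at u"
      by (rule at_within_interior) auto
    ultimately show ?thesis by (simp add: has_real_derivative_iff_has_vector_derivative)
  qed
  moreover have "0 \<le> h u \<and> h u \<le> 1" if "0 \<le> u" for u
  proof -
    have "ennreal (h u) \<le> 1"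
      unfolding heat[OF that, symmetric] by (rule heat_le_const) (auto simp: g that)
    moreover have "0 \<le> h u"
      unfolding h_def using a that sm by (intro mult_nonneg_nonneg suminf_nonneg) auto
    ultimately show ?thesis by simp
  qed
  ultimately have "thinning h H"
    using borel_measurable_continuous_onI[OF cont] by unfold_locales (auto simp: H_def zero_ereal_def)
  then show ?thesis using heat that by blast
qed

abbreviation walks :: "('i \<Rightarrow> 'v walk_data) measure" where
  "walks \<equiv> \<Pi>\<^sub>M i\<in>UNIV. walk_space p"

lemma irw_space_eq: "irw_space p \<mu> = \<mu> \<Otimes>\<^sub>M walks \<Otimes>\<^sub>M clocks \<Otimes>\<^sub>M walks"
  by (simp add: irw_space_def)

lemma prob_space_walks: "prob_space walks"
  by (intro prob_space_PiM prob_space_walk_space)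

lemma measurable_initial_walk:
  "(\<lambda>W. walk y (W i) t) \<in> walks \<rightarrow>\<^sub>M count_space UNIV"
  by (rule measurable_compose[OF measurable_component_singleton[of i UNIV "\<lambda>_. walk_space p", OF UNIV_I] measurable_walk])

lemma measurable_arrival: "(\<lambda>E. arrival lam E j) \<in> borel_measurable clocks"
  unfolding arrival_def by (intro borel_measurable_divide borel_measurable_sum measurable_clock) simp

lemma measurable_source_walk:
  "(\<lambda>z. walk y (snd z j) (t - arrival lam (fst z) j)) \<in> clocks \<Otimes>\<^sub>M walks \<rightarrow>\<^sub>M count_space UNIV"
proof -
  have 1: "(\<lambda>z. snd z j) \<in> clocks \<Otimes>\<^sub>M walks \<rightarrow>\<^sub>M walk_space p"
    by (rule measurable_compose[OF measurable_snd measurable_component_singleton[of j UNIV "\<lambda>_. walk_space p", OF UNIV_I]])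
  have 2: "(\<lambda>z. t - arrival lam (fst z) j) \<in> borel_measurable (clocks \<Otimes>\<^sub>M walks)"
    by (intro borel_measurable_diff measurable_compose[OF measurable_fst measurable_arrival]) simp
  show ?thesis
    using measurable_compose[OF measurable_Pair[OF 1 2] measurable_walk_joint] by simp
qed

lemma measurable_irw_config_site:
  assumes \<mu>: "sets \<mu> = sets config_space"
  shows "(\<lambda>\<omega>. irw_config orig lam \<omega> t x) \<in> irw_space p \<mu> \<rightarrow>\<^sub>M count_space UNIV"
proof -
  let ?M = "\<mu> \<Otimes>\<^sub>M walks \<Otimes>\<^sub>M clocks \<Otimes>\<^sub>M (walks :: (nat \<Rightarrow> 'v walk_data) measure)"
  have \<eta>: "(\<lambda>\<omega>. fst \<omega> y) \<in> ?M \<rightarrow>\<^sub>M count_space UNIV" for y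
  proof -
    have "(\<lambda>\<eta>. \<eta> y) \<in> \<mu> \<rightarrow>\<^sub>M count_space UNIV"
      unfolding measurable_cong_sets[OF \<mu> refl] by (rule measurable_component_singleton) simp
    then show ?thesis by (rule measurable_compose[OF measurable_fst])
  qed
  have w: "(\<lambda>\<omega>. walk (fst i) (fst (snd \<omega>) i) t) \<in> ?M \<rightarrow>\<^sub>M count_space UNIV" for i
    by (rule measurable_compose[OF measurable_compose[OF measurable_snd measurable_fst] measurable_initial_walk])
  have a: "(\<lambda>\<omega>. arrival lam (fst (snd (snd \<omega>))) j) \<in> borel_measurable ?M" for j
    by (rule measurable_compose[OF measurable_compose[OF measurable_compose[OF measurable_snd measurable_snd] measurable_fst] measurable_arrival])
  have v: "(\<lambda>\<omega>. walk orig (snd (snd (snd \<omega>)) j) (t - arrival lam (fst (snd (snd \<omega>))) j)) \<in> ?M \<rightarrow>\<^sub>M count_space UNIV" for j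
    by (rule measurable_compose[OF measurable_compose[OF measurable_snd measurable_snd] measurable_source_walk])
  have 1: "(\<lambda>\<omega>. ecount {i. enat (snd i) < fst \<omega> (fst i) \<and> walk (fst i) (fst (snd \<omega>) i) t = x}) \<in> ?M \<rightarrow>\<^sub>M count_space UNIV"
  proof (rule measurable_ecount)
    fix i
    have "Measurable.pred ?M (\<lambda>\<omega>. enat (snd i) < fst \<omega> (fst i))"
      by (rule measurable_compose[OF \<eta>]) simp
    moreover have "Measurable.pred ?M (\<lambda>\<omega>. walk (fst i) (fst (snd \<omega>) i) t = x)"
      by (rule measurable_compose[OF w]) simp
    ultimately show "Measurable.pred ?M (\<lambda>\<omega>. enat (snd i) < fst \<omega> (fst i) \<and> walk (fst i) (fst (snd \<omega>) i) t = x)"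
      by (rule pred_intros_logic)
  qed
  have 2: "(\<lambda>\<omega>. ecount {j. 0 < lam \<and> arrival lam (fst (snd (snd \<omega>))) j \<le> t \<and>
       walk orig (snd (snd (snd \<omega>)) j) (t - arrival lam (fst (snd (snd \<omega>))) j) = x}) \<in> ?M \<rightarrow>\<^sub>M count_space UNIV"
  proof (rule measurable_ecount)
    fix j
    have p1: "Measurable.pred ?M (\<lambda>\<omega>. arrival lam (fst (snd (snd \<omega>))) j \<le> t)"
      unfolding pred_def by (rule borel_measurable_le[OF a borel_measurable_const])
    have p2: "Measurable.pred ?M (\<lambda>\<omega>. walk orig (snd (snd (snd \<omega>)) j) (t - arrival lam (fst (snd (snd \<omega>))) j) = x)"
      by (rule measurable_compose[OF v]) simp
    show "Measurable.pred ?M (\<lambda>\<omega>. 0 < lam \<and> arrival lam (fst (snd (snd \<omega>))) j \<le> t \<and>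
       walk orig (snd (snd (snd \<omega>)) j) (t - arrival lam (fst (snd (snd \<omega>))) j) = x)"
      by (intro pred_intros_logic(3) p1 p2) simp
  qed
  have e: "irw_config orig lam \<omega> t x =
     ecount {i. enat (snd i) < fst \<omega> (fst i) \<and> walk (fst i) (fst (snd \<omega>) i) t = x} +
     ecount {j. 0 < lam \<and> arrival lam (fst (snd (snd \<omega>))) j \<le> t \<and>
       walk orig (snd (snd (snd \<omega>)) j) (t - arrival lam (fst (snd (snd \<omega>))) j) = x}" for \<omega> :: "'v irw_data"
    by (cases \<omega> rule: prod_cases4) (simp add: case_prod_unfold)
  show ?thesis
    unfolding irw_space_eq e
    by (rule measurable_compose[OF measurable_Pair[OF 1 2], of "\<lambda>(a, b). a + b", simplified])
       (auto simp: pair_measure_countable)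
qed

lemma measurable_irw_config:
  assumes \<mu>: "sets \<mu> = sets config_space"
  shows "(\<lambda>\<omega>. irw_config orig lam \<omega> t) \<in> irw_space p \<mu> \<rightarrow>\<^sub>M config_space"
  by (rule measurable_PiM_single') (auto intro!: measurable_irw_config_site[OF \<mu>])

lemma rho_at_eq_heat:
  assumes t: "0 \<le> t"
  shows "rho_at p orig lam \<rho> t x = heat p t (\<lambda>y. ennreal (\<rho> y)) x +
     ennreal lam * (\<integral>\<^sup>+s. heat p s (point orig) x * indicator {0..t} s \<partial>lborel)"
proof -
  have "(\<integral>\<^sup>+s\<in>{0..t}. rw_expect p x s (\<lambda>y. of_bool (y = orig)) \<partial>lborel) =
      (\<integral>\<^sup>+s. heat p s (point orig) x * indicator {0..t} s \<partial>lborel)"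
    by (intro nn_integral_cong) (auto simp: indicator_def rw_expect_eq_heat)
  then show ?thesis by (simp add: rho_at_def rw_expect_eq_heat[OF t])
qed

end

section \<open>Propagation of Poisson product laws\<close>

context symmetric_walk begin

lemma prob_space_irw_space: "prob_space \<mu> \<Longrightarrow> prob_space (irw_space p \<mu>)"
  unfolding irw_space_eq
  by (intro prob_space_pair prob_space_walks clocks.P.prob_space_axioms)

text \<open>With the initial configuration held fixed, the particles are independent, and the expectation of a finite
  product over particles is the product of the expectations. The products run over the particles that start at
  the first \<open>m\<close> sites and over the first \<open>m\<close> arrivals; they are bounded by 1, so the limit may be taken inside
  the expectation.\<close>

lemma conditional_pgf_tendsto:
  fixes \<eta>0 :: "'v \<Rightarrow> enat" and s :: "'v \<Rightarrow> real"
  assumes fin: "\<And>y. \<eta>0 y \<noteq> \<infinity>" and J: "finite J" and s: "\<And>x. 0 \<le> s x \<and> s x < 1" and t: "0 \<le> t"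
  defines "g \<equiv> \<lambda>x. if x \<in> J then s x else 1"
  assumes q: "\<And>y. heat p t (\<lambda>x. ennreal (g x)) y = ennreal (q y)" "\<And>y. 0 \<le> q y"
    and h: "\<And>u. 0 \<le> u \<Longrightarrow> heat p u (\<lambda>x. ennreal (g x)) orig = ennreal (h u)"
    and sets: "sets \<mu> = sets config_space"
  shows "(\<lambda>m. ennreal (\<Prod>y\<in>{y. to_nat y < m}. epow (q y) (\<eta>0 y)) *
          (\<integral>\<^sup>+E. (\<Prod>j<m. ennreal (if 0 < lam \<and> arrival lam E j \<le> t then h (t - arrival lam E j) else 1)) \<partial>clocks))
     \<longlonglongrightarrow> (\<integral>\<^sup>+z. ennreal (\<Prod>x\<in>J. epow (s x) (irw_config orig lam (\<eta>0, z) t x)) \<partial>(walks \<Otimes>\<^sub>M clocks \<Otimes>\<^sub>M walks))"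
proof -
  let ?WW = "walks :: ('v \<times> nat \<Rightarrow> 'v walk_data) measure" and ?WY = "walks :: (nat \<Rightarrow> 'v walk_data) measure"
  interpret Y: prob_space ?WY by (rule prob_space_walks)
  interpret W: prob_space ?WW by (rule prob_space_walks)
  interpret EY: prob_space "clocks \<Otimes>\<^sub>M ?WY"
    by (intro prob_space_pair prob_space_walks clocks.P.prob_space_axioms)
  interpret N: prob_space "?WW \<Otimes>\<^sub>M clocks \<Otimes>\<^sub>M ?WY"
    by (intro prob_space_pair W.prob_space_axioms EY.prob_space_axioms)
  define F where "F m = {i :: 'v \<times> nat. to_nat (fst i) < m \<and> enat (snd i) < \<eta>0 (fst i)}" for m
  have F_Sigma: "F m = Sigma {y. to_nat y < m} (\<lambda>y. {k. enat k < \<eta>0 y})" for m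
    by (auto simp: F_def)
  have below: "{k. enat k < \<eta>0 y} = {..<the_enat (\<eta>0 y)}" for y
    using fin[of y] by (cases "\<eta>0 y") auto
  have F_fin: "finite (F m)" for m
    unfolding F_Sigma below by (intro finite_SigmaI initial_segments(2)) simp
  have g: "0 \<le> g x" "g x \<le> 1" for x using s[of x] by (auto simp: g_def)
  define a where "a m W = (\<Prod>i\<in>F m. g (walk (fst i) (W i) t))" for m and W :: "'v \<times> nat \<Rightarrow> 'v walk_data"
  define b where "b m z = (\<Prod>j<m. if 0 < lam \<and> arrival lam (fst z) j \<le> t then g (walk orig (snd z j) (t - arrival lam (fst z) j)) else 1)"
    for m and z :: "(nat \<Rightarrow> real) \<times> (nat \<Rightarrow> 'v walk_data)"
  have ab: "0 \<le> a m W" "a m W \<le> 1" "0 \<le> b m z" "b m z \<le> 1" for m W z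
    by (auto simp: a_def b_def g intro!: prod_nonneg prod_le_1)
  have g_meas: "(\<lambda>x. ennreal (g x)) \<in> borel_measurable (count_space UNIV)" by simp
  have walk_meas: "(\<lambda>\<omega>. ennreal (g (walk y \<omega> u))) \<in> borel_measurable (walk_space p)" for y u
    by (rule measurable_compose[OF measurable_walk g_meas])
  have am: "(\<lambda>W. ennreal (a m W)) \<in> borel_measurable ?WW" for m
    unfolding a_def
    by (intro measurable_compose[OF borel_measurable_prod measurable_ennreal] measurable_compose[OF measurable_initial_walk]) simp
  have bm: "(\<lambda>z. ennreal (b m z)) \<in> borel_measurable (clocks \<Otimes>\<^sub>M ?WY)" for m
    unfolding b_def
  proof (intro measurable_compose[OF borel_measurable_prod measurable_ennreal] measurable_If)
    fix j
    show "(\<lambda>z. g (walk orig (snd z j) (t - arrival lam (fst z) j))) \<in> borel_measurable (clocks \<Otimes>\<^sub>M ?WY)"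
      by (rule measurable_compose[OF measurable_source_walk]) simp
    have "(\<lambda>z. arrival lam (fst z) j) \<in> borel_measurable (clocks \<Otimes>\<^sub>M ?WY)"
      by (rule measurable_compose[OF measurable_fst measurable_arrival])
    then have "{z \<in> space (clocks \<Otimes>\<^sub>M ?WY). arrival lam (fst z) j \<le> t} \<in> sets (clocks \<Otimes>\<^sub>M ?WY)"
      by (rule borel_measurable_le) simp
    then show "{z \<in> space (clocks \<Otimes>\<^sub>M ?WY). 0 < lam \<and> arrival lam (fst z) j \<le> t} \<in> sets (clocks \<Otimes>\<^sub>M ?WY)"
      by (cases "0 < lam") auto
  qed simp
  have int_a: "(\<integral>\<^sup>+W. ennreal (a m W) \<partial>?WW) = ennreal (\<Prod>y\<in>{y. to_nat y < m}. epow (q y) (\<eta>0 y))" for m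
  proof -
    have "(\<integral>\<^sup>+W. ennreal (a m W) \<partial>?WW) = (\<integral>\<^sup>+W. (\<Prod>i\<in>F m. ennreal (g (walk (fst i) (W i) t))) \<partial>?WW)"
      by (simp add: a_def prod_ennreal g)
    also have "\<dots> = (\<Prod>i\<in>F m. \<integral>\<^sup>+\<omega>. ennreal (g (walk (fst i) \<omega> t)) \<partial>walk_space p)"
      by (rule nn_integral_PiM_prod[OF prob_space_walk_space F_fin walk_meas])
    also have "\<dots> = (\<Prod>i\<in>F m. ennreal (q (fst i)))"
      using rw_expect_eq_heat[OF t, of _ "\<lambda>x. ennreal (g x)"] q(1) by (simp add: rw_expect_def)
    also have "\<dots> = ennreal (\<Prod>i\<in>F m. q (fst i))"
      by (rule prod_ennreal) (rule q)
    also have "(\<Prod>i\<in>F m. q (fst i)) = (\<Prod>y\<in>{y. to_nat y < m}. \<Prod>k\<in>{k. enat k < \<eta>0 y}. q y)"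
      unfolding F_Sigma below
      by (subst prod.Sigma) (auto simp: initial_segments(2) case_prod_unfold)
    also have "\<dots> = (\<Prod>y\<in>{y. to_nat y < m}. epow (q y) (\<eta>0 y))"
      unfolding below
    proof (rule prod.cong)
      fix y show "(\<Prod>k\<in>{..<the_enat (\<eta>0 y)}. q y) = epow (q y) (\<eta>0 y)"
        using fin[of y] by (cases "\<eta>0 y") auto
    qed simp
    finally show ?thesis .
  qed
  have int_b: "(\<integral>\<^sup>+z. ennreal (b m z) \<partial>(clocks \<Otimes>\<^sub>M ?WY)) =
     (\<integral>\<^sup>+E. (\<Prod>j<m. ennreal (if 0 < lam \<and> arrival lam E j \<le> t then h (t - arrival lam E j) else 1)) \<partial>clocks)" for m
  proof -
    have "(\<integral>\<^sup>+z. ennreal (b m z) \<partial>(clocks \<Otimes>\<^sub>M ?WY)) = (\<integral>\<^sup>+E. \<integral>\<^sup>+Y. ennreal (b m (E, Y)) \<partial>?WY \<partial>clocks)"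
      by (rule Y.nn_integral_fst[OF bm, symmetric])
    also have "\<dots> = (\<integral>\<^sup>+E. (\<Prod>j<m. ennreal (if 0 < lam \<and> arrival lam E j \<le> t then h (t - arrival lam E j) else 1)) \<partial>clocks)"
    proof (rule nn_integral_cong)
      fix E
      let ?f = "\<lambda>j \<omega>. ennreal (if 0 < lam \<and> arrival lam E j \<le> t then g (walk orig \<omega> (t - arrival lam E j)) else 1)"
      have "(\<integral>\<^sup>+Y. ennreal (b m (E, Y)) \<partial>?WY) = (\<integral>\<^sup>+Y. (\<Prod>j<m. ?f j (Y j)) \<partial>?WY)"
        unfolding b_def fst_conv snd_conv by (subst prod_ennreal) (auto simp: g)
      also have "\<dots> = (\<Prod>j<m. \<integral>\<^sup>+\<omega>. ?f j \<omega> \<partial>walk_space p)"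
      proof (rule nn_integral_PiM_prod[OF prob_space_walk_space])
        show "?f j \<in> borel_measurable (walk_space p)" for j
          using walk_meas by (cases "0 < lam \<and> arrival lam E j \<le> t") auto
      qed simp
      also have "\<dots> = (\<Prod>j<m. ennreal (if 0 < lam \<and> arrival lam E j \<le> t then h (t - arrival lam E j) else 1))"
      proof (rule prod.cong)
        fix j
        have "(\<integral>\<^sup>+\<omega>. ennreal (g (walk orig \<omega> u)) \<partial>walk_space p) = ennreal (h u)" if "0 \<le> u" for u
          using rw_expect_eq_heat[OF that, of orig "\<lambda>x. ennreal (g x)"] h[OF that] by (simp add: rw_expect_def)
        then show "(\<integral>\<^sup>+\<omega>. ?f j \<omega> \<partial>walk_space p) = ennreal (if 0 < lam \<and> arrival lam E j \<le> t then h (t - arrival lam E j) else 1)"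
          using prob_space.emeasure_space_1[OF prob_space_walk_space]
          by (cases "0 < lam \<and> arrival lam E j \<le> t") auto
      qed simp
      finally show "(\<integral>\<^sup>+Y. ennreal (b m (E, Y)) \<partial>?WY) = (\<Prod>j<m. ennreal (if 0 < lam \<and> arrival lam E j \<le> t then h (t - arrival lam E j) else 1))" .
    qed
    finally show ?thesis .
  qed
  have abm: "(\<lambda>z. ennreal (a m (fst z)) * ennreal (b m (snd z))) \<in> borel_measurable (?WW \<Otimes>\<^sub>M clocks \<Otimes>\<^sub>M ?WY)" for m
    by (intro borel_measurable_times_ennreal measurable_compose[OF measurable_fst am] measurable_compose[OF measurable_snd bm])
  have int_ab: "(\<integral>\<^sup>+z. ennreal (a m (fst z)) * ennreal (b m (snd z)) \<partial>(?WW \<Otimes>\<^sub>M clocks \<Otimes>\<^sub>M ?WY)) =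
     (\<integral>\<^sup>+W. ennreal (a m W) \<partial>?WW) * (\<integral>\<^sup>+z. ennreal (b m z) \<partial>(clocks \<Otimes>\<^sub>M ?WY))" for m
  proof -
    have "(\<integral>\<^sup>+z. ennreal (a m (fst z)) * ennreal (b m (snd z)) \<partial>(?WW \<Otimes>\<^sub>M clocks \<Otimes>\<^sub>M ?WY)) =
       (\<integral>\<^sup>+W. \<integral>\<^sup>+z. ennreal (a m W) * ennreal (b m z) \<partial>(clocks \<Otimes>\<^sub>M ?WY) \<partial>?WW)"
      using EY.nn_integral_fst[OF abm, of m] by simp
    also have "\<dots> = (\<integral>\<^sup>+W. ennreal (a m W) * (\<integral>\<^sup>+z. ennreal (b m z) \<partial>(clocks \<Otimes>\<^sub>M ?WY)) \<partial>?WW)"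
      by (intro nn_integral_cong nn_integral_cmult bm)
    also have "\<dots> = (\<integral>\<^sup>+W. ennreal (a m W) \<partial>?WW) * (\<integral>\<^sup>+z. ennreal (b m z) \<partial>(clocks \<Otimes>\<^sub>M ?WY))"
      by (rule nn_integral_multc[OF am])
    finally show ?thesis .
  qed
  have lim: "(\<lambda>m. ennreal (a m (fst z)) * ennreal (b m (snd z))) \<longlonglongrightarrow>
     ennreal (\<Prod>x\<in>J. epow (s x) (irw_config orig lam (\<eta>0, z) t x))" for z
  proof -
    obtain W E Y where z: "z = (W, E, Y)" by (cases z rule: prod_cases3)
    let ?act = "\<lambda>i::'v \<times> nat. enat (snd i) < \<eta>0 (fst i)" and ?pos = "\<lambda>i::'v \<times> nat. walk (fst i) (W i) t"
    have "(\<lambda>m. \<Prod>i\<in>F m. if ?act i then (if ?pos i \<in> J then s (?pos i) else 1) else 1)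
        \<longlonglongrightarrow> (\<Prod>x\<in>J. epow (s x) (ecount {i. ?act i \<and> ?pos i = x}))"
    proof (rule tendsto_prod_epow_ecount[OF J s])
      show "incseq F" by (auto simp: incseq_def F_def)
      show "\<exists>m. i \<in> F m" if "?act i" for i
        using that by (auto simp: F_def)
    qed (rule F_fin)
    moreover have "(\<Prod>i\<in>F m. if ?act i then (if ?pos i \<in> J then s (?pos i) else 1) else 1) = a m W" for m
      unfolding a_def by (rule prod.cong) (auto simp: F_def g_def)
    ultimately have la: "(\<lambda>m. a m W) \<longlonglongrightarrow> (\<Prod>x\<in>J. epow (s x) (ecount {i. ?act i \<and> ?pos i = x}))"
      by simp
    let ?act' = "\<lambda>j. 0 < lam \<and> arrival lam E j \<le> t" and ?pos' = "\<lambda>j. walk orig (Y j) (t - arrival lam E j)"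
    have "(\<lambda>m. \<Prod>j<m. if ?act' j then (if ?pos' j \<in> J then s (?pos' j) else 1) else 1)
        \<longlonglongrightarrow> (\<Prod>x\<in>J. epow (s x) (ecount {j. ?act' j \<and> ?pos' j = x}))"
      by (rule tendsto_prod_epow_ecount[OF J s]) (auto simp: incseq_def)
    then have lb: "(\<lambda>m. b m (E, Y)) \<longlonglongrightarrow> (\<Prod>x\<in>J. epow (s x) (ecount {j. ?act' j \<and> ?pos' j = x}))"
      by (simp only: b_def g_def fst_conv snd_conv)
    have conf: "irw_config orig lam (\<eta>0, z) t x = ecount {i. ?act i \<and> ?pos i = x} + ecount {j. ?act' j \<and> ?pos' j = x}" for x
      by (simp add: z case_prod_unfold)
    have "(\<lambda>m. ennreal (a m W * b m (E, Y))) \<longlonglongrightarrow> ennreal (\<Prod>x\<in>J. epow (s x) (irw_config orig lam (\<eta>0, z) t x))"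
      unfolding conf epow_add prod.distrib by (intro tendsto_ennrealI tendsto_mult la lb)
    then show ?thesis by (simp add: z ennreal_mult ab)
  qed
  have "(\<lambda>m. \<integral>\<^sup>+z. ennreal (a m (fst z)) * ennreal (b m (snd z)) \<partial>(?WW \<Otimes>\<^sub>M clocks \<Otimes>\<^sub>M ?WY))
     \<longlonglongrightarrow> (\<integral>\<^sup>+z. ennreal (\<Prod>x\<in>J. epow (s x) (irw_config orig lam (\<eta>0, z) t x)) \<partial>(?WW \<Otimes>\<^sub>M clocks \<Otimes>\<^sub>M ?WY))"
  proof (rule nn_integral_dominated_convergence[where w = "\<lambda>_. 1"])
    show "AE z in ?WW \<Otimes>\<^sub>M clocks \<Otimes>\<^sub>M ?WY. ennreal (a m (fst z)) * ennreal (b m (snd z)) \<le> 1" for m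
      by (rule AE_I2) (auto simp: ab ennreal_mult[symmetric] ennreal_le_1 mult_le_one)
    show "(\<lambda>z. ennreal (\<Prod>x\<in>J. epow (s x) (irw_config orig lam (\<eta>0, z) t x))) \<in> borel_measurable (?WW \<Otimes>\<^sub>M clocks \<Otimes>\<^sub>M ?WY)"
      by (rule borel_measurable_LIMSEQ_order[OF lim abm])
  qed (use abm lim N.emeasure_space_1 in auto)
  then show ?thesis unfolding int_ab int_a int_b .
qed

text \<open>Averaging the conditional generating function over the Poisson initial numbers gives
  \<open>exp (- (\<Sum>y. (1 - q y) * \<rho> y))\<close>, where \<open>q y\<close> is the heat flow of \<open>g\<close> at \<open>y\<close>. Here \<open>1 - q\<close> is the heat flow
  of \<open>1 - g\<close>, a combination of point functions at the observed sites, and symmetry of the heat kernel moves the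
  sum over \<open>y\<close> to the heat flow of \<open>\<rho>\<close> at these sites. The source term is rewritten in the same way.\<close>

theorem irw_law_poisson_product:
  assumes \<rho>: "\<And>x. 0 \<le> \<rho> x" and lam: "0 \<le> lam" and t: "0 \<le> t"
  shows "irw_law p orig lam (poisson_product (\<lambda>x. ennreal (\<rho> x))) t = poisson_product (rho_at p orig lam \<rho> t)"
proof -
  let ?\<mu> = "poisson_product (\<lambda>x. ennreal (\<rho> x))"
  let ?S = "irw_space p ?\<mu>"
  let ?C = "config_space"
  interpret \<mu>: prob_space ?\<mu> by (rule prob_space_poisson_product)
  have conf: "(\<lambda>\<omega>. irw_config orig lam \<omega> t) \<in> ?S \<rightarrow>\<^sub>M ?C"
    by (rule measurable_irw_config[OF sets_poisson_product])
  show ?thesis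
  proof (rule config_measure_eqI)
    show "prob_space (irw_law p orig lam ?\<mu> t)"
      unfolding irw_law_def
      by (rule prob_space.prob_space_distr[OF prob_space_irw_space[OF \<mu>.prob_space_axioms] conf])
    show "sets (irw_law p orig lam ?\<mu> t) = sets ?C"
      by (simp add: irw_law_def)
    fix J :: "'v set" and s :: "'v \<Rightarrow> real"
    assume J: "finite J" and s: "\<And>x. 0 \<le> s x \<and> s x < 1"
    \<comment> \<open>A particle at \<open>x\<close> contributes the factor \<open>g x\<close> to the generating function.\<close>
    define g where "g x = (if x \<in> J then s x else 1)" for x
    have g: "0 \<le> g x" "g x \<le> 1" for x using s[of x] by (auto simp: g_def)
    obtain h H where th: "thinning h H" and h: "\<And>u. 0 \<le> u \<Longrightarrow> heat p u (\<lambda>x. ennreal (g x)) orig = ennreal (h u)"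
      by (rule thinning_heat[where g = g and y = orig, OF g]) (rule that)
    interpret thinning h H by (rule th)
    define q where "q y = enn2real (heat p t (\<lambda>x. ennreal (g x)) y)" for y
    have hle: "heat p t (\<lambda>x. ennreal (g x)) y \<le> 1" for y
      by (rule heat_le_const[OF _ t]) (simp add: g)
    have q: "heat p t (\<lambda>x. ennreal (g x)) y = ennreal (q y)" "0 \<le> q y" "q y \<le> 1" for y
    proof -
      have "heat p t (\<lambda>x. ennreal (g x)) y < \<top>"
        using hle[of y] by (rule le_less_trans) simp
      then show "heat p t (\<lambda>x. ennreal (g x)) y = ennreal (q y)"
        unfolding q_def by (rule ennreal_enn2real[symmetric])
      then show "q y \<le> 1" using hle[of y] by simp
    qed (simp add: q_def)
    let ?F = "\<lambda>\<omega>. ennreal (\<Prod>x\<in>J. epow (s x) (irw_config orig lam \<omega> t x))"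
    let ?N = "walks \<Otimes>\<^sub>M clocks \<Otimes>\<^sub>M walks :: (('v \<times> nat \<Rightarrow> 'v walk_data) \<times> (nat \<Rightarrow> real) \<times> (nat \<Rightarrow> 'v walk_data)) measure"
    interpret N: prob_space ?N
      by (intro prob_space_pair prob_space_walks clocks.P.prob_space_axioms)
    let ?A = "\<lambda>m. \<integral>\<^sup>+E. (\<Prod>j<m. ennreal (if 0 < lam \<and> arrival lam E j \<le> t then h (t - arrival lam E j) else 1)) \<partial>clocks"
    let ?\<kappa> = "\<lambda>m \<eta>. ennreal (\<Prod>y\<in>{y. to_nat y < m}. epow (q y) (\<eta> y))"
    have Fm: "?F \<in> borel_measurable (?\<mu> \<Otimes>\<^sub>M ?N)"
      using measurable_compose[OF conf measurable_prod_epow] unfolding irw_space_eq .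
    have \<kappa>m: "?\<kappa> m \<in> borel_measurable ?\<mu>" for m
      unfolding measurable_cong_sets[OF sets_poisson_product refl] by (rule measurable_prod_epow)
    have "(\<integral>\<^sup>+\<eta>. ennreal (\<Prod>x\<in>J. epow (s x) (\<eta> x)) \<partial>irw_law p orig lam ?\<mu> t) = (\<integral>\<^sup>+\<omega>. ?F \<omega> \<partial>?S)"
      unfolding irw_law_def by (rule nn_integral_distr[OF conf]) (simp add: measurable_prod_epow)
    also have "\<dots> = (\<integral>\<^sup>+\<eta>. \<integral>\<^sup>+z. ?F (\<eta>, z) \<partial>?N \<partial>?\<mu>)"
      unfolding irw_space_eq by (rule N.nn_integral_fst[OF Fm, symmetric])
    finally have lhs: "(\<integral>\<^sup>+\<eta>. ennreal (\<Prod>x\<in>J. epow (s x) (\<eta> x)) \<partial>irw_law p orig lam ?\<mu> t) =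
        (\<integral>\<^sup>+\<eta>. \<integral>\<^sup>+z. ?F (\<eta>, z) \<partial>?N \<partial>?\<mu>)" .
    have A_le: "?A m \<le> 1" for m
    proof -
      have "?A m \<le> (\<integral>\<^sup>+E. 1 \<partial>clocks)"
        by (intro nn_integral_mono prod_le_1) (auto simp: ennreal_le_1 h_bounds)
      then show ?thesis by (simp add: clocks.P.emeasure_space_1)
    qed
    have lim1: "(\<lambda>m. \<integral>\<^sup>+\<eta>. ?\<kappa> m \<eta> * ?A m \<partial>?\<mu>) \<longlonglongrightarrow> (\<integral>\<^sup>+\<eta>. \<integral>\<^sup>+z. ?F (\<eta>, z) \<partial>?N \<partial>?\<mu>)"
    proof (rule nn_integral_dominated_convergence[where w = "\<lambda>_. 1"])
      show "(\<lambda>\<eta>. ?\<kappa> m \<eta> * ?A m) \<in> borel_measurable ?\<mu>" for m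
        by (intro borel_measurable_times_ennreal \<kappa>m) simp
      show "(\<lambda>\<eta>. \<integral>\<^sup>+z. ?F (\<eta>, z) \<partial>?N) \<in> borel_measurable ?\<mu>"
        by (rule N.borel_measurable_nn_integral_fst[OF Fm])
      show "AE \<eta> in ?\<mu>. ?\<kappa> m \<eta> * ?A m \<le> 1" for m
      proof (rule AE_I2)
        fix \<eta>
        have "(\<Prod>y\<in>{y. to_nat y < m}. epow (q y) (\<eta> y)) \<le> 1"
          by (intro prod_le_1) (auto simp: epow_bounds q)
        then show "?\<kappa> m \<eta> * ?A m \<le> 1"
          using A_le[of m] by (intro mult_le_one) (auto simp: ennreal_le_1)
      qed
      show "AE \<eta> in ?\<mu>. (\<lambda>m. ?\<kappa> m \<eta> * ?A m) \<longlonglongrightarrow> (\<integral>\<^sup>+z. ?F (\<eta>, z) \<partial>?N)"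
        using AE_poisson_product_finite[of \<rho>]
      proof eventually_elim
        case (elim \<eta>)
        show ?case
          by (rule conditional_pgf_tendsto[OF _ J s t _ _ _ sets_poisson_product])
            (use elim q h in \<open>auto simp: g_def[symmetric]\<close>)
      qed
    qed (auto simp: \<mu>.emeasure_space_1)
    have int\<kappa>: "(\<integral>\<^sup>+\<eta>. ?\<kappa> m \<eta> * ?A m \<partial>?\<mu>) =
        ennreal (nexp (\<Sum>y\<in>{y. to_nat y < m}. ennreal (1 - q y) * ennreal (\<rho> y))) * ?A m" for m
      by (subst nn_integral_multc[OF \<kappa>m], subst poisson_product_pgf[OF initial_segments(2)]) (auto simp: q)
    let ?B = "\<integral>\<^sup>+y. ennreal (1 - q y) * ennreal (\<rho> y) \<partial>count_space UNIV"
    have "(\<lambda>m. ennreal (nexp (\<Sum>y\<in>{y. to_nat y < m}. ennreal (1 - q y) * ennreal (\<rho> y))) * ?A m)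
        \<longlonglongrightarrow> ennreal (nexp ?B) * ennreal (exp (- lam * H t))"
    proof (rule tendsto_mult_ennreal)
      show "(\<lambda>m. ennreal (nexp (\<Sum>y\<in>{y. to_nat y < m}. ennreal (1 - q y) * ennreal (\<rho> y)))) \<longlonglongrightarrow> ennreal (nexp ?B)"
        by (intro tendsto_ennrealI tendsto_nexp initial_segments(3))
      show "?A \<longlonglongrightarrow> ennreal (exp (- lam * H t))"
        by (rule arrivals_thinned_tendsto[OF th lam t])
    qed auto
    with lim1 have val: "(\<integral>\<^sup>+\<eta>. \<integral>\<^sup>+z. ?F (\<eta>, z) \<partial>?N \<partial>?\<mu>) = ennreal (nexp ?B) * ennreal (exp (- lam * H t))"
      unfolding int\<kappa> by (rule LIMSEQ_unique)
    define D where "D z = (\<Sum>x\<in>J. ennreal (1 - s x) * point x z)" for z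
    have gD: "ennreal (g z) + D z = 1" for z
    proof -
      have "D z = (\<Sum>x\<in>J. if x = z then ennreal (1 - s x) else 0)"
        unfolding D_def by (intro sum.cong) auto
      also have "\<dots> = (if z \<in> J then ennreal (1 - s z) else 0)"
        by (rule sum.delta[OF J])
      finally show ?thesis using s[of z] by (auto simp: g_def simp flip: ennreal_plus)
    qed
    have heatD: "heat p u D y = ennreal (1 - r)" if "0 \<le> u" "heat p u (\<lambda>x. ennreal (g x)) y = ennreal r" "0 \<le> r" for u y r
    proof -
      have "ennreal r + heat p u D y = 1"
        using heat_add[of p u "\<lambda>x. ennreal (g x)" D y] heat_const[OF that(1), of 1 y] that(2) by (simp add: gD)
      then have "heat p u D y = 1 - ennreal r"
        by (metis ennreal_add_diff_cancel_left ennreal_neq_top)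
      then show ?thesis using that(3) by (simp add: ennreal_minus flip: ennreal_1)
    qed
    have heatD': "heat p u D y = (\<Sum>x\<in>J. ennreal (1 - s x) * heat p u (point y) x)" for u y
      unfolding D_def[abs_def] heat_sum[OF J] using heat_point_sym[of u _ y] by (intro sum.cong refl arg_cong2[where f = "(*)"]) auto
    have B: "?B = (\<Sum>x\<in>J. ennreal (1 - s x) * heat p t (\<lambda>y. ennreal (\<rho> y)) x)"
    proof -
      have "?B = (\<integral>\<^sup>+y. (\<Sum>x\<in>J. ennreal (1 - s x) * (ennreal (\<rho> y) * heat p t (point y) x)) \<partial>count_space UNIV)"
        unfolding heatD[OF t q(1,2), symmetric] heatD' sum_distrib_right
        by (intro nn_integral_cong sum.cong refl) (simp only: mult_ac)
      also have "\<dots> = (\<Sum>x\<in>J. ennreal (1 - s x) * (\<integral>\<^sup>+y. ennreal (\<rho> y) * heat p t (point y) x \<partial>count_space UNIV))"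
        by (subst nn_integral_sum) (simp_all add: nn_integral_cmult)
      finally show ?thesis by (subst (asm) heat_kernel[symmetric])
    qed
    have lamH: "ennreal (lam * H t) = (\<Sum>x\<in>J. ennreal (1 - s x) * (ennreal lam * (\<integral>\<^sup>+u. heat p u (point orig) x * indicator {0..t} u \<partial>lborel)))"
    proof -
      have "ennreal (H t) = (\<integral>\<^sup>+u. (\<Sum>x\<in>J. ennreal (1 - s x) * (heat p u (point orig) x * indicator {0..t} u)) \<partial>lborel)"
        unfolding H_integral[OF t, symmetric]
      proof (rule nn_integral_cong)
        fix u
        show "ennreal (1 - h u) * indicator {0..t} u = (\<Sum>x\<in>J. ennreal (1 - s x) * (heat p u (point orig) x * indicator {0..t} u))"
        proof (cases "u \<in> {0..t}")
          case True
          then have "ennreal (1 - h u) = heat p u D orig"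
            by (intro heatD[symmetric] h h_bounds) auto
          then show ?thesis using True by (simp add: heatD')
        qed simp
      qed
      also have "\<dots> = (\<Sum>x\<in>J. ennreal (1 - s x) * (\<integral>\<^sup>+u. heat p u (point orig) x * indicator {0..t} u \<partial>lborel))"
        by (subst nn_integral_sum) (simp_all add: nn_integral_cmult)
      finally show ?thesis
        by (simp only: ennreal_mult[OF lam H_nonneg[OF t]] sum_distrib_left mult.left_commute)
    qed
    have "ennreal (nexp ?B) * ennreal (exp (- lam * H t)) = ennreal (nexp ?B * nexp (ennreal (lam * H t)))"
      using nexp_ennreal[of "lam * H t"] lam H_nonneg[OF t] nexp_bounds by (simp add: ennreal_mult)
    also have "nexp ?B * nexp (ennreal (lam * H t)) = nexp (\<Sum>x\<in>J. ennreal (1 - s x) * rho_at p orig lam \<rho> t x)"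
      unfolding nexp_add[symmetric] B lamH rho_at_eq_heat[OF t] distrib_left sum.distrib ..
    also have "ennreal \<dots> = (\<integral>\<^sup>+\<eta>. ennreal (\<Prod>x\<in>J. epow (s x) (\<eta> x)) \<partial>poisson_product (rho_at p orig lam \<rho> t))"
      by (rule poisson_product_pgf[OF J, symmetric]) (use s in \<open>auto simp: less_imp_le\<close>)
    finally show "(\<integral>\<^sup>+\<eta>. ennreal (\<Prod>x\<in>J. epow (s x) (\<eta> x)) \<partial>irw_law p orig lam ?\<mu> t) =
       (\<integral>\<^sup>+\<eta>. ennreal (\<Prod>x\<in>J. epow (s x) (\<eta> x)) \<partial>poisson_product (rho_at p orig lam \<rho> t))"
      unfolding lhs val .
  qed (rule prob_space_poisson_product sets_poisson_product)+
qed

end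

section \<open>The density solves the deterministic system\<close>

lemma trans_op_heat: "trans_op p (heat p t g) x = heat p t (trans_op p g) x"
proof -
  have "trans_op p (heat p t g) x = trans_op p (\<lambda>x. \<Sum>n. ennreal (exp (- t) * t ^ n / fact n) * (trans_op p ^^ n) g x) x"
    by (simp only: heat_def[abs_def])
  also have "\<dots> = (\<Sum>n. ennreal (exp (- t) * t ^ n / fact n) * (trans_op p ^^ Suc n) g x)"
    unfolding trans_op_suminf trans_op_cmult by simp
  finally show ?thesis unfolding funpow_Suc_apply' heat_def .
qed

lemma summable_if_suminf_ennreal_finite:
  assumes "\<And>n. 0 \<le> f n" "(\<Sum>n. ennreal (f n)) < \<infinity>"
  shows "summable f"
  using assms by (intro summable_suminf_not_top) auto

text \<open>Up to \<open>exp (- t)\<close> the heat flow is a power series with nonnegative coefficients. Finiteness for all \<open>t < T\<close>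
  makes its radius of convergence at least \<open>T\<close>, and differentiation shifts the coefficients, which replaces
  \<open>g\<close> by its image under the transition operator.\<close>

lemma heat_flow:
  assumes T: "0 < T" and fin: "\<And>t. 0 \<le> t \<Longrightarrow> t < T \<Longrightarrow> heat p t g x < \<infinity>"
  obtains k where "\<And>t. 0 \<le> t \<Longrightarrow> t < T \<Longrightarrow> heat p t g x = ennreal (k t) \<and> 0 \<le> k t"
    and "\<And>t. 0 \<le> t \<Longrightarrow> t < T \<Longrightarrow> heat p t (trans_op p g) x < \<infinity>"
    and "\<And>t. 0 \<le> t \<Longrightarrow> t < T \<Longrightarrow> (k has_real_derivative enn2real (heat p t (trans_op p g) x) - k t) (at t)"
proof -
  define a where "a n = enn2real ((trans_op p ^^ n) g x)" for n
  have a: "(trans_op p ^^ n) g x = ennreal (a n)" for n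
  proof -
    have "ennreal (exp (- (T/2)) * (T/2) ^ n / fact n) * (trans_op p ^^ n) g x \<le> heat p (T/2) g x"
      unfolding heat_def
      using sum_le_suminf[of "\<lambda>n. ennreal (exp (- (T/2)) * (T/2) ^ n / fact n) * (trans_op p ^^ n) g x" "{n}"] by simp
    also have "\<dots> < \<infinity>" using T by (intro fin) auto
    finally have "(trans_op p ^^ n) g x \<noteq> \<top>"
      using T by (auto simp: ennreal_mult_top)
    then show ?thesis unfolding a_def by (simp add: less_top)
  qed
  have a0: "0 \<le> a n" for n by (simp add: a_def)
  have sm: "summable (\<lambda>n. a n / fact n * t ^ n)" if t: "\<bar>t\<bar> < T" for t
  proof (rule summable_comparison_test')
    have "(\<Sum>n. ennreal (exp (- \<bar>t\<bar>) * \<bar>t\<bar> ^ n / fact n * a n)) = heat p \<bar>t\<bar> g x"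
      unfolding heat_def a by (simp add: ennreal_mult[symmetric] a0)
    also have "\<dots> < \<infinity>" using t by (intro fin) auto
    finally have "summable (\<lambda>n. exp (- \<bar>t\<bar>) * \<bar>t\<bar> ^ n / fact n * a n)"
      by (intro summable_if_suminf_ennreal_finite) (auto simp: a0)
    then have "summable (\<lambda>n. exp \<bar>t\<bar> * (exp (- \<bar>t\<bar>) * \<bar>t\<bar> ^ n / fact n * a n))"
      by (rule summable_mult)
    then show "summable (\<lambda>n. a n / fact n * \<bar>t\<bar> ^ n)"
      by (simp add: exp_minus field_simps)
    show "norm (a n / fact n * t ^ n) \<le> a n / fact n * \<bar>t\<bar> ^ n" for n
      by (simp add: abs_mult power_abs a0)
  qed
  have d: "diffs (\<lambda>n. a n / fact n) n = a (Suc n) / fact n" for n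
    unfolding diffs_def fact_Suc of_nat_mult by (simp del: of_nat_Suc)
  have sm': "summable (\<lambda>n. a (Suc n) / fact n * t ^ n)" if "\<bar>t\<bar> < T" for t
    using termdiff_converges[of t T "\<lambda>n. a n / fact n"] sm that unfolding d by auto
  define k where "k t = exp (- t) * (\<Sum>n. a n / fact n * t ^ n)" for t
  have heat: "heat p t g x = ennreal (k t)" "0 \<le> k t" if "0 \<le> t" "t < T" for t
  proof -
    show "heat p t g x = ennreal (k t)"
      unfolding k_def using that by (intro heat_eq_power_series a a0 sm) auto
    show "0 \<le> k t"
      unfolding k_def using that a0 by (intro mult_nonneg_nonneg suminf_nonneg sm) auto
  qed
  have heat': "heat p t (trans_op p g) x = ennreal (exp (- t) * (\<Sum>n. a (Suc n) / fact n * t ^ n))"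
    if "0 \<le> t" "t < T" for t
  proof (rule heat_eq_power_series)
    show "(trans_op p ^^ n) (trans_op p g) x = ennreal (a (Suc n))" for n
      unfolding a[symmetric] funpow_Suc_apply' ..
  qed (use that a0 sm' in auto)
  show ?thesis
  proof
    fix t assume t: "0 \<le> t" "t < T"
    show "heat p t g x = ennreal (k t) \<and> 0 \<le> k t" using heat[OF t] by simp
    show "heat p t (trans_op p g) x < \<infinity>" using heat'[OF t] by simp
    have "((\<lambda>t. \<Sum>n. a n / fact n * t ^ n) has_real_derivative (\<Sum>n. a (Suc n) / fact n * t ^ n)) (at t)"
      unfolding d[symmetric] by (rule termdiffs_strong'[where K = T]) (use sm t in auto)
    then have "(k has_real_derivative exp (- t) * (\<Sum>n. a (Suc n) / fact n * t ^ n) - k t) (at t)"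
      unfolding k_def by (auto intro!: derivative_eq_intros)
    moreover have "enn2real (heat p t (trans_op p g) x) = exp (- t) * (\<Sum>n. a (Suc n) / fact n * t ^ n)"
      unfolding heat'[OF t] using t a0 sm' by (intro enn2real_ennreal mult_nonneg_nonneg suminf_nonneg) auto
    ultimately show "(k has_real_derivative enn2real (heat p t (trans_op p g) x) - k t) (at t)"
      by simp
  qed
qed

lemma nonneg_derivative_imp_le:
  fixes f :: "real \<Rightarrow> real"
  assumes "a \<le> b" and d: "\<And>s. a \<le> s \<Longrightarrow> s \<le> b \<Longrightarrow> (f has_real_derivative f' s) (at s within {a..b})"
    and nn: "\<And>s. a \<le> s \<Longrightarrow> s \<le> b \<Longrightarrow> 0 \<le> f' s"
  shows "f a \<le> f b"
proof -
  obtain s where "s \<in> {a..b}" "f b - f a = f' s * (b - a)"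
    using mvt_very_simple[OF assms(1), of f "\<lambda>s h. f' s * h"] d
    unfolding has_field_derivative_def by blast
  then show ?thesis using mult_nonneg_nonneg[OF nn[of s], of "b - a"] assms(1) by simp
qed

context symmetric_walk begin

lemma trans_op_real:
  assumes f: "\<And>y. 0 \<le> f y" and fin: "P (\<lambda>y. ennreal (f y)) x < \<infinity>"
  shows "((\<lambda>y. p x y * f y) has_sum enn2real (P (\<lambda>y. ennreal (f y)) x)) UNIV"
proof -
  have e: "P (\<lambda>y. ennreal (f y)) x = (\<integral>\<^sup>+y. ennreal (p x y * f y) \<partial>count_space UNIV)"
    by (simp add: trans_op_def ennreal_mult p_nonneg f)
  have sm: "(\<lambda>y. p x y * f y) summable_on UNIV"
    using fin unfolding e by (subst summable_on_iff_nn_integral_finite) (auto simp: p_nonneg f)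
  have "enn2real (P (\<lambda>y. ennreal (f y)) x) = (\<Sum>\<^sub>\<infinity>y. p x y * f y)"
    unfolding e nn_integral_count_space_eq_infsum[OF sm mult_nonneg_nonneg[OF p_nonneg f]]
    by (intro enn2real_ennreal infsum_nonneg) (simp add: p_nonneg f)
  then show ?thesis using has_sum_infsum[OF sm] by simp
qed

lemma generator_has_sum:
  assumes "((\<lambda>y. p x y * f y) has_sum S) UNIV"
  shows "((\<lambda>y. p x y * (f y - f x)) has_sum (S - f x)) UNIV"
proof -
  have "((\<lambda>y. p x y * f y + p x y * (- f x)) has_sum (S + 1 * (- f x))) UNIV"
    by (intro has_sum_add assms has_sum_cmult_left p_has_sum)
  then show ?thesis by (simp add: algebra_simps)
qed

lemma integrated_kernel:
  obtains K where "\<And>u. 0 \<le> u \<Longrightarrow> (\<integral>\<^sup>+s. heat p s (point orig) x * indicator {0..u} s \<partial>lborel) = ennreal (K u)"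
    and "\<And>u. 0 \<le> u \<Longrightarrow> 0 \<le> K u" and "K 0 = 0"
    and "\<And>u. 0 \<le> u \<Longrightarrow> (K has_real_derivative enn2real (heat p u (point orig) x)) (at u)"
proof -
  have b: "(0::real) \<le> of_bool (y = orig)" "of_bool (y = orig) \<le> (1::real)" for y by auto
  obtain h H where th: "thinning h H" and h: "\<And>u. 0 \<le> u \<Longrightarrow> heat p u (\<lambda>y. ennreal (of_bool (y = orig))) x = ennreal (h u)"
    by (rule thinning_heat[where g = "\<lambda>y. of_bool (y = orig)" and y = x, OF b]) (rule that)
  interpret thinning h H by (rule th)
  have e: "ennreal (of_bool c) = of_bool c" for c by (cases c) auto
  note h = h[unfolded e]
  have dK: "((\<lambda>u. u - H u) has_real_derivative h u) (at u)" for u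
    by (auto intro!: derivative_eq_intros H_deriv)
  show ?thesis
  proof
    fix u :: real assume u: "0 \<le> u"
    have "(\<integral>\<^sup>+s. heat p s (point orig) x * indicator {0..u} s \<partial>lborel) = (\<integral>\<^sup>+s. ennreal (h s) * indicator {0..u} s \<partial>lborel)"
      by (intro nn_integral_cong) (auto simp: indicator_def h)
    also have "\<dots> = ennreal ((u - H u) - (0 - H 0))"
      by (rule nn_integral_FTC_Icc) (use dK h_bounds u in auto)
    finally show "(\<integral>\<^sup>+s. heat p s (point orig) x * indicator {0..u} s \<partial>lborel) = ennreal (u - H u)"
      by (simp add: H_0)
    have "0 - H 0 \<le> u - H u"
      by (rule nonneg_derivative_imp_le[OF u, of "\<lambda>u. u - H u" h])
        (use dK h_bounds in \<open>auto intro: has_field_derivative_at_within\<close>)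
    then show "0 \<le> u - H u" by (simp add: H_0)
    show "((\<lambda>u. u - H u) has_real_derivative enn2real (heat p u (point orig) x)) (at u)"
      using dK[of u] h[OF u] h_bounds(1)[OF u] by simp
  qed (simp add: H_0)
qed

text \<open>This is the time integral of the equation \<open>\<partial>\<^sub>s heat = P heat - heat\<close>, with \<open>P\<close> taken out of the integral
  by Tonelli's theorem; it avoids subtraction because all terms have values in \<open>[0, \<infinity>]\<close>.\<close>

lemma integrated_kernel_balance:
  assumes t: "0 \<le> t"
  shows "P (\<lambda>y. \<integral>\<^sup>+s. heat p s (point orig) y * indicator {0..t} s \<partial>lborel) x + of_bool (x = orig) =
     heat p t (point orig) x + (\<integral>\<^sup>+s. heat p s (point orig) x * indicator {0..t} s \<partial>lborel)"
proof -
  have le: "heat p s (point orig) x < \<infinity>" if "0 \<le> s" for s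
    by (rule le_less_trans[OF heat_le_const[of _ 1]]) (auto simp: that)
  have t1: "0 < t + 1" using t by simp
  obtain k where k: "\<And>s. 0 \<le> s \<Longrightarrow> s < t + 1 \<Longrightarrow> heat p s (point orig) x = ennreal (k s) \<and> 0 \<le> k s"
    and fin: "\<And>s. 0 \<le> s \<Longrightarrow> s < t + 1 \<Longrightarrow> heat p s (P (point orig)) x < \<infinity>"
    and dk: "\<And>s. 0 \<le> s \<Longrightarrow> s < t + 1 \<Longrightarrow> (k has_real_derivative enn2real (heat p s (P (point orig)) x) - k s) (at s)"
    by (rule heat_flow[OF t1, where g = "point orig" and p = p and x = x]) (use le in \<open>blast intro: that\<close>)+
  let ?I = "\<lambda>u x. \<integral>\<^sup>+s. heat p s (point orig) x * indicator {0..u} s \<partial>lborel"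
  obtain K where K: "\<And>u. 0 \<le> u \<Longrightarrow> ?I u x = ennreal (K u)" "\<And>u. 0 \<le> u \<Longrightarrow> 0 \<le> K u" and K0: "K 0 = 0"
    and dK: "\<And>s. 0 \<le> s \<Longrightarrow> (K has_real_derivative enn2real (heat p s (point orig) x)) (at s)"
    by (rule integrated_kernel[where orig = orig and x = x]) (rule that)
  have dkK: "((\<lambda>s. k s + K s) has_real_derivative enn2real (heat p s (P (point orig)) x)) (at s)" if "s \<in> {0..t}" for s
  proof -
    have "enn2real (heat p s (point orig) x) = k s" using k[of s] that by auto
    then show ?thesis using DERIV_add[OF dk[of s] dK[of s]] that by simp
  qed
  have m: "(\<lambda>s. enn2real (heat p s (P (point orig)) x)) \<in> borel_measurable borel"
    by measurable
  have "P (\<lambda>y. ?I t y) x = (\<integral>\<^sup>+s. P (heat p s (point orig)) x * indicator {0..t} s \<partial>lborel)"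
  proof -
    have "P (\<lambda>y. ?I t y) x = (\<integral>\<^sup>+y. \<integral>\<^sup>+s. ennreal (p x y) * (heat p s (point orig) y * indicator {0..t} s) \<partial>lborel \<partial>count_space UNIV)"
      unfolding trans_op_def by (intro nn_integral_cong nn_integral_cmult[symmetric]) measurable
    also have "\<dots> = (\<integral>\<^sup>+s. \<integral>\<^sup>+y. ennreal (p x y) * (heat p s (point orig) y * indicator {0..t} s) \<partial>count_space UNIV \<partial>lborel)"
      by (rule nn_integral_count_space_nn_integral[symmetric]; measurable)
    also have "\<dots> = (\<integral>\<^sup>+s. P (heat p s (point orig)) x * indicator {0..t} s \<partial>lborel)"
      unfolding trans_op_def mult.assoc[symmetric] by (intro nn_integral_cong nn_integral_multc) simp
    finally show ?thesis .
  qed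
  also have "\<dots> = (\<integral>\<^sup>+s. ennreal (enn2real (heat p s (P (point orig)) x)) * indicator {0..t} s \<partial>lborel)"
    unfolding trans_op_heat using fin by (intro nn_integral_cong) (auto simp: indicator_def)
  also have "\<dots> = ennreal ((k t + K t) - (k 0 + K 0))"
  proof (rule nn_integral_FTC_Icc[OF m])
    fix s assume s: "s \<in> {0..t}"
    show "((\<lambda>s. k s + K s) has_real_derivative enn2real (heat p s (P (point orig)) x)) (at s)"
      by (rule dkK[OF s])
  qed (use t in auto)
  finally have *: "P (\<lambda>y. ?I t y) x = ennreal ((k t + K t) - k 0)" by (simp add: K0)
  have k0: "k 0 = of_bool (x = orig)"
    using k[of 0] t by (auto simp: heat_0 split: if_splits)
  have "k 0 \<le> k t + K t"
  proof -
    have "k 0 + K 0 \<le> k t + K t"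
    proof (rule nonneg_derivative_imp_le[OF t])
      fix s assume s: "0 \<le> s" "s \<le> t"
      show "((\<lambda>s. k s + K s) has_real_derivative enn2real (heat p s (P (point orig)) x)) (at s within {0..t})"
        by (rule has_field_derivative_at_within[OF dkK]) (use s in simp)
    qed simp
    then show ?thesis by (simp add: K0)
  qed
  then have "P (\<lambda>y. ?I t y) x + ennreal (k 0) = ennreal (k t + K t)"
    unfolding * using k[of 0] t by (simp flip: ennreal_plus)
  also have "ennreal (k 0) = of_bool (x = orig)" by (simp add: k0 split: if_splits)
  also have "ennreal (k t + K t) = heat p t (point orig) x + ?I t x"
    using k[of t] K(1,2)[OF t] t by simp
  finally show ?thesis .
qed

text \<open>The heat flow of \<open>\<rho>\<close> obeys the homogeneous equation by \<open>heat_flow\<close>. The derivative of the time integral of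
  the heat kernel is the kernel itself, which \<open>integrated_kernel_balance\<close> expresses by the generator.\<close>

lemma solves_det_system_rho_at:
  assumes \<rho>: "\<And>x. 0 \<le> \<rho> x" and lam: "0 \<le> lam" and T: "0 < T"
    and fin: "\<And>t x. 0 \<le> t \<Longrightarrow> t < T \<Longrightarrow> rho_at p orig lam \<rho> t x < \<infinity>"
  shows "solves_det_system p orig lam T (\<lambda>t x. enn2real (rho_at p orig lam \<rho> t x))"
  unfolding solves_det_system_def
proof (intro allI ballI)
  let ?g = "\<lambda>y. ennreal (\<rho> y)" and ?z = "\<lambda>t x. enn2real (rho_at p orig lam \<rho> t x)"
  let ?I = "\<lambda>t x. \<integral>\<^sup>+s. heat p s (point orig) x * indicator {0..t} s \<partial>lborel"
  fix x t assume "t \<in> {0..<T}"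
  then have t: "0 \<le> t" "t < T" by auto
  have heat_fin: "heat p t ?g x < \<infinity>" if "0 \<le> t" "t < T" for t x
    using fin[OF that, of x] unfolding rho_at_eq_heat[OF that(1)] by auto
  obtain k where k: "\<And>s. 0 \<le> s \<Longrightarrow> s < T \<Longrightarrow> heat p s ?g x = ennreal (k s) \<and> 0 \<le> k s"
    and Pfin: "\<And>s. 0 \<le> s \<Longrightarrow> s < T \<Longrightarrow> heat p s (P ?g) x < \<infinity>"
    and dk: "\<And>s. 0 \<le> s \<Longrightarrow> s < T \<Longrightarrow> (k has_real_derivative enn2real (heat p s (P ?g) x) - k s) (at s)"
    by (rule heat_flow[OF T, where g = ?g and p = p and x = x]) (use heat_fin in \<open>blast intro: that\<close>)+
  obtain K where K: "\<And>u. 0 \<le> u \<Longrightarrow> ?I u x = ennreal (K u)" "\<And>u. 0 \<le> u \<Longrightarrow> 0 \<le> K u"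
    and dK: "\<And>s. 0 \<le> s \<Longrightarrow> (K has_real_derivative enn2real (heat p s (point orig) x)) (at s)"
    by (rule integrated_kernel[where orig = orig and x = x]) (rule that)
  have z: "?z s x = k s + lam * K s" if "0 \<le> s" "s < T" for s
    unfolding rho_at_eq_heat[OF that(1)] using k[OF that] K[OF that(1)] lam
    by (simp add: ennreal_mult[symmetric] flip: ennreal_plus)
  have z0: "0 \<le> ?z t y" for y by simp
  have zr: "ennreal (?z t y) = rho_at p orig lam \<rho> t y" for y
    using fin[OF t, of y] by simp
  have P_add: "P (\<lambda>y. f y + c * g y) x = P f x + c * P g x" for f g :: "'v \<Rightarrow> ennreal" and c
  proof -
    have "P (\<lambda>y. f y + c * g y) x = P f x + P (\<lambda>y. c * g y) x"
      unfolding trans_op_def by (simp only: distrib_left, rule nn_integral_add) simp_all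
    then show ?thesis by (simp add: trans_op_cmult)
  qed
  have "P (\<lambda>y. rho_at p orig lam \<rho> t y) x = P (heat p t ?g) x + ennreal lam * P (?I t) x"
    unfolding rho_at_eq_heat[OF t(1)] by (rule P_add)
  then have Pz: "P (\<lambda>y. ennreal (?z t y)) x = heat p t (P ?g) x + ennreal lam * P (?I t) x"
    by (simp only: zr trans_op_heat)
  let ?h = "enn2real (heat p t (point orig) x)"
  have hfin: "heat p t (point orig) x < \<infinity>"
    by (rule le_less_trans[OF heat_le_const[of _ 1]]) (auto simp: t)
  have PI: "P (?I t) x + of_bool (x = orig) = ennreal (?h + K t)"
    unfolding integrated_kernel_balance[OF t(1)] using hfin K[OF t(1)] by simp
  then have "P (?I t) x \<noteq> \<top>" by auto
  then obtain r where r: "P (?I t) x = ennreal r" "0 \<le> r" by (cases "P (?I t) x") auto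
  have "ennreal (r + of_bool (x = orig)) = ennreal r + of_bool (x = orig)"
    using r(2) by (cases "x = orig") simp_all
  then have "ennreal (r + of_bool (x = orig)) = ennreal (?h + K t)"
    using PI r(1) by simp
  then have r_eq: "r + of_bool (x = orig) = ?h + K t"
    using r(2) K(2)[OF t(1)] by (subst (asm) ennreal_inj) auto
  have Pz_real: "enn2real (P (\<lambda>y. ennreal (?z t y)) x) = enn2real (heat p t (P ?g) x) + lam * r"
    and Pz_fin: "P (\<lambda>y. ennreal (?z t y)) x < \<infinity>"
  proof -
    obtain q where q: "heat p t (P ?g) x = ennreal q" "0 \<le> q"
      using Pfin[OF t] by (cases "heat p t (P ?g) x") auto
    have e: "P (\<lambda>y. ennreal (?z t y)) x = ennreal (q + lam * r)"
      unfolding Pz q r using lam q r by (simp add: ennreal_mult)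
    show "enn2real (P (\<lambda>y. ennreal (?z t y)) x) = enn2real (heat p t (P ?g) x) + lam * r"
      unfolding e using lam q r by (subst enn2real_ennreal) auto
    show "P (\<lambda>y. ennreal (?z t y)) x < \<infinity>" unfolding e by simp
  qed
  have gen: "((\<lambda>y. p x y * (?z t y - ?z t x)) has_sum (enn2real (heat p t (P ?g) x) + lam * r - ?z t x)) UNIV"
    using generator_has_sum[OF trans_op_real[OF z0 Pz_fin]] unfolding Pz_real .
  have "((\<lambda>s. k s + lam * K s) has_real_derivative (enn2real (heat p t (P ?g) x) - k t) + lam * ?h) (at t)"
    by (intro DERIV_add dk[OF t] DERIV_cmult dK[OF t(1)])
  also have "(enn2real (heat p t (P ?g) x) - k t) + lam * ?h =
      (enn2real (heat p t (P ?g) x) + lam * r - ?z t x) + lam * of_bool (x = orig)"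
  proof -
    have "lam * ?h + lam * K t = lam * r + lam * of_bool (x = orig)"
      unfolding distrib_left[symmetric] r_eq ..
    then show ?thesis unfolding z[OF t] by simp
  qed
  also have "enn2real (heat p t (P ?g) x) + lam * r - ?z t x = (\<Sum>\<^sub>\<infinity>y. p x y * (?z t y - ?z t x))"
    by (rule infsumI[OF gen, symmetric])
  finally have "((\<lambda>s. k s + lam * K s) has_real_derivative
      (\<Sum>\<^sub>\<infinity>y. p x y * (?z t y - ?z t x)) + lam * of_bool (x = orig)) (at t within {0..<T})"
    by (rule has_field_derivative_at_within)
  then have "((\<lambda>s. ?z s x) has_real_derivative
      (\<Sum>\<^sub>\<infinity>y. p x y * (?z t y - ?z t x)) + lam * of_bool (x = orig)) (at t within {0..<T})"
    by (rule has_field_derivative_transform_within[where d = 1]) (use t z in auto)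
  then show "(\<lambda>y. p x y * (?z t y - ?z t x)) summable_on UNIV \<and>
     ((\<lambda>s. ?z s x) has_real_derivative
       (\<Sum>\<^sub>\<infinity>y. p x y * (?z t y - ?z t x)) + lam * of_bool (x = orig)) (at t within {0..<T})"
    using has_sum_imp_summable[OF gen] by blast
qed

lemma rho_at_0: "rho_at p orig lam \<rho> 0 x = ennreal (\<rho> x)"
proof -
  have "(\<integral>\<^sup>+s. heat p s (point orig) x * indicator {0..0::real} s \<partial>lborel) = 0"
    by (rule integrated_kernel[where orig = orig and x = x]) simp
  then show ?thesis by (simp add: rho_at_eq_heat heat_0)
qed

end

section \<open>Uniqueness of nonnegative solutions\<close>

context symmetric_walk begin

lemma trans_op_eq_infsum:
  assumes f: "\<And>y. 0 \<le> f y" and sm: "(\<lambda>y. p x y * f y) summable_on UNIV"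
  shows "P (\<lambda>y. ennreal (f y)) x = ennreal (\<Sum>\<^sub>\<infinity>y. p x y * f y)"
proof -
  have e: "P (\<lambda>y. ennreal (f y)) x = (\<integral>\<^sup>+y. ennreal (p x y * f y) \<partial>count_space UNIV)"
    by (simp add: trans_op_def ennreal_mult p_nonneg f)
  show ?thesis
    unfolding e by (rule nn_integral_count_space_eq_infsum[OF sm]) (simp add: p_nonneg f)
qed

end

text \<open>For two nonnegative solutions \<open>z\<close> and \<open>w\<close>, multiplication by \<open>exp t\<close> removes the loss term of the
  generator: \<open>a t = exp t * (z t + w t)\<close> satisfies \<open>a' \<ge> P a\<close>, and \<open>u t = exp t * (z t - w t)\<close> satisfies
  \<open>u' = P u\<close>, so that \<open>\<bar>u'\<bar> \<le> P \<bar>u\<bar>\<close>.\<close>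

locale dominated_difference = symmetric_walk p for p :: "'v::countable \<Rightarrow> 'v \<Rightarrow> real" +
  fixes a a' u u' :: "real \<Rightarrow> 'v \<Rightarrow> real" and T :: real
  assumes nn: "\<And>t x. 0 \<le> t \<Longrightarrow> t < T \<Longrightarrow> 0 \<le> a t x"
    and deriv: "\<And>t x. 0 \<le> t \<Longrightarrow> t < T \<Longrightarrow> ((\<lambda>s. a s x) has_real_derivative a' t x) (at t within {0..<T})"
    and P_le: "\<And>t x. 0 \<le> t \<Longrightarrow> t < T \<Longrightarrow> P (\<lambda>y. ennreal (a t y)) x \<le> ennreal (a' t x)"
    and a'_nn: "\<And>t x. 0 \<le> t \<Longrightarrow> t < T \<Longrightarrow> 0 \<le> a' t x"
    and u_le: "\<And>t x. 0 \<le> t \<Longrightarrow> t < T \<Longrightarrow> \<bar>u t x\<bar> \<le> a t x"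
    and u_deriv: "\<And>t x. 0 \<le> t \<Longrightarrow> t < T \<Longrightarrow> ((\<lambda>s. u s x) has_real_derivative u' t x) (at t within {0..<T})"
    and u'_le: "\<And>t x. 0 \<le> t \<Longrightarrow> t < T \<Longrightarrow> ennreal \<bar>u' t x\<bar> \<le> P (\<lambda>y. ennreal \<bar>u t y\<bar>) x"
begin

text \<open>Positivity makes \<open>a\<close> dominate every single term of its Taylor expansion around \<open>t\<close>. Read backwards, the
  iterates of \<open>P\<close> on \<open>a t\<close> are finite and grow at most like \<open>n! / (r - t) ^ n\<close>.\<close>

lemma growth_bound:
  assumes t: "0 \<le> t" and r: "t \<le> r" "r < T"
  shows "ennreal ((r - t) ^ n / fact n) * (P ^^ n) (\<lambda>y. ennreal (a t y)) x \<le> ennreal (a r x)"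
  using r
proof (induction n arbitrary: r x)
  case 0
  have "a t x \<le> a r x"
  proof (rule nonneg_derivative_imp_le[OF 0(1), where f' = "\<lambda>s. a' s x"])
    show "((\<lambda>s. a s x) has_real_derivative a' s x) (at s within {t..r})" if "t \<le> s" "s \<le> r" for s
      by (rule DERIV_subset[OF deriv]) (use that t 0 in auto)
  qed (use a'_nn t 0 in auto)
  then show ?case by (simp add: ennreal_leI)
next
  case (Suc n)
  let ?A = "\<lambda>y. ennreal (a t y)"
  have rate: "ennreal ((s - t) ^ n / fact n) * (P ^^ Suc n) ?A x \<le> ennreal (a' s x)" if "t \<le> s" "s \<le> r" for s
  proof -
    have "ennreal ((s - t) ^ n / fact n) * (P ^^ Suc n) ?A x = P (\<lambda>y. ennreal ((s - t) ^ n / fact n) * (P ^^ n) ?A y) x"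
      by (simp add: trans_op_cmult)
    also have "\<dots> \<le> P (\<lambda>y. ennreal (a s y)) x"
      by (rule trans_op_mono) (use Suc.IH[of s] that Suc.prems in auto)
    also have "\<dots> \<le> ennreal (a' s x)" using that t Suc.prems by (intro P_le) auto
    finally show ?thesis .
  qed
  show ?case
  proof (cases "r = t")
    case True
    then show ?thesis by simp
  next
    case False
    then have rt: "t < r" using Suc.prems by simp
    have "(P ^^ Suc n) ?A x \<noteq> \<top>"
    proof
      assume "(P ^^ Suc n) ?A x = \<top>"
      moreover have "0 < (r - t) ^ n / fact n" using rt by simp
      ultimately have "\<top> \<le> ennreal (a' r x)"
        using rate[of r] rt by (simp add: ennreal_mult_top del: funpow.simps)
      then show False by (simp add: top_unique)
    qed
    then obtain c where c: "(P ^^ Suc n) ?A x = ennreal c" "0 \<le> c" by (cases "(P ^^ Suc n) ?A x") auto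
    have ratec: "(s - t) ^ n / fact n * c \<le> a' s x" if "t \<le> s" "s \<le> r" for s
      using rate[OF that] that t Suc.prems(2) c a'_nn[of s x] unfolding c by (simp add: ennreal_mult[symmetric])
    have "a t x - (t - t) ^ Suc n / fact (Suc n) * c \<le> a r x - (r - t) ^ Suc n / fact (Suc n) * c"
    proof (rule nonneg_derivative_imp_le[of t r "\<lambda>s. a s x - (s - t) ^ Suc n / fact (Suc n) * c" "\<lambda>s. a' s x - (s - t) ^ n / fact n * c"])
      fix s assume s: "t \<le> s" "s \<le> r"
      have da: "((\<lambda>s. a s x) has_real_derivative a' s x) (at s within {t..r})"
        by (rule DERIV_subset[OF deriv]) (use s t Suc.prems in auto)
      have "((\<lambda>s. (s - t) ^ Suc n / fact (Suc n)) has_real_derivative real (Suc n) * (s - t) ^ n / fact (Suc n)) (at s within {t..r})"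
        by (rule derivative_eq_intros refl | simp)+
      also have "real (Suc n) * (s - t) ^ n / fact (Suc n) = (s - t) ^ n / fact n"
        unfolding fact_Suc of_nat_mult by (simp del: of_nat_Suc)
      finally show "((\<lambda>s. a s x - (s - t) ^ Suc n / fact (Suc n) * c) has_real_derivative a' s x - (s - t) ^ n / fact n * c) (at s within {t..r})"
        by (intro DERIV_diff da DERIV_cmult_right)
    qed (use rt ratec in auto)
    moreover have "0 \<le> a t x" using t rt Suc.prems by (intro nn) auto
    ultimately have "(r - t) ^ Suc n / fact (Suc n) * c \<le> a r x" by simp
    then show ?thesis unfolding c using rt c by (simp add: ennreal_mult[symmetric] ennreal_leI del: power_Suc fact_Suc)
  qed
qed

text \<open>Start from \<open>\<bar>u\<bar> \<le> a t\<close> on \<open>[t0, t]\<close> and integrate \<open>\<bar>u'\<bar> \<le> P \<bar>u\<bar>\<close> \<open>n\<close> times from \<open>t0\<close>, where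
  \<open>u\<close> vanishes.\<close>

lemma difference_bound:
  assumes t0: "0 \<le> t0" "\<And>x. u t0 x = 0" and t: "t0 \<le> t" "t < T" and s: "t0 \<le> s" "s \<le> t"
  shows "ennreal \<bar>u s x\<bar> \<le> ennreal ((s - t0) ^ n / fact n) * (P ^^ n) (\<lambda>y. ennreal (a t y)) x"
  using s
proof (induction n arbitrary: s x)
  case 0
  have "a s x \<le> a t x"
  proof (rule nonneg_derivative_imp_le[OF 0(2), where f' = "\<lambda>s. a' s x"])
    show "((\<lambda>s. a s x) has_real_derivative a' r x) (at r within {s..t})" if "s \<le> r" "r \<le> t" for r
      by (rule DERIV_subset[OF deriv]) (use that t t0 0 in auto)
  qed (use a'_nn t t0 0 in auto)
  then show ?case using u_le[of s x] t t0 0 by (auto intro!: ennreal_leI)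
next
  case (Suc n)
  let ?A = "\<lambda>y. ennreal (a t y)"
  have rate: "ennreal \<bar>u' r x\<bar> \<le> ennreal ((r - t0) ^ n / fact n) * (P ^^ Suc n) ?A x" if "t0 \<le> r" "r \<le> t" for r
  proof -
    have "ennreal \<bar>u' r x\<bar> \<le> P (\<lambda>y. ennreal \<bar>u r y\<bar>) x" using that t t0 by (intro u'_le) auto
    also have "\<dots> \<le> P (\<lambda>y. ennreal ((r - t0) ^ n / fact n) * (P ^^ n) ?A y) x"
      by (rule trans_op_mono) (use Suc.IH that in auto)
    finally show ?thesis by (simp add: trans_op_cmult)
  qed
  have "(P ^^ Suc n) ?A x \<noteq> \<top>"
  proof
    assume top: "(P ^^ Suc n) ?A x = \<top>"
    obtain r where r: "t < r" "r < T" using dense[OF t(2)] by blast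
    have "ennreal ((r - t) ^ Suc n / fact (Suc n)) * (P ^^ Suc n) ?A x \<le> ennreal (a r x)"
      by (rule growth_bound) (use t t0 r in auto)
    moreover have "0 < (r - t) ^ Suc n / fact (Suc n)" using r by simp
    ultimately have "\<top> \<le> ennreal (a r x)"
      unfolding top using r by (simp add: ennreal_mult_top del: power_Suc fact_Suc)
    then show False by (simp add: top_unique)
  qed
  then obtain c where c: "(P ^^ Suc n) ?A x = ennreal c" "0 \<le> c" by (cases "(P ^^ Suc n) ?A x") auto
  have ratec: "\<bar>u' r x\<bar> \<le> (r - t0) ^ n / fact n * c" if "t0 \<le> r" "r \<le> t" for r
    using rate[OF that] that c unfolding c by (simp add: ennreal_mult[symmetric])
  have pw: "((\<lambda>s. (s - t0) ^ Suc n / fact (Suc n) * c) has_real_derivative (r - t0) ^ n / fact n * c) (at r within S)" for r S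
  proof -
    have "((\<lambda>s. (s - t0) ^ Suc n / fact (Suc n)) has_real_derivative real (Suc n) * (r - t0) ^ n / fact (Suc n)) (at r within S)"
      by (rule derivative_eq_intros refl | simp)+
    also have "real (Suc n) * (r - t0) ^ n / fact (Suc n) = (r - t0) ^ n / fact n"
      unfolding fact_Suc of_nat_mult by (simp del: of_nat_Suc)
    finally show ?thesis by (rule DERIV_cmult_right)
  qed
  have du: "((\<lambda>s. u s x) has_real_derivative u' r x) (at r within {t0..s})" if "t0 \<le> r" "r \<le> s" for r
    by (rule DERIV_subset[OF u_deriv]) (use that t t0 Suc.prems in auto)
  have "(t0 - t0) ^ Suc n / fact (Suc n) * c - u t0 x \<le> (s - t0) ^ Suc n / fact (Suc n) * c - u s x"
    by (rule nonneg_derivative_imp_le[of t0 s "\<lambda>s. (s - t0) ^ Suc n / fact (Suc n) * c - u s x" "\<lambda>r. (r - t0) ^ n / fact n * c - u' r x"])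
      (use Suc.prems du pw ratec in \<open>auto intro!: DERIV_diff simp: abs_le_iff simp del: power_Suc fact_Suc\<close>)
  moreover have "(t0 - t0) ^ Suc n / fact (Suc n) * c + u t0 x \<le> (s - t0) ^ Suc n / fact (Suc n) * c + u s x"
  proof (rule nonneg_derivative_imp_le[of t0 s "\<lambda>s. (s - t0) ^ Suc n / fact (Suc n) * c + u s x" "\<lambda>r. (r - t0) ^ n / fact n * c + u' r x"])
    show "0 \<le> (r - t0) ^ n / fact n * c + u' r x" if "t0 \<le> r" "r \<le> s" for r
      using ratec[of r] that Suc.prems by (simp add: abs_le_iff)
  qed (use Suc.prems du pw in \<open>auto intro!: DERIV_add simp del: power_Suc fact_Suc\<close>)
  ultimately have "\<bar>u s x\<bar> \<le> (s - t0) ^ Suc n / fact (Suc n) * c"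
    using t0(2)[of x] by simp
  then show ?case unfolding c using Suc.prems c by (simp add: ennreal_mult[symmetric] ennreal_leI del: power_Suc fact_Suc)
qed

text \<open>The two preceding bounds give \<open>\<bar>u t\<bar> \<le> ((t - t0) / (r - t)) ^ n * a r\<close>, which tends to 0 if \<open>t\<close> lies in
  the first half of the interval from \<open>t0\<close> to some \<open>r < T\<close>. Hence zeros propagate from \<open>t0\<close> over a fixed
  proportion of the remaining time.\<close>

lemma difference_zero:
  assumes u0: "\<And>x. u 0 x = 0" and t: "0 \<le> t" "t < T"
  shows "u t x = 0"
proof -
  have local: "u t x = 0" if t0: "0 \<le> t0" "\<And>x. u t0 x = 0" and t: "t0 \<le> t" "t - t0 < T - t" "t < T" for t0 t x
  proof -
    obtain r where r: "t - t0 < r - t" "r < T"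
      using dense[of "t + (t - t0)" T] t by (auto simp: algebra_simps)
    have rt: "0 < r - t" "t \<le> r" using r t by auto
    have bound: "\<bar>u t x\<bar> \<le> ((t - t0) / (r - t)) ^ n * a r x" for n
    proof -
      let ?c = "(P ^^ n) (\<lambda>y. ennreal (a t y)) x"
      have 1: "ennreal \<bar>u t x\<bar> \<le> ennreal ((t - t0) ^ n / fact n) * ?c"
        by (rule difference_bound) (use t0 t in auto)
      have 2: "ennreal ((r - t) ^ n / fact n) * ?c \<le> ennreal (a r x)"
        by (rule growth_bound) (use t0 t rt r in auto)
      have "(t - t0) ^ n / fact n = ((t - t0) / (r - t)) ^ n * ((r - t) ^ n / fact n)"
        using rt by (simp add: power_divide)
      then have e: "ennreal ((t - t0) ^ n / fact n) = ennreal (((t - t0) / (r - t)) ^ n) * ennreal ((r - t) ^ n / fact n)"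
        using rt t by (simp only:) (intro ennreal_mult, auto)
      have "ennreal \<bar>u t x\<bar> \<le> ennreal (((t - t0) / (r - t)) ^ n) * (ennreal ((r - t) ^ n / fact n) * ?c)"
        using 1 unfolding e mult.assoc .
      also have "\<dots> \<le> ennreal (((t - t0) / (r - t)) ^ n) * ennreal (a r x)"
        by (intro mult_left_mono 2) simp
      also have "\<dots> = ennreal (((t - t0) / (r - t)) ^ n * a r x)"
        using rt t r t0 nn[of r x] by (intro ennreal_mult[symmetric]) auto
      finally show ?thesis
        using rt t r t0 nn[of r x] by (subst (asm) ennreal_le_iff) (auto intro!: mult_nonneg_nonneg)
    qed
    have "(\<lambda>n. ((t - t0) / (r - t)) ^ n * a r x) \<longlonglongrightarrow> 0 * a r x"
      using rt r t by (intro tendsto_mult tendsto_const LIMSEQ_realpow_zero) auto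
    then have "\<bar>u t x\<bar> \<le> 0 * a r x"
      by (rule LIMSEQ_le_const) (use bound in auto)
    then show ?thesis by simp
  qed
  \<comment> \<open>Each step gains one third of the remaining time, safely inside its first half.\<close>
  define \<tau> where "\<tau> k = T - T * (2/3) ^ k" for k :: nat
  have T: "0 < T" using t by simp
  have step: "\<forall>t x. 0 \<le> t \<and> t \<le> \<tau> k \<longrightarrow> u t x = 0" for k
  proof (induction k)
    case 0
    then show ?case using u0 by (auto simp: \<tau>_def)
  next
    case (Suc k)
    have k: "0 \<le> \<tau> k" "\<tau> k < T"
      using T power_le_one[of "2/3::real" k] by (auto simp: \<tau>_def)
    show ?case
    proof (intro allI impI, elim conjE)
      fix t x assume t: "0 \<le> t" "t \<le> \<tau> (Suc k)"
      show "u t x = 0"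
      proof (cases "t \<le> \<tau> k")
        case False
        have "T - \<tau> (Suc k) = 2/3 * (T - \<tau> k)" by (simp add: \<tau>_def)
        then have *: "3 * t \<le> T + 2 * \<tau> k" using t(2) by (simp add: field_simps)
        then have "t - \<tau> k < T - t" using k by (simp add: algebra_simps)
        moreover have "t < T" using * k by simp
        ultimately show ?thesis using local[of "\<tau> k" t x] Suc k False by auto
      qed (use Suc t in auto)
    qed
  qed
  have "(\<lambda>k. T * (2/3::real) ^ k) \<longlonglongrightarrow> T * 0"
    by (intro tendsto_mult tendsto_const LIMSEQ_realpow_zero) auto
  then have "eventually (\<lambda>k. T * (2/3::real) ^ k < T - t) sequentially"
    using order_tendstoD(2)[of _ "T * 0" sequentially "T - t"] t by simp
  then obtain k where "T * (2/3::real) ^ k < T - t" by (auto simp: eventually_sequentially)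
  then have "t \<le> \<tau> k" by (simp add: \<tau>_def)
  then show ?thesis using step t by blast
qed

end

context symmetric_walk begin

lemma nonneg_solution_unique:
  assumes z: "solves_det_system p orig lam T z" "\<And>t x. 0 \<le> t \<Longrightarrow> t < T \<Longrightarrow> 0 \<le> z t x"
    and w: "solves_det_system p orig lam T w" "\<And>t x. 0 \<le> t \<Longrightarrow> t < T \<Longrightarrow> 0 \<le> w t x"
    and init: "\<And>x. z 0 x = w 0 x" and lam: "0 \<le> lam" and t: "0 \<le> t" "t < T"
  shows "z t x = w t x"
proof -
  let ?Q = "\<lambda>f x. \<Sum>\<^sub>\<infinity>y. p x y * f y"
  have sol: "(\<lambda>y. p x y * f t y) summable_on UNIV"
     "((\<lambda>s. f s x) has_real_derivative (?Q (f t) x - f t x) + lam * of_bool (x = orig)) (at t within {0..<T})"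
    if f: "solves_det_system p orig lam T f" and t: "0 \<le> t" "t < T" for f t x
  proof -
    have f1: "(\<lambda>y. p x y * (f t y - f t x)) summable_on UNIV"
      and f2: "((\<lambda>s. f s x) has_real_derivative (\<Sum>\<^sub>\<infinity>y. p x y * (f t y - f t x)) + lam * of_bool (x = orig)) (at t within {0..<T})"
      using f t unfolding solves_det_system_def by auto
    have "(\<lambda>y. p x y * (f t y - f t x) + p x y * f t x) summable_on UNIV"
      by (intro summable_on_add f1 summable_on_cmult_left has_sum_imp_summable[OF p_has_sum])
    then show sm: "(\<lambda>y. p x y * f t y) summable_on UNIV" by (simp add: algebra_simps)
    have "(\<Sum>\<^sub>\<infinity>y. p x y * (f t y - f t x)) = ?Q (f t) x - f t x"
      by (rule infsumI[OF generator_has_sum[OF has_sum_infsum[OF sm]]])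
    then show "((\<lambda>s. f s x) has_real_derivative (?Q (f t) x - f t x) + lam * of_bool (x = orig)) (at t within {0..<T})"
      using f2 by simp
  qed
  define a where "a t x = exp t * (z t x + w t x)" for t x
  define a' where "a' t x = exp t * (?Q (z t) x + ?Q (w t) x + 2 * lam * of_bool (x = orig))" for t x
  define u where "u t x = exp t * (z t x - w t x)" for t x
  define u' where "u' t x = exp t * (?Q (z t) x - ?Q (w t) x)" for t x
  have Q_nn: "0 \<le> ?Q (z t) x" "0 \<le> ?Q (w t) x" if "0 \<le> t" "t < T" for t x
    using z(2)[OF that] w(2)[OF that] by (auto intro!: infsum_nonneg simp: p_nonneg)
  interpret dominated_difference p a a' u u' T
  proof
    fix t x assume t: "0 \<le> t" "t < T"
    note zs = sol[OF z(1) t] and ws = sol[OF w(1) t]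
    have zn: "0 \<le> z t y" and wn: "0 \<le> w t y" for y using z(2)[OF t] w(2)[OF t] by auto
    show "0 \<le> a t x" using zn wn by (simp add: a_def)
    show "0 \<le> a' t x" using Q_nn[OF t] lam by (simp add: a'_def)
    show "\<bar>u t x\<bar> \<le> a t x"
      unfolding u_def a_def abs_mult using zn[of x] wn[of x] by (intro mult_mono) auto
    show "((\<lambda>s. a s x) has_real_derivative a' t x) (at t within {0..<T})"
      unfolding a_def a'_def
      by (rule derivative_eq_intros zs(2) ws(2) refl | simp add: algebra_simps)+
    show "((\<lambda>s. u s x) has_real_derivative u' t x) (at t within {0..<T})"
      unfolding u_def u'_def
      by (rule derivative_eq_intros zs(2) ws(2) refl | simp add: algebra_simps)+
    have sm: "(\<lambda>y. p x y * a t y) summable_on UNIV" and Qa: "?Q (a t) x = exp t * (?Q (z t) x + ?Q (w t) x)"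
    proof -
      have hs: "((\<lambda>y. exp t * (p x y * z t y + p x y * w t y)) has_sum (exp t * (?Q (z t) x + ?Q (w t) x))) UNIV"
        by (intro has_sum_cmult_right has_sum_add has_sum_infsum zs(1) ws(1))
      have e: "(\<lambda>y. exp t * (p x y * z t y + p x y * w t y)) = (\<lambda>y. p x y * a t y)"
        by (simp add: a_def algebra_simps)
      show "(\<lambda>y. p x y * a t y) summable_on UNIV" "?Q (a t) x = exp t * (?Q (z t) x + ?Q (w t) x)"
        using hs unfolding e by (auto simp: has_sum_imp_summable infsumI)
    qed
    have ann: "0 \<le> a t y" for y using zn wn by (simp add: a_def)
    show "P (\<lambda>y. ennreal (a t y)) x \<le> ennreal (a' t x)"
      unfolding trans_op_eq_infsum[OF ann sm] Qa a'_def using lam by (intro ennreal_leI mult_left_mono) auto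
    have us: "(\<lambda>y. p x y * \<bar>u t y\<bar>) summable_on UNIV"
    proof (rule summable_on_comparison_test[OF sm])
      show "p x y * \<bar>u t y\<bar> \<le> p x y * a t y" for y
        unfolding u_def a_def abs_mult using zn[of y] wn[of y] by (intro mult_left_mono mult_mono p_nonneg) auto
    qed (simp add: p_nonneg)
    have hu: "((\<lambda>y. p x y * u t y) has_sum u' t x) UNIV"
    proof -
      have "((\<lambda>y. exp t * (p x y * z t y + (- 1) * (p x y * w t y))) has_sum (exp t * (?Q (z t) x + (- 1) * ?Q (w t) x))) UNIV"
        by (intro has_sum_cmult_right has_sum_add has_sum_infsum zs(1) ws(1))
      then show ?thesis by (simp add: u_def u'_def algebra_simps)
    qed
    have "\<bar>u' t x\<bar> \<le> ?Q (\<lambda>y. \<bar>u t y\<bar>) x"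
    proof -
      have "norm (\<Sum>\<^sub>\<infinity>y. p x y * u t y) \<le> (\<Sum>\<^sub>\<infinity>y. norm (p x y * u t y))"
        using us by (intro norm_infsum_bound) (simp add: abs_mult p_nonneg)
      then show ?thesis using infsumI[OF hu] by (simp add: abs_mult p_nonneg)
    qed
    then show "ennreal \<bar>u' t x\<bar> \<le> P (\<lambda>y. ennreal \<bar>u t y\<bar>) x"
      by (subst trans_op_eq_infsum[OF _ us]) (auto intro: ennreal_leI)
  qed
  have "u t x = 0" by (rule difference_zero) (use t init in \<open>auto simp: u_def\<close>)
  then show ?thesis by (simp add: u_def)
qed

end

section \<open>Recurrence and the Green function\<close>

lemma tendsto_integral_at_top:
  fixes f :: "real \<Rightarrow> ennreal"
  assumes [measurable]: "f \<in> borel_measurable borel"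
  shows "((\<lambda>t. \<integral>\<^sup>+s. f s * indicator {0..t} s \<partial>lborel) \<longlongrightarrow> (\<integral>\<^sup>+s. f s * indicator {0..} s \<partial>lborel)) at_top"
proof (rule order_tendstoI)
  let ?I = "\<lambda>t. \<integral>\<^sup>+s. f s * indicator {0..t} s \<partial>lborel" and ?L = "\<integral>\<^sup>+s. f s * indicator {0..} s \<partial>lborel"
  have mono: "?I s \<le> ?I t" if "s \<le> t" for s t
    using that by (intro nn_integral_mono mult_left_mono) (auto simp: indicator_def)
  have le: "?I t \<le> ?L" for t
    by (intro nn_integral_mono mult_left_mono) (auto simp: indicator_def)
  have sup: "(SUP n. ?I (real n)) = ?L"
  proof -
    have inc: "incseq (\<lambda>n s. f s * indicator {0..real n} s)"
      by (auto simp: incseq_def le_fun_def indicator_def)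
    have "(SUP n. f s * indicator {0..real n} s) = f s * indicator {0..} s" for s
    proof (rule antisym)
      show "(SUP n. f s * indicator {0..real n} s) \<le> f s * indicator {0..} s"
        by (rule SUP_least) (auto simp: indicator_def)
      obtain n where "s \<le> real n" using real_arch_simple by blast
      then show "f s * indicator {0..} s \<le> (SUP n. f s * indicator {0..real n} s)"
        by (intro SUP_upper2[of n]) (auto simp: indicator_def)
    qed
    then show ?thesis using nn_integral_monotone_convergence_SUP[OF inc, of lborel] by simp
  qed
  fix a
  { assume "a < ?L"
    then obtain n where n: "a < ?I (real n)" unfolding sup[symmetric] less_SUP_iff by blast
    show "eventually (\<lambda>t. a < ?I t) at_top"
      using eventually_ge_at_top[of "real n"] by eventually_elim (use n mono less_le_trans in blast) }
  { assume "?L < a"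
    then show "eventually (\<lambda>t. ?I t < a) at_top"
      using le by (intro always_eventually) (auto intro: le_less_trans) }
qed

lemma nn_integral_poisson_weight:
  "(\<integral>\<^sup>+s. ennreal (exp (- s) * s ^ n / fact n) * indicator {0..} s \<partial>lborel) = 1"
proof -
  have "(\<integral>\<^sup>+s. ennreal (exp (- s) * s ^ n / fact n) * indicator {0..} s \<partial>lborel) =
     (\<integral>\<^sup>+s. ennreal (erlang_density n 1 s * s ^ 0) \<partial>lborel)"
    by (intro nn_integral_cong) (auto simp: erlang_density_def indicator_def mult.commute)
  also have "\<dots> = 1"
    by (subst nn_integral_erlang_ith_moment) simp_all
  finally show ?thesis .
qed

context symmetric_walk begin

definition green :: "'v \<Rightarrow> 'v \<Rightarrow> ennreal" where
  "green x y = (\<Sum>n. (P ^^ n) (point y) x)"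

lemma green_eq_integral: "(\<integral>\<^sup>+s. heat p s (point y) x * indicator {0..} s \<partial>lborel) = green x y"
proof -
  have "(\<integral>\<^sup>+s. heat p s (point y) x * indicator {0..} s \<partial>lborel) =
     (\<integral>\<^sup>+s. (\<Sum>n. ennreal (exp (- s) * s ^ n / fact n) * indicator {0..} s * (P ^^ n) (point y) x) \<partial>lborel)"
    unfolding heat_def by (subst ennreal_suminf_multc[symmetric]) (simp only: mult_ac)
  also have "\<dots> = (\<Sum>n. \<integral>\<^sup>+s. ennreal (exp (- s) * s ^ n / fact n) * indicator {0..} s * (P ^^ n) (point y) x \<partial>lborel)"
    by (rule nn_integral_suminf) measurable
  also have "\<dots> = green x y"
    unfolding green_def by (subst nn_integral_multc) (simp_all add: nn_integral_poisson_weight)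
  finally show ?thesis .
qed

lemma green_tendsto: "((\<lambda>t. \<integral>\<^sup>+s. heat p s (point y) x * indicator {0..t} s \<partial>lborel) \<longlongrightarrow> green x y) at_top"
  unfolding green_eq_integral[symmetric] by (rule tendsto_integral_at_top) measurable

lemma green_step: "green x y = point y x + P (\<lambda>x. green x y) x"
proof -
  have "green x y = (P ^^ 0) (point y) x + (\<Sum>n. (P ^^ Suc n) (point y) x)"
    unfolding green_def using suminf_offset[of "\<lambda>n. (P ^^ n) (point y) x" 1] by (simp add: summableI add.commute)
  also have "(\<Sum>n. (P ^^ Suc n) (point y) x) = P (\<lambda>x. green x y) x"
    unfolding green_def trans_op_suminf by simp
  finally show ?thesis by simp
qed

text \<open>By irreducibility every value of the Green function dominates a positive multiple of every other one.\<close>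

lemma green_infinite_everywhere:
  assumes "green x y = \<infinity>"
  shows "green x' y' = \<infinity>"
proof -
  obtain a where a: "(P ^^ a) (point x) x' > 0" using irreducible by blast
  obtain b where b: "(P ^^ b) (point y') y > 0" using irreducible by blast
  let ?c = "(P ^^ b) (point y') y" and ?d = "(P ^^ a) (point x) x'"
  have step: "f x * (P ^^ n) (point x) z \<le> (P ^^ n) f z" for f x n z
    using trans_op_iter_mono[of "\<lambda>w. f x * point x w" f n p z]
    by (simp add: trans_op_iter_cmult of_bool_def)
  have "?c * ?d * (P ^^ n) (point y) x \<le> (P ^^ (a + n + b)) (point y') x'" for n
  proof -
    have 1: "?c * (P ^^ n) (point y) x \<le> (P ^^ n) ((P ^^ b) (point y')) x"
      by (rule step)
    have "?c * ?d * (P ^^ n) (point y) x = (?c * (P ^^ n) (point y) x) * ?d" by (simp add: mult_ac)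
    also have "\<dots> \<le> (P ^^ n) ((P ^^ b) (point y')) x * ?d" by (rule mult_right_mono[OF 1]) simp
    also have "\<dots> \<le> (P ^^ a) ((P ^^ n) ((P ^^ b) (point y'))) x'" by (rule step)
    finally show ?thesis by (simp add: funpow_add)
  qed
  then have "(\<Sum>n. ?c * ?d * (P ^^ n) (point y) x) \<le> (\<Sum>n. (P ^^ (a + n + b)) (point y') x')"
    by (intro suminf_le) auto
  also have "\<dots> = (\<Sum>n. (P ^^ (n + (a + b))) (point y') x')" by (simp add: add_ac)
  also have "\<dots> \<le> green x' y'"
    unfolding green_def using suminf_offset[of "\<lambda>n. (P ^^ n) (point y') x'" "a + b"] by (simp add: summableI)
  finally have "?c * ?d * green x y \<le> green x' y'" unfolding green_def by simp
  then show ?thesis using assms a b by (auto simp: ennreal_mult_top top_unique split: if_splits)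
qed

text \<open>The Markov property for random maps: from step \<open>n\<close> on, fresh maps drive the chain started at its position
  at step \<open>n\<close>.\<close>

lemma skeleton_comb_seq:
  "m \<le> n \<Longrightarrow> skeleton x (comb_seq n U V) m = skeleton x U m"
  "skeleton x (comb_seq n U V) (n + m) = skeleton (skeleton x U n) V m"
proof -
  show 1: "m \<le> n \<Longrightarrow> skeleton x (comb_seq n U V) m = skeleton x U m" for m
    by (induction m) (simp_all add: comb_seq_less)
  show "skeleton x (comb_seq n U V) (n + m) = skeleton (skeleton x U n) V m"
    by (induction m) (use 1[of n] comb_seq_add[of n U V] in \<open>simp_all add: add.commute\<close>)
qed

lemma sets_visit: "{U\<in>space U_space. skeleton x U k = x} \<in> sets U_space"
  using measurable_sets[OF measurable_skeleton, of "{x}" x k] by (simp add: vimage_def Int_def conj_commute)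

text \<open>The event splits into a condition on the first \<open>n\<close> maps and a condition on an independent copy of the
  sequence.\<close>

lemma last_visit_probability:
  "emeasure U_space {U\<in>space U_space. skeleton x U n = x \<and> (\<forall>m\<ge>1. skeleton x U (n + m) \<noteq> x)} =
   (P ^^ n) (point x) x * emeasure U_space {U\<in>space U_space. \<forall>m\<ge>1. skeleton x U m \<noteq> x}"
proof -
  let ?A = "{U\<in>space U_space. skeleton x U n = x \<and> (\<forall>m\<ge>1. skeleton x U (n + m) \<noteq> x)}"
  let ?B = "{U\<in>space U_space. \<forall>m\<ge>1. skeleton x U m \<noteq> x}"
  have ne: "{U\<in>space U_space. skeleton x U k \<noteq> x} \<in> sets U_space" for k
    using sets.sets_Collect_neg[OF sets_visit] .
  have A: "?A \<in> sets U_space" and B: "?B \<in> sets U_space"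
    by (intro sets.sets_Collect_conj sets.sets_Collect_countable_All sets.sets_Collect_imp sets_visit ne sets.sets_Collect_const)+
  have comb: "(\<lambda>(U, V). comb_seq n U V) \<in> U_space \<Otimes>\<^sub>M U_space \<rightarrow>\<^sub>M U_space"
    by (rule measurable_comb_seq)
  have "emeasure U_space ?A = emeasure (distr (U_space \<Otimes>\<^sub>M U_space) U_space (\<lambda>(U, V). comb_seq n U V)) ?A"
    by (subst U.PiM_comb_seq) simp
  also have "\<dots> = emeasure (U_space \<Otimes>\<^sub>M U_space) ((\<lambda>(U, V). comb_seq n U V) -` ?A \<inter> space (U_space \<Otimes>\<^sub>M U_space))"
    by (rule emeasure_distr[OF comb A])
  also have "(\<lambda>(U, V). comb_seq n U V) -` ?A \<inter> space (U_space \<Otimes>\<^sub>M U_space) = {U\<in>space U_space. skeleton x U n = x} \<times> ?B"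
    using measurable_space[OF comb] by (auto simp: space_pair_measure skeleton_comb_seq)
  also have "emeasure (U_space \<Otimes>\<^sub>M U_space) \<dots> = emeasure U_space {U\<in>space U_space. skeleton x U n = x} * emeasure U_space ?B"
    by (rule U.P.emeasure_pair_measure_Times[OF sets_visit B])
  also have "emeasure U_space {U\<in>space U_space. skeleton x U n = x} = (P ^^ n) (point x) x"
  proof -
    have "(P ^^ n) (point x) x = (\<integral>\<^sup>+U. indicator {U\<in>space U_space. skeleton x U n = x} U \<partial>U_space)"
      unfolding nn_integral_skeleton[symmetric] by (intro nn_integral_cong) (auto simp: indicator_def)
    then show ?thesis using sets_visit by simp
  qed
  finally show ?thesis .
qed

text \<open>The events that the last visit to \<open>x\<close> happens at step \<open>n\<close> are disjoint, and their probabilities sum to the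
  Green function times the probability of never returning. An infinite Green function therefore forces the
  latter to be 0, and with it the probability that a last visit exists.\<close>

lemma AE_infinitely_many_visits:
  assumes "green x x = \<infinity>"
  shows "AE U in U_space. infinite {n. skeleton x U n = x}"
proof -
  let ?A = "\<lambda>n. {U\<in>space U_space. skeleton x U n = x \<and> (\<forall>m\<ge>1. skeleton x U (n + m) \<noteq> x)}"
  let ?e = "emeasure U_space {U\<in>space U_space. \<forall>m\<ge>1. skeleton x U m \<noteq> x}"
  have A: "?A n \<in> sets U_space" for n
    by (intro sets.sets_Collect_conj sets.sets_Collect_countable_All sets.sets_Collect_imp sets_visit sets.sets_Collect_neg sets.sets_Collect_const)
  have disj: "disjoint_family ?A"
    unfolding disjoint_family_on_def
  proof safe
    fix m n :: nat and U assume "m \<noteq> n"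
      and m: "skeleton x U m = x" "\<forall>k\<ge>1. skeleton x U (m + k) \<noteq> x"
      and n: "skeleton x U n = x" "\<forall>k\<ge>1. skeleton x U (n + k) \<noteq> x"
    show "U \<in> {}"
    proof (cases "m < n")
      case True
      then have "1 \<le> n - m" "m + (n - m) = n" by auto
      then show ?thesis using m(2) n(1) by metis
    next
      case False
      then have "1 \<le> m - n" "n + (m - n) = m" using \<open>m \<noteq> n\<close> by auto
      then show ?thesis using n(2) m(1) by metis
    qed
  qed
  have "green x x * ?e = (\<Sum>n. emeasure U_space (?A n))"
    unfolding green_def last_visit_probability by simp
  also have "\<dots> = emeasure U_space (\<Union>n. ?A n)"
    using A disj by (intro suminf_emeasure) auto
  also have "\<dots> \<le> 1" by (rule U.P.emeasure_le_1)
  finally have "?e = 0"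
    using assms by (auto simp: ennreal_top_mult top_unique split: if_splits)
  then have "emeasure U_space (?A n) = 0" for n
    unfolding last_visit_probability by simp
  then have "AE U in U_space. U \<notin> ?A n" for n
    using A by (intro AE_not_in) auto
  then have "AE U in U_space. \<forall>n. U \<notin> ?A n" unfolding AE_all_countable by blast
  then show ?thesis using AE_space
  proof (eventually_elim, intro notI)
    fix U assume U: "\<forall>n. U \<notin> ?A n" "U \<in> space U_space" and fin: "finite {n. skeleton x U n = x}"
    have "0 \<in> {n. skeleton x U n = x}" by simp
    then have ne: "{n. skeleton x U n = x} \<noteq> {}" by blast
    let ?N = "Max {n. skeleton x U n = x}"
    have "skeleton x U ?N = x" using Max_in[OF fin ne] by simp
    moreover have "skeleton x U (?N + m) \<noteq> x" if "m \<ge> 1" for m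
    proof
      assume "skeleton x U (?N + m) = x"
      then have "?N + m \<le> ?N" using Max_ge[OF fin, of "?N + m"] by simp
      then show False using that by simp
    qed
    ultimately show False using U by blast
  qed
qed

text \<open>The Green function is the mean number of visits.\<close>

lemma AE_finitely_many_visits:
  assumes "green x x < \<infinity>"
  shows "AE U in U_space. finite {n. skeleton x U n = x}"
proof -
  have pm: "(\<lambda>U. point x (skeleton x U n)) \<in> borel_measurable U_space" for n
    by (rule measurable_compose[OF measurable_skeleton]) simp
  have "(\<integral>\<^sup>+U. (\<Sum>n. point x (skeleton x U n)) \<partial>U_space) = green x x"
    unfolding green_def nn_integral_skeleton[symmetric] by (rule nn_integral_suminf[OF pm])
  then have "AE U in U_space. (\<Sum>n. point x (skeleton x U n)) \<noteq> \<infinity>"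
    using assms by (intro nn_integral_PInf_AE borel_measurable_suminf pm) auto
  then show ?thesis
  proof eventually_elim
    case (elim U)
    show ?case
    proof (rule ccontr)
      assume inf: "infinite {n. skeleton x U n = x}"
      have "of_nat k \<le> (\<Sum>n. point x (skeleton x U n))" for k
      proof -
        obtain F where F: "F \<subseteq> {n. skeleton x U n = x}" "finite F" "card F = k"
          using infinite_arbitrarily_large[OF inf] by blast
        have "of_nat k = (\<Sum>n\<in>F. point x (skeleton x U n))"
        proof -
          have "(\<Sum>n\<in>F. point x (skeleton x U n)) = (\<Sum>n\<in>F. 1)"
            by (rule sum.cong) (use F in auto)
          then show ?thesis using F by simp
        qed
        also have "\<dots> \<le> (\<Sum>n. point x (skeleton x U n))"
          by (rule sum_le_suminf) (auto intro: summableI F)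
        finally show ?thesis .
      qed
      then have "(\<Sum>n. point x (skeleton x U n)) = \<top>"
        by (metis ennreal_SUP_of_nat_eq_top SUP_least top_unique)
      then show False using elim by simp
    qed
  qed
qed

lemma AE_walk_space_fst: "AE U in U_space. Q U \<Longrightarrow> AE \<omega> in walk_space p. Q (fst \<omega>)"
  and AE_walk_space_snd: "AE E in clocks. R E \<Longrightarrow> AE \<omega> in walk_space p. R (snd \<omega>)"
proof -
  interpret pair_prob_space U_space clocks ..
  have f: "distr (U_space \<Otimes>\<^sub>M clocks) U_space fst = U_space"
    by (rule clocks.P.distr_pair_fst)
  have s: "distr (U_space \<Otimes>\<^sub>M clocks) clocks snd = clocks"
  proof (rule measure_eqI)
    fix A assume A: "A \<in> sets (distr (U_space \<Otimes>\<^sub>M clocks) clocks snd)"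
    then have "emeasure (distr (U_space \<Otimes>\<^sub>M clocks) clocks snd) A = emeasure (U_space \<Otimes>\<^sub>M clocks) (space U_space \<times> A)"
      by (auto simp: emeasure_distr space_pair_measure dest: sets.sets_into_space intro!: arg_cong2[where f = emeasure])
    then show "emeasure (distr (U_space \<Otimes>\<^sub>M clocks) clocks snd) A = emeasure clocks A"
      using A by (simp add: clocks.P.emeasure_pair_measure_Times U.P.emeasure_space_1)
  qed simp
  show "AE U in U_space. Q U \<Longrightarrow> AE \<omega> in walk_space p. Q (fst \<omega>)"
    unfolding walk_space_eq by (rule AE_distrD[OF measurable_fst]) (simp only: f)
  show "AE E in clocks. R E \<Longrightarrow> AE \<omega> in walk_space p. R (snd \<omega>)"
    unfolding walk_space_eq by (rule AE_distrD[OF measurable_snd]) (simp only: s)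
qed

lemma rings_at_ring_time:
  assumes E: "regular_clock E"
  shows "rings E (ring_time E n) = Suc n"
proof -
  have "k < rings E (ring_time E n) \<longleftrightarrow> k < Suc n" for k
    unfolding ring_time_le_iff[OF E, symmetric]
    using ring_time_strict_mono[OF E, of k n] ring_time_strict_mono[OF E, of n k]
    by (cases k n rule: linorder_cases) auto
  then show ?thesis by (metis linorder_neqE_nat less_irrefl)
qed

text \<open>For a regular clock, the chain sits at its position of step \<open>n\<close> from the \<open>n\<close>-th ring on, and the ring times
  tend to infinity.\<close>

lemma visits_unbounded_iff:
  assumes E: "regular_clock E"
  shows "bdd_above {t. 0 \<le> t \<and> walk x (U, E) t = x} \<longleftrightarrow> finite {n. skeleton x U n = x}"
proof
  assume fin: "finite {n. skeleton x U n = x}"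
  show "bdd_above {t. 0 \<le> t \<and> walk x (U, E) t = x}"
  proof (rule bdd_aboveI)
    fix t assume t: "t \<in> {t. 0 \<le> t \<and> walk x (U, E) t = x}"
    let ?N = "Max {n. skeleton x U n = x}"
    have "skeleton x U (rings E t) = x" using t unfolding walk_def by simp
    then have "rings E t \<in> {n. skeleton x U n = x}" by (rule CollectI)
    then have "rings E t \<le> ?N" by (rule Max_ge[OF fin])
    then have "\<not> ?N < rings E t" by (rule leD)
    then have "\<not> ring_time E ?N \<le> t"
      by (rule contrapos_nn) (rule ring_time_le_iff[OF E, THEN iffD1])
    then show "t \<le> ring_time E ?N" by (rule less_imp_le[OF not_le_imp_less])
  qed
next
  assume "bdd_above {t. 0 \<le> t \<and> walk x (U, E) t = x}"
  then obtain B where B: "\<And>t. 0 \<le> t \<Longrightarrow> walk x (U, E) t = x \<Longrightarrow> t \<le> B"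
    by (auto simp: bdd_above_def)
  have "n \<le> Suc (rings E B)" if n: "skeleton x U n = x" for n
  proof (cases n)
    case (Suc m)
    have "0 \<le> ring_time E m" using E by (intro sum_nonneg) (auto simp: regular_clock_def less_imp_le)
    moreover have "walk x (U, E) (ring_time E m) = x"
      using n Suc rings_at_ring_time[OF E, of m] by (simp only: walk_def fst_conv snd_conv)
    ultimately have "ring_time E m \<le> B" by (rule B)
    then have "m < rings E B" by (rule ring_time_le_iff[OF E, THEN iffD1])
    then show ?thesis using Suc by linarith
  next
    case 0
    then show ?thesis by linarith
  qed
  then have "{n. skeleton x U n = x} \<subseteq> {..Suc (rings E B)}" by blast
  then show "finite {n. skeleton x U n = x}"
    by (rule finite_subset[OF _ finite_atMost])
qed

theorem recurrent_iff_green_infinite: "rw_recurrent p \<longleftrightarrow> green x y = \<infinity>"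
proof
  assume "green x y = \<infinity>"
  then have G: "green z z = \<infinity>" for z by (rule green_infinite_everywhere)
  show "rw_recurrent p"
    unfolding rw_recurrent_def
  proof
    fix z
    have visits: "AE \<omega> in walk_space p. infinite {n. skeleton z (fst \<omega>) n = z}"
      by (rule AE_walk_space_fst[OF AE_infinitely_many_visits[OF G]])
    have clock: "AE \<omega> in walk_space p. regular_clock (snd \<omega>)"
      by (rule AE_walk_space_snd[OF AE_regular_clock])
    from visits clock show "AE \<omega> in walk_space p. \<not> bdd_above {t. 0 \<le> t \<and> walk z \<omega> t = z}"
    proof eventually_elim
      case (elim \<omega>)
      then show ?case using visits_unbounded_iff[of "snd \<omega>" z "fst \<omega>"] by simp
    qed
  qed
next
  assume rec: "rw_recurrent p"
  show "green x y = \<infinity>"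
  proof (rule ccontr)
    assume "green x y \<noteq> \<infinity>"
    then have "green x x < \<infinity>"
      using green_infinite_everywhere[of x x x y] by (auto simp: less_top[symmetric])
    then have visits: "AE \<omega> in walk_space p. finite {n. skeleton x (fst \<omega>) n = x}"
      by (intro AE_walk_space_fst AE_finitely_many_visits)
    have clock: "AE \<omega> in walk_space p. regular_clock (snd \<omega>)"
      by (rule AE_walk_space_snd[OF AE_regular_clock])
    have unbounded: "AE \<omega> in walk_space p. \<not> bdd_above {t. 0 \<le> t \<and> walk x \<omega> t = x}"
      using rec unfolding rw_recurrent_def by blast
    from visits clock unbounded have "AE \<omega> in walk_space p. False"
    proof eventually_elim
      case (elim \<omega>)
      then show ?case using visits_unbounded_iff[of "snd \<omega>" x "fst \<omega>"] by simp
    qed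
    then show False using prob_space.AE_False[OF prob_space_walk_space] by simp
  qed
qed

end

section \<open>Weak convergence of Poisson product laws\<close>

text \<open>Cylinders that fix finitely many coordinates form a countable base of the topology, and they are
  measurable.\<close>

lemma measurable_continuous_discrete_product:
  fixes f :: "('v::countable \<Rightarrow> enat) \<Rightarrow> real"
  assumes f: "continuous_map (product_topology (\<lambda>_. discrete_topology UNIV) UNIV) euclideanreal f"
  shows "f \<in> borel_measurable config_space"
proof (rule borel_measurableI)
  fix S :: "real set" assume "open S"
  let ?cyl = "\<lambda>l :: ('v \<times> enat) list. {\<eta>. \<forall>(x, n)\<in>set l. \<eta> x = n}"
  have op: "openin (product_topology (\<lambda>_::'v. discrete_topology (UNIV :: enat set)) UNIV) (f -` S)"
    using openin_continuous_map_preimage[OF f, of S] \<open>open S\<close> by (simp add: vimage_def)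
  have "\<exists>l. \<eta> \<in> ?cyl l \<and> ?cyl l \<subseteq> f -` S" if e: "\<eta> \<in> f -` S" for \<eta>
  proof -
    have "\<forall>\<eta>\<in>f -` S. \<exists>U. finite {i. U i \<noteq> (UNIV :: enat set)} \<and> \<eta> \<in> Pi\<^sub>E UNIV U \<and> Pi\<^sub>E UNIV U \<subseteq> f -` S"
      using op unfolding openin_product_topology_alt by simp
    then obtain U where U: "finite {i. U i \<noteq> (UNIV :: enat set)}" "\<eta> \<in> Pi\<^sub>E UNIV U" "Pi\<^sub>E UNIV U \<subseteq> f -` S"
      using e by blast
    obtain xs where xs: "set xs = {i. U i \<noteq> (UNIV :: enat set)}" using finite_list[OF U(1)] by blast
    let ?l = "map (\<lambda>x. (x, \<eta> x)) xs"
    have "?cyl ?l \<subseteq> Pi\<^sub>E UNIV U"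
    proof
      fix \<zeta> assume z: "\<zeta> \<in> ?cyl ?l"
      have "\<zeta> x \<in> U x" for x
      proof (cases "U x = UNIV")
        case False
        then have "x \<in> set xs" using xs by simp
        then have "\<zeta> x = \<eta> x" using z by auto
        then show ?thesis using U(2) by (auto simp: PiE_iff)
      qed simp
      then show "\<zeta> \<in> Pi\<^sub>E UNIV U" by (auto simp: PiE_iff)
    qed
    then show ?thesis using U(3) by (intro exI[of _ ?l]) auto
  qed
  then have eq: "f -` S = (\<Union>l\<in>{l. ?cyl l \<subseteq> f -` S}. ?cyl l)" by blast
  have cyl: "?cyl l \<in> sets config_space" for l
  proof (induction l)
    case Nil
    have "{\<eta> :: 'v \<Rightarrow> enat. True} = space config_space" by (auto simp: space_PiM)
    then have "{\<eta> :: 'v \<Rightarrow> enat. True} \<in> sets config_space" by (simp only: sets.top)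
    then show ?case by simp
  next
    case (Cons q l)
    have "{\<eta> \<in> space config_space. \<eta> (fst q) = snd q} \<in> sets config_space"
      using measurable_sets[OF measurable_component_singleton[of "fst q" UNIV "\<lambda>_. count_space UNIV", OF UNIV_I], of "{snd q}"]
      by (simp add: vimage_def Int_def conj_commute)
    then have "{\<eta> \<in> space config_space. \<eta> (fst q) = snd q} \<inter> ?cyl l \<in> sets config_space"
      using Cons by (rule sets.Int)
    moreover have "?cyl (q # l) = {\<eta> \<in> space config_space. \<eta> (fst q) = snd q} \<inter> ?cyl l"
      by (auto simp: space_PiM)
    ultimately show ?case by (simp only:)
  qed
  have "(\<Union>l\<in>{l. ?cyl l \<subseteq> f -` S}. ?cyl l) \<in> sets config_space"
    by (rule sets.countable_UN') (use cyl in auto)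
  then show "f -` S \<inter> space config_space \<in> sets config_space"
    unfolding eq[symmetric] by (simp add: space_PiM)
qed

lemma continuous_discrete_product_tendsto:
  fixes f :: "('v \<Rightarrow> enat) \<Rightarrow> real"
  assumes f: "continuous_map (product_topology (\<lambda>_. discrete_topology UNIV) UNIV) euclideanreal f"
    and ev: "\<And>x. eventually (\<lambda>t. \<eta> t x = \<zeta> x) F"
  shows "((\<lambda>t. f (\<eta> t)) \<longlongrightarrow> f \<zeta>) F"
proof -
  have "limitin (product_topology (\<lambda>_. discrete_topology UNIV) UNIV) \<eta> \<zeta> F"
    unfolding limitin_componentwise
  proof (intro conjI ballI)
    fix x
    show "limitin (discrete_topology UNIV) (\<lambda>t. \<eta> t x) (\<zeta> x) F"
      unfolding limitin_def using eventually_mono[OF ev[of x]] by auto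
  qed auto
  from continuous_map_limit[OF f this] show ?thesis by (simp add: o_def)
qed

lemma AE_ring_time_neq: "AE E in clocks. ring_time E n \<noteq> c"
proof -
  have m: "(\<lambda>E. ring_time E n) \<in> clocks \<rightarrow>\<^sub>M lborel"
    and d: "distr clocks lborel (\<lambda>E. ring_time E n) = density lborel (erlang_density n 1)"
    using ring_time_distributed[of n] unfolding distributed_def by auto
  have "AE x in lborel. x \<noteq> c" by (rule AE_lborel_singleton)
  then have "AE x in density lborel (\<lambda>x. ennreal (erlang_density n 1 x)). x \<noteq> c"
    by (subst AE_density) (auto elim!: eventually_mono)
  then show ?thesis
    using AE_distrD[OF m, of "\<lambda>x. x \<noteq> c"] unfolding d by blast
qed

text \<open>The number of rings is locally constant away from the ring times.\<close>

lemma rings_eventually_eq: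
  assumes E: "regular_clock E" and ne: "\<And>n. ring_time E n \<noteq> R"
    and r: "(r \<longlongrightarrow> R) F" "\<And>t. r t \<le> R"
  shows "eventually (\<lambda>t. rings E (r t) = rings E R) F"
proof -
  let ?N = "rings E R"
  have upper: "rings E (r t) \<le> ?N" for t
  proof (rule ccontr)
    assume "\<not> rings E (r t) \<le> ?N"
    then have "?N < rings E (r t)" by simp
    then have "ring_time E ?N \<le> r t" by (rule ring_time_le_iff[OF E, THEN iffD2])
    then have "ring_time E ?N \<le> R" using r(2)[of t] by linarith
    then have "?N < ?N" by (rule ring_time_le_iff[OF E, THEN iffD1])
    then show False by simp
  qed
  show ?thesis
  proof (cases ?N)
    case 0
    have "rings E (r t) = rings E R" for t
      using upper[of t] unfolding 0 by (rule le_0_eq[THEN iffD1])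
    then show ?thesis by (intro always_eventually allI)
  next
    case (Suc m)
    have "ring_time E m \<le> R"
      by (rule ring_time_le_iff[OF E, THEN iffD2]) (unfold Suc, simp)
    then have "ring_time E m < R" using ne[of m] by linarith
    then have "eventually (\<lambda>t. ring_time E m < r t) F"
      by (rule order_tendstoD(1)[OF r(1)])
    then show ?thesis
    proof eventually_elim
      case (elim t)
      then have "ring_time E m \<le> r t" by (rule less_imp_le)
      then have "m < rings E (r t)" by (rule ring_time_le_iff[OF E, THEN iffD1])
      then show ?case using upper[of t] Suc by linarith
    qed
  qed
qed

abbreviation clock_field :: "('v \<Rightarrow> nat \<Rightarrow> real) measure" where
  "clock_field \<equiv> \<Pi>\<^sub>M x\<in>UNIV. clocks"

text \<open>All densities use the same clocks; this coupling turns convergence of densities into almost sure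
  convergence of configurations.\<close>

definition counts :: "('v \<Rightarrow> real) \<Rightarrow> ('v \<Rightarrow> nat \<Rightarrow> real) \<Rightarrow> 'v \<Rightarrow> enat" where
  "counts r \<omega> x = enat (rings (\<omega> x) (r x))"

lemma measurable_counts:
  fixes r :: "'v \<Rightarrow> real"
  shows "counts r \<in> clock_field \<rightarrow>\<^sub>M config_space"
proof (rule measurable_PiM_single')
  fix x :: 'v
  have "(\<lambda>\<omega>. rings (\<omega> x) (r x)) \<in> clock_field \<rightarrow>\<^sub>M count_space UNIV"
    by (rule measurable_compose[OF measurable_component_singleton[of x UNIV "\<lambda>_. clocks", OF UNIV_I] measurable_rings])
  then show "(\<lambda>\<omega>. counts r \<omega> x) \<in> clock_field \<rightarrow>\<^sub>M count_space UNIV"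
    unfolding counts_def by (rule measurable_compose) simp
qed auto

lemma prob_space_clock_field: "prob_space clock_field"
  by (intro prob_space_PiM clocks.P.prob_space_axioms)

lemma distr_counts:
  fixes r :: "'v \<Rightarrow> real"
  assumes r: "\<And>x. 0 \<le> r x"
  shows "distr clock_field config_space (counts r) = poisson_product (\<lambda>x. ennreal (r x))"
proof (rule config_measure_eqI)
  show "prob_space (distr clock_field config_space (counts r))"
    by (rule prob_space.prob_space_distr[OF prob_space_clock_field measurable_counts])
  fix J :: "'v set" and s :: "'v \<Rightarrow> real"
  assume J: "finite J" and s: "\<And>x. 0 \<le> s x \<and> s x < 1"
  have one: "(\<integral>\<^sup>+E. ennreal (s x ^ rings E (r x)) \<partial>clocks) = ennreal (exp (- (1 - s x) * r x))" for x
  proof -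
    have "(\<integral>\<^sup>+E. ennreal (s x ^ rings E (r x)) \<partial>clocks) = (\<Sum>n. ennreal (exp (- r x) * r x ^ n / fact n) * ennreal (s x ^ n))"
      by (rule nn_integral_rings[OF r])
    also have "\<dots> = (\<Sum>n. ennreal (exp (- r x) * r x ^ n / fact n * s x ^ n))"
      using r[of x] s[of x] by (simp add: ennreal_mult[symmetric])
    also have "\<dots> = ennreal (exp (- (1 - s x) * r x))"
      by (rule suminf_ennreal_eq[OF _ poisson_pgf_sums]) (use r[of x] s[of x] in simp)
    finally show ?thesis .
  qed
  have "(\<integral>\<^sup>+\<eta>. ennreal (\<Prod>x\<in>J. epow (s x) (\<eta> x)) \<partial>distr clock_field config_space (counts r)) =
     (\<integral>\<^sup>+\<omega>. ennreal (\<Prod>x\<in>J. epow (s x) (counts r \<omega> x)) \<partial>clock_field)"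
    by (rule nn_integral_distr[OF measurable_counts]) (simp add: measurable_prod_epow)
  also have "\<dots> = (\<integral>\<^sup>+\<omega>. (\<Prod>x\<in>J. ennreal (s x ^ rings (\<omega> x) (r x))) \<partial>clock_field)"
    using s by (simp add: counts_def prod_ennreal)
  also have "\<dots> = (\<Prod>x\<in>J. \<integral>\<^sup>+E. ennreal (s x ^ rings E (r x)) \<partial>clocks)"
  proof (rule nn_integral_PiM_prod[OF clocks.P.prob_space_axioms J])
    show "(\<lambda>E. ennreal (s x ^ rings E (r x))) \<in> borel_measurable clocks" for x
      by (rule measurable_compose[OF measurable_rings]) simp
  qed
  also have "\<dots> = ennreal (nexp (\<Sum>x\<in>J. ennreal (1 - s x) * ennreal (r x)))"
  proof -
    have "exp (- (1 - s x) * r x) = nexp (ennreal (1 - s x) * ennreal (r x))" for x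
    proof -
      have "0 \<le> 1 - s x" using s[of x] by simp
      then have "nexp (ennreal (1 - s x) * ennreal (r x)) = exp (- ((1 - s x) * r x))"
        using r[of x] by (simp only: ennreal_mult[symmetric] nexp_ennreal mult_nonneg_nonneg)
      then show ?thesis by (simp only: minus_mult_left)
    qed
    then show ?thesis
      unfolding one nexp_sum[OF J] by (simp only:) (rule prod_ennreal, rule nexp_bounds)
  qed
  also have "\<dots> = (\<integral>\<^sup>+\<eta>. ennreal (\<Prod>x\<in>J. epow (s x) (\<eta> x)) \<partial>poisson_product (\<lambda>x. ennreal (r x)))"
    by (rule poisson_product_pgf[OF J, symmetric]) (use s in \<open>auto simp: less_imp_le\<close>)
  finally show "(\<integral>\<^sup>+\<eta>. ennreal (\<Prod>x\<in>J. epow (s x) (\<eta> x)) \<partial>distr clock_field config_space (counts r)) =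
     (\<integral>\<^sup>+\<eta>. ennreal (\<Prod>x\<in>J. epow (s x) (\<eta> x)) \<partial>poisson_product (\<lambda>x. ennreal (r x)))" .
qed (simp_all add: prob_space_poisson_product sets_poisson_product)

text \<open>Almost surely, no limiting density \<open>R x\<close> is a ring time of its clock. Then every coordinate of the coupled
  configurations is eventually equal to its limit, which is convergence in the product of discrete topologies.\<close>

theorem poisson_product_converges_weakly:
  fixes r :: "real \<Rightarrow> 'v::countable \<Rightarrow> real"
  assumes r: "\<And>t x. 0 \<le> r t x" "\<And>t x. r t x \<le> R x" "\<And>x. ((\<lambda>t. r t x) \<longlongrightarrow> R x) at_top"
  shows "converges_weakly (\<lambda>t. poisson_product (\<lambda>x. ennreal (r t x))) (poisson_product (\<lambda>x. ennreal (R x)))"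
  unfolding converges_weakly_def
proof (intro allI impI, elim conjE)
  fix f :: "('v \<Rightarrow> enat) \<Rightarrow> real"
  assume f: "continuous_map (product_topology (\<lambda>_. discrete_topology UNIV) UNIV) euclideanreal f"
    and "bounded (range f)"
  then obtain B where B: "\<And>\<eta>. norm (f \<eta>) \<le> B" by (auto simp: bounded_iff)
  let ?C = "config_space"
  interpret field: prob_space "clock_field :: ('v \<Rightarrow> nat \<Rightarrow> real) measure" by (rule prob_space_clock_field)
  have R: "0 \<le> R x" for x using order_trans[OF r(1,2)] .
  have fm: "f \<in> borel_measurable ?C" by (rule measurable_continuous_discrete_product[OF f])
  have int: "(\<integral>\<eta>. f \<eta> \<partial>poisson_product (\<lambda>x. ennreal (q x))) = (\<integral>\<omega>. f (counts q \<omega>) \<partial>clock_field)"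
    if "\<And>x. 0 \<le> q x" for q
    unfolding distr_counts[OF that, symmetric] by (rule integral_distr[OF measurable_counts fm])
  have AE: "AE \<omega> in clock_field. \<forall>x. regular_clock (\<omega> x) \<and> (\<forall>n. ring_time (\<omega> x) n \<noteq> R x)"
  proof -
    have "AE \<omega> in clock_field. regular_clock (\<omega> x) \<and> (\<forall>n. ring_time (\<omega> x) n \<noteq> R x)" for x :: 'v
    proof (rule AE_PiM_component)
      show "AE E in clocks. regular_clock E \<and> (\<forall>n. ring_time E n \<noteq> R x)"
        using AE_regular_clock AE_ring_time_neq by (simp add: AE_all_countable)
    qed (auto intro: clocks.P.prob_space_axioms)
    then show ?thesis by (simp add: AE_all_countable)
  qed
  have "((\<lambda>t. \<integral>\<omega>. f (counts (r t) \<omega>) \<partial>clock_field) \<longlongrightarrow> (\<integral>\<omega>. f (counts R \<omega>) \<partial>clock_field)) at_top"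
  proof (rule integral_dominated_convergence_at_top[where w = "\<lambda>_. B"])
    show "(\<lambda>\<omega>. f (counts (r t) \<omega>)) \<in> borel_measurable clock_field" for t
      by (rule measurable_compose[OF measurable_counts fm])
    show "(\<lambda>\<omega>. f (counts R \<omega>)) \<in> borel_measurable clock_field"
      by (rule measurable_compose[OF measurable_counts fm])
    show "eventually (\<lambda>t. AE \<omega> in clock_field. norm (f (counts (r t) \<omega>)) \<le> B) at_top"
      using B by (intro always_eventually allI AE_I2)
    show "AE \<omega> in clock_field. ((\<lambda>t. f (counts (r t) \<omega>)) \<longlongrightarrow> f (counts R \<omega>)) at_top"
      using AE
    proof eventually_elim
      case (elim \<omega>)
      show ?case
      proof (rule continuous_discrete_product_tendsto[OF f])
        fix x
        have "eventually (\<lambda>t. rings (\<omega> x) (r t x) = rings (\<omega> x) (R x)) at_top"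
          by (rule rings_eventually_eq) (use elim r in auto)
        then show "eventually (\<lambda>t. counts (r t) \<omega> x = counts R \<omega> x) at_top"
          unfolding counts_def by eventually_elim (simp only:)
      qed
    qed
  qed simp
  then show "((\<lambda>t. \<integral>\<eta>. f \<eta> \<partial>poisson_product (\<lambda>x. ennreal (r t x))) \<longlongrightarrow> (\<integral>\<eta>. f \<eta> \<partial>poisson_product (\<lambda>x. ennreal (R x)))) at_top"
    unfolding int[OF R] int[OF r(1)] .
qed

section \<open>Long-time behaviour of the density\<close>

context symmetric_walk begin

lemma rho_at_tendsto_infinity:
  assumes lam: "0 < lam" and rec: "rw_recurrent p"
  shows "((\<lambda>t. rho_at p orig lam \<rho> t x) \<longlongrightarrow> \<infinity>) at_top"
proof (rule order_tendstoI)
  fix a :: ennreal assume a: "a < \<infinity>"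
  let ?I = "\<lambda>t. \<integral>\<^sup>+s. heat p s (point orig) x * indicator {0..t} s \<partial>lborel"
  have "green x orig = \<infinity>" using rec recurrent_iff_green_infinite by blast
  then have "(?I \<longlongrightarrow> \<infinity>) at_top" using green_tendsto[of orig x] by simp
  then have "((\<lambda>t. ennreal lam * ?I t) \<longlongrightarrow> ennreal lam * \<infinity>) at_top"
    by (intro ennreal_tendsto_cmult) simp_all
  also have "ennreal lam * \<infinity> = \<infinity>" using lam by (simp add: ennreal_mult_top)
  finally have "eventually (\<lambda>t. a < ennreal lam * ?I t) at_top"
    using a by (rule order_tendstoD)
  then show "eventually (\<lambda>t. a < rho_at p orig lam \<rho> t x) at_top"
    using eventually_ge_at_top[of 0]
  proof eventually_elim
    case (elim t)
    have "ennreal lam * ?I t \<le> rho_at p orig lam \<rho> t x"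
      unfolding rho_at_eq_heat[OF elim(2)] by simp
    with elim(1) show ?case by (rule less_le_trans)
  qed
qed (simp add: top.not_eq_extremum)

lemma rho_at_le:
  assumes t: "0 \<le> t" and M: "\<And>x. \<rho> x \<le> M"
  shows "rho_at p orig lam \<rho> t x \<le> ennreal M + ennreal lam * green x orig"
  unfolding rho_at_eq_heat[OF t]
proof (rule add_mono)
  show "heat p t (\<lambda>y. ennreal (\<rho> y)) x \<le> ennreal M"
    by (rule heat_le_const[OF _ t]) (simp add: M ennreal_leI)
  show "ennreal lam * (\<integral>\<^sup>+s. heat p s (point orig) x * indicator {0..t} s \<partial>lborel) \<le> ennreal lam * green x orig"
    unfolding green_eq_integral[symmetric]
    by (intro mult_left_mono nn_integral_mono) (auto simp: indicator_def)
qed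

text \<open>Bounded initial densities stay bounded under the heat flow, so for a transient walk the density stays below
  a finite constant.\<close>

lemma rho_at_diverges_iff:
  assumes lam: "0 < lam" and bdd: "bounded (range \<rho>)"
  shows "((\<lambda>t. rho_at p orig lam \<rho> t x) \<longlongrightarrow> \<infinity>) at_top \<longleftrightarrow> rw_recurrent p"
proof
  assume div: "((\<lambda>t. rho_at p orig lam \<rho> t x) \<longlongrightarrow> \<infinity>) at_top"
  obtain M where M: "\<And>x. \<rho> x \<le> M"
    using bdd unfolding bounded_iff by (metis abs_le_D1 rangeI real_norm_def)
  let ?b = "ennreal M + ennreal lam * green x orig"
  show "rw_recurrent p"
  proof (rule ccontr)
    assume "\<not> rw_recurrent p"
    then have "green x orig \<noteq> \<infinity>" using recurrent_iff_green_infinite by blast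
    then have "?b < \<infinity>" by (simp add: ennreal_mult_less_top less_top)
    then have "eventually (\<lambda>t. ?b < rho_at p orig lam \<rho> t x) at_top"
      by (rule order_tendstoD(1)[OF div])
    then have "eventually (\<lambda>t::real. False) at_top"
      using eventually_ge_at_top[of 0]
      by eventually_elim (use rho_at_le[OF _ M] in \<open>auto simp: not_le[symmetric]\<close>)
    then show False by simp
  qed
qed (rule rho_at_tendsto_infinity[OF lam])

lemma rho_infinity_eq_green: "rho_infinity p orig lam c x = ennreal c + ennreal lam * green x orig"
proof -
  have "(\<integral>\<^sup>+s\<in>{0..}. rw_expect p x s (\<lambda>y. of_bool (y = orig)) \<partial>lborel) =
      (\<integral>\<^sup>+s. heat p s (point orig) x * indicator {0..} s \<partial>lborel)"
    by (intro nn_integral_cong) (auto simp: indicator_def rw_expect_eq_heat)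
  then show ?thesis by (simp add: rho_infinity_def green_eq_integral)
qed

text \<open>The densities increase to \<open>c + lam * green x orig\<close>. The equation for the limit is \<open>green_step\<close>: removing
  the contribution of step 0 from the Green function amounts to applying the transition operator.\<close>

lemma transient_limit:
  assumes lam: "0 \<le> lam" and trans: "rw_transient p" and c: "0 \<le> c"
  shows "rho_infinity p orig lam c x < \<infinity>"
    and "converges_weakly (irw_law p orig lam (poisson_product (\<lambda>_. ennreal c)))
            (poisson_product (rho_infinity p orig lam c))"
    and "((\<lambda>y. p x y * (enn2real (rho_infinity p orig lam c y) - enn2real (rho_infinity p orig lam c x)))
            has_sum (- lam * of_bool (x = orig))) UNIV"
proof -
  let ?I = "\<lambda>t x. \<integral>\<^sup>+s. heat p s (point orig) x * indicator {0..t} s \<partial>lborel"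
  have fin: "green x orig < \<infinity>" for x
    using trans recurrent_iff_green_infinite by (auto simp: less_top)
  define g where "g x = enn2real (green x orig)" for x
  have g: "green x orig = ennreal (g x)" "0 \<le> g x" for x using fin[of x] by (auto simp: g_def)
  define R where "R x = c + lam * g x" for x
  have R: "rho_infinity p orig lam c x = ennreal (R x)" "0 \<le> R x" for x
    using lam c g(2)[of x] by (auto simp: rho_infinity_eq_green g(1) R_def ennreal_mult)
  show "rho_infinity p orig lam c x < \<infinity>" by (simp add: R)
  have I_le: "?I t x \<le> green x orig" for t x
    unfolding green_eq_integral[symmetric] by (intro nn_integral_mono mult_left_mono) (auto simp: indicator_def)
  define K where "K t x = enn2real (?I t x)" for t x
  have K: "?I t x = ennreal (K t x)" "0 \<le> K t x" "K t x \<le> g x" for t x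
  proof -
    have le: "?I t x \<le> green x orig" by (rule I_le)
    have "?I t x < \<top>" using le fin[of x] by (auto intro: le_less_trans)
    then show e: "?I t x = ennreal (K t x)" by (simp add: K_def)
    show "0 \<le> K t x" by (simp add: K_def)
    then show "K t x \<le> g x" using le g[of x] unfolding e by simp
  qed
  have "((\<lambda>t. K t x) \<longlongrightarrow> g x) at_top" for x
    unfolding K_def[abs_def] g_def using fin[of x] by (intro tendsto_enn2real) (simp_all add: green_tendsto)
  then have conv: "((\<lambda>t. c + lam * K t x) \<longlongrightarrow> R x) at_top" for x
    unfolding R_def by (intro tendsto_intros)
  have weak: "converges_weakly (\<lambda>t. poisson_product (\<lambda>x. ennreal (c + lam * K t x))) (poisson_product (\<lambda>x. ennreal (R x)))"
    by (rule poisson_product_converges_weakly)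
      (use c lam K conv in \<open>auto simp: R_def intro!: add_nonneg_nonneg mult_nonneg_nonneg mult_left_mono\<close>)
  have law: "irw_law p orig lam (poisson_product (\<lambda>_. ennreal c)) t = poisson_product (\<lambda>x. ennreal (c + lam * K t x))"
    if "0 \<le> t" for t
  proof -
    have "rho_at p orig lam (\<lambda>_. c) t = (\<lambda>x. ennreal (c + lam * K t x))"
    proof
      fix x show "rho_at p orig lam (\<lambda>_. c) t x = ennreal (c + lam * K t x)"
        unfolding rho_at_eq_heat[OF that] heat_const[OF that] K(1) using c lam K(2)[of t x] by (simp add: ennreal_mult)
    qed
    then show ?thesis using irw_law_poisson_product[where \<rho> = "\<lambda>_. c" and lam = lam and t = t and orig = orig] c lam that by simp
  qed
  have Req: "rho_infinity p orig lam c = (\<lambda>x. ennreal (R x))" using R(1) by auto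
  show "converges_weakly (irw_law p orig lam (poisson_product (\<lambda>_. ennreal c))) (poisson_product (rho_infinity p orig lam c))"
    unfolding converges_weakly_def Req
  proof (intro allI impI)
    fix f :: "('v \<Rightarrow> enat) \<Rightarrow> real"
    assume f: "continuous_map (product_topology (\<lambda>_. discrete_topology UNIV) UNIV) euclideanreal f \<and> bounded (range f)"
    have "((\<lambda>t. \<integral>\<eta>. f \<eta> \<partial>poisson_product (\<lambda>x. ennreal (c + lam * K t x))) \<longlongrightarrow> (\<integral>\<eta>. f \<eta> \<partial>poisson_product (\<lambda>x. ennreal (R x)))) at_top"
      using weak f unfolding converges_weakly_def by blast
    moreover have "eventually (\<lambda>t. (\<integral>\<eta>. f \<eta> \<partial>poisson_product (\<lambda>x. ennreal (c + lam * K t x))) =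
        (\<integral>\<eta>. f \<eta> \<partial>irw_law p orig lam (poisson_product (\<lambda>_. ennreal c)) t)) at_top"
      using eventually_ge_at_top[of 0] by eventually_elim (simp only: law)
    ultimately show "((\<lambda>t. \<integral>\<eta>. f \<eta> \<partial>irw_law p orig lam (poisson_product (\<lambda>_. ennreal c)) t) \<longlongrightarrow> (\<integral>\<eta>. f \<eta> \<partial>poisson_product (\<lambda>x. ennreal (R x)))) at_top"
      by (rule Lim_transform_eventually)
  qed
  have Pg: "P (\<lambda>y. ennreal (g y)) x + of_bool (x = orig) = ennreal (g x)"
    using green_step[of x orig] by (simp add: g(1) add.commute)
  then have "P (\<lambda>y. ennreal (g y)) x \<noteq> \<top>" by auto
  then obtain q where q: "P (\<lambda>y. ennreal (g y)) x = ennreal q" "0 \<le> q" by (cases "P (\<lambda>y. ennreal (g y)) x") auto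
  have q_eq: "q + of_bool (x = orig) = g x"
  proof -
    have "ennreal (q + of_bool (x = orig)) = ennreal q + of_bool (x = orig)"
      using q(2) by (cases "x = orig") simp_all
    then have "ennreal (q + of_bool (x = orig)) = ennreal (g x)" using Pg q(1) by simp
    then show ?thesis using q(2) g(2)[of x] by (subst (asm) ennreal_inj) auto
  qed
  have "((\<lambda>y. p x y * g y) has_sum q) UNIV"
    using trans_op_real[of g x] g(2) q by simp
  then have "((\<lambda>y. lam * (p x y * (g y - g x))) has_sum (lam * (q - g x))) UNIV"
    by (intro has_sum_cmult_right generator_has_sum)
  moreover have "lam * (q - g x) = - lam * of_bool (x = orig)"
  proof -
    have "q - g x = - of_bool (x = orig)" using q_eq by simp
    then show ?thesis by (simp only: mult_minus_right mult_minus_left)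
  qed
  moreover have "lam * (p x y * (g y - g x)) =
      p x y * (enn2real (rho_infinity p orig lam c y) - enn2real (rho_infinity p orig lam c x))" for y
    unfolding R(1) enn2real_ennreal[OF R(2)] by (simp add: R_def algebra_simps)
  ultimately show "((\<lambda>y. p x y * (enn2real (rho_infinity p orig lam c y) - enn2real (rho_infinity p orig lam c x)))
            has_sum (- lam * of_bool (x = orig))) UNIV"
    by simp
qed

end

section \<open>The proposition\<close>

theorem proposition5p2:
  fixes p :: "'v::countable \<Rightarrow> 'v \<Rightarrow> real" and orig :: 'v and lam :: real
  assumes rw: "irreducible_symmetric_rw p" and lam: "0 \<le> lam"
  shows
    "(\<forall>\<Lambda> f. finite \<Lambda> \<and> depends_on \<Lambda> f \<and> (\<forall>z. G_exists \<Lambda> f z) \<and> smooth (G_op \<Lambda> f) \<longrightarrow>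
        (\<forall>z.
          (\<forall>(x, y)\<in>site_pairs.
             depends_on (\<Lambda> \<union> {x, y}) (irw_pair_term p f x y) \<and>
             G_exists (\<Lambda> \<union> {x, y}) (irw_pair_term p f x y) z) \<and>
          depends_on (\<Lambda> \<union> {orig}) (irw_source_term orig lam f) \<and>
          G_exists (\<Lambda> \<union> {orig}) (irw_source_term orig lam f) z \<and>
          (G_irw_gen_converges p \<Lambda> f z \<longleftrightarrow> det_gen_converges p (G_op \<Lambda> f) z) \<and>
          ((\<forall>x. (\<lambda>y. p x y * \<bar>z y\<bar>) summable_on UNIV) \<longrightarrow> G_irw_gen_converges p \<Lambda> f z) \<and>
          G_irw_gen p orig lam \<Lambda> f z = det_gen p orig lam (G_op \<Lambda> f) z))
     \<and>
     (\<forall>\<rho>. (\<forall>x. 0 \<le> \<rho> x) \<longrightarrow>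
        (\<forall>t\<ge>0. irw_law p orig lam (poisson_product (\<lambda>x. ennreal (\<rho> x))) t
                 = poisson_product (rho_at p orig lam \<rho> t)) \<and>
        (\<forall>T>0. (\<forall>t\<in>{0..<T}. \<forall>x. rho_at p orig lam \<rho> t x < \<infinity>) \<longrightarrow>
           solves_det_system p orig lam T (\<lambda>t x. enn2real (rho_at p orig lam \<rho> t x)) \<and>
           (\<forall>x. enn2real (rho_at p orig lam \<rho> 0 x) = \<rho> x) \<and>
           (\<forall>z. solves_det_system p orig lam T z \<and> (\<forall>x. z 0 x = \<rho> x) \<and>
                 (\<forall>t\<in>{0..<T}. \<forall>x. 0 \<le> z t x) \<longrightarrow>
                 (\<forall>t\<in>{0..<T}. \<forall>x. z t x = enn2real (rho_at p orig lam \<rho> t x)))))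
     \<and>
     (0 < lam \<longrightarrow>
        (\<forall>\<rho>. (\<forall>x. 0 \<le> \<rho> x) \<longrightarrow>
          (rw_recurrent p \<longrightarrow> (\<forall>x. ((\<lambda>t. rho_at p orig lam \<rho> t x) \<longlongrightarrow> \<infinity>) at_top)) \<and>
          (bounded (range \<rho>) \<longrightarrow>
             (\<forall>x. ((\<lambda>t. rho_at p orig lam \<rho> t x) \<longlongrightarrow> \<infinity>) at_top \<longleftrightarrow> rw_recurrent p))))
     \<and>
     (rw_transient p \<longrightarrow>
        (\<forall>c\<ge>0.
          (\<forall>x. rho_infinity p orig lam c x < \<infinity>) \<and>
          converges_weakly (irw_law p orig lam (poisson_product (\<lambda>_. ennreal c)))
            (poisson_product (rho_infinity p orig lam c)) \<and>
          (\<forall>x. (\<lambda>y. p x y * (enn2real (rho_infinity p orig lam c y)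
                              - enn2real (rho_infinity p orig lam c x))) summable_on UNIV \<and>
               L_RW p (\<lambda>y. enn2real (rho_infinity p orig lam c y)) x
                 = - lam * of_bool (x = orig))))"
proof -
  interpret symmetric_walk p by unfold_locales (rule rw)
  show ?thesis
  proof (intro conjI)
    show "\<forall>\<Lambda> f. finite \<Lambda> \<and> depends_on \<Lambda> f \<and> (\<forall>z. G_exists \<Lambda> f z) \<and> smooth (G_op \<Lambda> f) \<longrightarrow>
        (\<forall>z.
          (\<forall>(x, y)\<in>site_pairs.
             depends_on (\<Lambda> \<union> {x, y}) (irw_pair_term p f x y) \<and>
             G_exists (\<Lambda> \<union> {x, y}) (irw_pair_term p f x y) z) \<and>
          depends_on (\<Lambda> \<union> {orig}) (irw_source_term orig lam f) \<and>
          G_exists (\<Lambda> \<union> {orig}) (irw_source_term orig lam f) z \<and>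
          (G_irw_gen_converges p \<Lambda> f z \<longleftrightarrow> det_gen_converges p (G_op \<Lambda> f) z) \<and>
          ((\<forall>x. (\<lambda>y. p x y * \<bar>z y\<bar>) summable_on UNIV) \<longrightarrow> G_irw_gen_converges p \<Lambda> f z) \<and>
          G_irw_gen p orig lam \<Lambda> f z = det_gen p orig lam (G_op \<Lambda> f) z)"
      by (intro allI impI, elim conjE) (rule G_irw_gen_eq_det_gen[OF rw], blast+)
  next
    show "\<forall>\<rho>. (\<forall>x. 0 \<le> \<rho> x) \<longrightarrow>
        (\<forall>t\<ge>0. irw_law p orig lam (poisson_product (\<lambda>x. ennreal (\<rho> x))) t
                 = poisson_product (rho_at p orig lam \<rho> t)) \<and>
        (\<forall>T>0. (\<forall>t\<in>{0..<T}. \<forall>x. rho_at p orig lam \<rho> t x < \<infinity>) \<longrightarrow>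
           solves_det_system p orig lam T (\<lambda>t x. enn2real (rho_at p orig lam \<rho> t x)) \<and>
           (\<forall>x. enn2real (rho_at p orig lam \<rho> 0 x) = \<rho> x) \<and>
           (\<forall>z. solves_det_system p orig lam T z \<and> (\<forall>x. z 0 x = \<rho> x) \<and>
                 (\<forall>t\<in>{0..<T}. \<forall>x. 0 \<le> z t x) \<longrightarrow>
                 (\<forall>t\<in>{0..<T}. \<forall>x. z t x = enn2real (rho_at p orig lam \<rho> t x))))"
    proof (intro allI impI conjI ballI)
      fix \<rho> :: "'v \<Rightarrow> real" assume \<rho>: "\<forall>x. 0 \<le> \<rho> x"
      show "irw_law p orig lam (poisson_product (\<lambda>x. ennreal (\<rho> x))) t = poisson_product (rho_at p orig lam \<rho> t)"
        if "0 \<le> t" for t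
        using \<rho> lam that by (intro irw_law_poisson_product) auto
      fix T :: real
      assume T: "0 < T" and fin: "\<forall>t\<in>{0..<T}. \<forall>x. rho_at p orig lam \<rho> t x < \<infinity>"
      show sol: "solves_det_system p orig lam T (\<lambda>t x. enn2real (rho_at p orig lam \<rho> t x))"
        using \<rho> lam T fin by (intro solves_det_system_rho_at) auto
      show init: "enn2real (rho_at p orig lam \<rho> 0 x) = \<rho> x" for x
        using \<rho> by (simp add: rho_at_0)
      fix z t x
      assume z: "solves_det_system p orig lam T z \<and> (\<forall>x. z 0 x = \<rho> x) \<and> (\<forall>t\<in>{0..<T}. \<forall>x. 0 \<le> z t x)"
        and t: "t \<in> {0..<T}"
      show "z t x = enn2real (rho_at p orig lam \<rho> t x)"
        by (rule nonneg_solution_unique[OF _ _ sol _ _ lam]) (use z t init in auto)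
    qed
  next
    show "0 < lam \<longrightarrow>
        (\<forall>\<rho>. (\<forall>x. 0 \<le> \<rho> x) \<longrightarrow>
          (rw_recurrent p \<longrightarrow> (\<forall>x. ((\<lambda>t. rho_at p orig lam \<rho> t x) \<longlongrightarrow> \<infinity>) at_top)) \<and>
          (bounded (range \<rho>) \<longrightarrow>
             (\<forall>x. ((\<lambda>t. rho_at p orig lam \<rho> t x) \<longlongrightarrow> \<infinity>) at_top \<longleftrightarrow> rw_recurrent p)))"
      using rho_at_tendsto_infinity rho_at_diverges_iff by blast
  next
    show "rw_transient p \<longrightarrow>
        (\<forall>c\<ge>0.
          (\<forall>x. rho_infinity p orig lam c x < \<infinity>) \<and>
          converges_weakly (irw_law p orig lam (poisson_product (\<lambda>_. ennreal c)))
            (poisson_product (rho_infinity p orig lam c)) \<and>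
          (\<forall>x. (\<lambda>y. p x y * (enn2real (rho_infinity p orig lam c y)
                              - enn2real (rho_infinity p orig lam c x))) summable_on UNIV \<and>
               L_RW p (\<lambda>y. enn2real (rho_infinity p orig lam c y)) x
                 = - lam * of_bool (x = orig)))"
    proof (intro impI allI conjI)
      fix c :: real and x
      assume trans: "rw_transient p" and c: "0 \<le> c"
      note limit = transient_limit[OF lam trans c]
      show "rho_infinity p orig lam c x < \<infinity>" by (rule limit)
      show "converges_weakly (irw_law p orig lam (poisson_product (\<lambda>_. ennreal c)))
            (poisson_product (rho_infinity p orig lam c))" by (rule limit)
      show "(\<lambda>y. p x y * (enn2real (rho_infinity p orig lam c y)
                              - enn2real (rho_infinity p orig lam c x))) summable_on UNIV"
        by (rule has_sum_imp_summable[OF limit(3)])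
      show "L_RW p (\<lambda>y. enn2real (rho_infinity p orig lam c y)) x = - lam * of_bool (x = orig)"
        unfolding L_RW_def by (rule infsumI[OF limit(3)])
    qed
  qed
qed

end
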